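(* Let $B$ be a finite set of Boolean functions. Then $\mathrm{MC}(\{\mathbf{S}\},B)$ is solvable in deterministic logarithmic space.
   Context: For a finite set $B$ of Boolean functions, temporal $B$-formulae over $\{\mathbf{S}\}$ are built from propositional variables by applying functions from $B$ and the binary operator $\mathbf{S}$. A Kripke structure is $K=(W,R,\eta)$ with $W$ finite, $R\subseteq W\times W$ total, $\eta:W\to2^{\mathrm{VAR}}$; a path is an infinite sequence $p=(p_0,p_1,\dots)$ with $p_iRp_{i+1}$. Satisfaction: $p,i\vDash x$ iff $x\in\eta(p_i)$; $p,i\vDash f(\varphi_1,\dots,\varphi_n)$ iff $f$ of the truth values at $i$ is $1$; $p,i\vDash\varphi_1\mathbf{S}\varphi_2$ iff there is $\ell$ with $0\le\ell\le i$, $p,\ell\vDash\varphi_2$ and $p,j\vDash\varphi_1$ for all $\ell<j\le i$. $\mathrm{MC}(\{\mathbf{S}\},B)$: given such a formula $\varphi$, a Kripke structure $K$ and a state $a$, decide whether some path $p$ with $p_0=a$ has $p,0\vDash\varphi$. *)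

theory Defs
  imports Complex_Main "HOL-Library.Landau_Symbols"
begin

section \<open>Temporal formulae with Since over Kripke structures\<close>

text \<open>
  A Boolean function is a pair of its arity n and a map on bit lists; only the values of the map
  on lists of length n matter. Arity 0 (constants) is allowed.
\<close>

type_synonym bool_fun = "nat \<times> (bool list \<Rightarrow> bool)"

datatype 'v fm =
    Var 'v
  | App bool_fun "'v fm list"
  | Since "'v fm" "'v fm"

inductive_set B_formulae :: "bool_fun set \<Rightarrow> 'v fm set" for B :: "bool_fun set" where
  "Var x \<in> B_formulae B"
| "(n, f) \<in> B \<Longrightarrow> length \<phi>s = n \<Longrightarrow> (\<And>\<phi>. \<phi> \<in> set \<phi>s \<Longrightarrow> \<phi> \<in> B_formulae B)
     \<Longrightarrow> App (n, f) \<phi>s \<in> B_formulae B"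
| "\<phi> \<in> B_formulae B \<Longrightarrow> \<psi> \<in> B_formulae B \<Longrightarrow> Since \<phi> \<psi> \<in> B_formulae B"

record ('s, 'v) kripke =
  worlds :: "'s set"
  rel :: "('s \<times> 's) set"
  label :: "'s \<Rightarrow> 'v set"

definition kripke_structure :: "('s, 'v) kripke \<Rightarrow> bool" where
  "kripke_structure K \<longleftrightarrow>
     finite (worlds K) \<and> rel K \<subseteq> worlds K \<times> worlds K \<and>
     (\<forall>s\<in>worlds K. \<exists>t. (s, t) \<in> rel K)"

definition is_path :: "('s, 'v) kripke \<Rightarrow> (nat \<Rightarrow> 's) \<Rightarrow> bool" where
  "is_path K p \<longleftrightarrow> (\<forall>i. (p i, p (Suc i)) \<in> rel K)"

fun sat :: "('s, 'v) kripke \<Rightarrow> (nat \<Rightarrow> 's) \<Rightarrow> nat \<Rightarrow> 'v fm \<Rightarrow> bool" where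
  "sat K p i (Var x) \<longleftrightarrow> x \<in> label K (p i)"
| "sat K p i (App (n, f) \<phi>s) \<longleftrightarrow> f (map (sat K p i) \<phi>s)"
| "sat K p i (Since \<phi> \<psi>) \<longleftrightarrow>
     (\<exists>l\<le>i. sat K p l \<psi> \<and> (\<forall>j. l < j \<and> j \<le> i \<longrightarrow> sat K p j \<phi>))"


section \<open>The model checking problem as a language\<close>

text \<open>
  Variables and states are named by bit strings. An instance is written as a word over a finite
  alphabet having one connective symbol for each member of B. Formulae are written in prefix
  notation (as trees, without sharing), which is uniquely readable because each connective has a
  fixed arity. The sets constituting the Kripke structure are given by listing their elements, in
  any order and possibly with repetitions. Words that do not describe an instance are not in the
  language.
\<close>

type_synonym name = "bool list"

datatype symbol =
    Bit bool
  | Var_Sym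
  | Fun_Sym bool_fun
  | Since_Sym
  | Init_Sym
  | World_Sym
  | Edge_Sym
  | Label_Sym
  | Sep

definition alphabet :: "bool_fun set \<Rightarrow> symbol set" where
  "alphabet B = range Bit \<union> Fun_Sym ` B \<union>
     {Var_Sym, Since_Sym, Init_Sym, World_Sym, Edge_Sym, Label_Sym, Sep}"

abbreviation enc_name :: "name \<Rightarrow> symbol list" where
  "enc_name \<equiv> map Bit"

primrec enc_fm :: "name fm \<Rightarrow> symbol list" where
  "enc_fm (Var x) = Var_Sym # enc_name x"
| "enc_fm (App f \<phi>s) = Fun_Sym f # concat (map enc_fm \<phi>s)"
| "enc_fm (Since \<phi> \<psi>) = Since_Sym # enc_fm \<phi> @ enc_fm \<psi>"

definition enc_pair :: "symbol \<Rightarrow> name \<times> name \<Rightarrow> symbol list" where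
  "enc_pair m = (\<lambda>(x, y). m # enc_name x @ Sep # enc_name y)"

text \<open>
  A word is an encoding only if the label sets of all states are finite; labels outside the set of
  states are irrelevant.
\<close>

definition encodes_kripke :: "symbol list \<Rightarrow> (name, name) kripke \<Rightarrow> bool" where
  "encodes_kripke u K \<longleftrightarrow>
     (\<exists>ws es ls.
        set ws = worlds K \<and> set es = rel K \<and>
        set ls = {(s, x). s \<in> worlds K \<and> x \<in> label K s} \<and>
        u = concat (map (\<lambda>s. World_Sym # enc_name s) ws) @
            concat (map (enc_pair Edge_Sym) es) @
            concat (map (enc_pair Label_Sym) ls))"

definition encodes_instance ::
    "symbol list \<Rightarrow> name fm \<Rightarrow> (name, name) kripke \<Rightarrow> name \<Rightarrow> bool" where
  "encodes_instance w \<phi> K a \<longleftrightarrow>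
     (\<exists>u. encodes_kripke u K \<and> w = enc_fm \<phi> @ Init_Sym # enc_name a @ u)"

definition MC_Since :: "bool_fun set \<Rightarrow> symbol list set" where
  "MC_Since B = {w. \<exists>\<phi> K a.
     \<phi> \<in> B_formulae B \<and> kripke_structure K \<and> a \<in> worlds K \<and> encodes_instance w \<phi> K a \<and>
     (\<exists>p. is_path K p \<and> p 0 = a \<and> sat K p 0 \<phi>)}"


section \<open>Deterministic logarithmic space\<close>

text \<open>
  Deterministic Turing machines with a two-way read-only input tape, delimited by end markers, and
  a fixed number of one-way infinite work tapes. A head told to leave its tape stays where it is.
\<close>

datatype 'a cell = Left_End | Inp 'a | Right_End

datatype move = Move_Left | Stay | Move_Right

record ('q, 'g, 'a) tm =
  states :: "'q set"
  work_alphabet :: "'g set"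
  num_tapes :: nat
  blank :: 'g
  start :: 'q
  accept :: 'q
  reject :: 'q
  delta :: "'q \<Rightarrow> 'a cell \<Rightarrow> 'g list \<Rightarrow> 'q \<times> move \<times> ('g \<times> move) list"

definition turing_machine :: "'a set \<Rightarrow> ('q, 'g, 'a) tm \<Rightarrow> bool" where
  "turing_machine \<Sigma> M \<longleftrightarrow>
     finite (states M) \<and> finite (work_alphabet M) \<and> blank M \<in> work_alphabet M \<and>
     start M \<in> states M \<and> accept M \<in> states M \<and> reject M \<in> states M \<and> accept M \<noteq> reject M \<and>
     (\<forall>q \<in> states M - {accept M, reject M}.
      \<forall>c \<in> {Left_End, Right_End} \<union> Inp ` \<Sigma>.
      \<forall>gs \<in> lists (work_alphabet M). length gs = num_tapes M \<longrightarrow>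
        (case delta M q c gs of (q', d, acts) \<Rightarrow>
           q' \<in> states M \<and> length acts = num_tapes M \<and> fst ` set acts \<subseteq> work_alphabet M))"

type_synonym 'g tape = "(nat \<Rightarrow> 'g) \<times> nat"

type_synonym ('q, 'g) config = "'q \<times> nat \<times> 'g tape list"

fun move_head :: "move \<Rightarrow> nat \<Rightarrow> nat" where
  "move_head Move_Left h = h - 1"
| "move_head Stay h = h"
| "move_head Move_Right h = Suc h"

definition input_cell :: "'a list \<Rightarrow> nat \<Rightarrow> 'a cell" where
  "input_cell w h =
     (if h = 0 then Left_End else if h \<le> length w then Inp (w ! (h - 1)) else Right_End)"

definition act :: "'g tape \<Rightarrow> 'g \<times> move \<Rightarrow> 'g tape" where
  "act = (\<lambda>(t, h) (g, d). (t(h := g), move_head d h))"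

definition initial :: "('q, 'g, 'a) tm \<Rightarrow> ('q, 'g) config" where
  "initial M = (start M, 0, replicate (num_tapes M) (\<lambda>_. blank M, 0))"

definition step :: "('q, 'g, 'a) tm \<Rightarrow> 'a list \<Rightarrow> ('q, 'g) config \<Rightarrow> ('q, 'g) config" where
  "step M w = (\<lambda>(q, h, ts).
     if q = accept M \<or> q = reject M then (q, h, ts)
     else case delta M q (input_cell w h) (map (\<lambda>(t, i). t i) ts) of
       (q', d, acts) \<Rightarrow> (q', min (move_head d h) (Suc (length w)), map2 act ts acts))"

definition config_at :: "('q, 'g, 'a) tm \<Rightarrow> 'a list \<Rightarrow> nat \<Rightarrow> ('q, 'g) config" where
  "config_at M w t = (step M w ^^ t) (initial M)"

definition decides :: "('q, 'g, 'a) tm \<Rightarrow> 'a set \<Rightarrow> 'a list set \<Rightarrow> bool" where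
  "decides M \<Sigma> L \<longleftrightarrow>
     (\<forall>w \<in> lists \<Sigma>. \<exists>t. fst (config_at M w t) = (if w \<in> L then accept M else reject M))"

text \<open>
  Space is the number of cells visited on a work tape; the input tape is not counted.
\<close>

definition runs_in_space :: "('q, 'g, 'a) tm \<Rightarrow> 'a set \<Rightarrow> (nat \<Rightarrow> nat) \<Rightarrow> bool" where
  "runs_in_space M \<Sigma> s \<longleftrightarrow>
     (\<forall>w \<in> lists \<Sigma>. \<forall>t. \<forall>(tp, i) \<in> set (snd (snd (config_at M w t))). Suc i \<le> s (length w))"

text \<open>
  Since the sets of states and work symbols are finite, taking them to be sets of natural numbers
  is no restriction.
\<close>

definition logspace_decidable :: "'a set \<Rightarrow> 'a list set \<Rightarrow> bool" where
  "logspace_decidable \<Sigma> L \<longleftrightarrow>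
     finite \<Sigma> \<and> L \<subseteq> lists \<Sigma> \<and>
     (\<exists>(M :: (nat, nat, 'a) tm) s.
        turing_machine \<Sigma> M \<and> decides M \<Sigma> L \<and> runs_in_space M \<Sigma> s \<and>
        (\<lambda>n. real (s n)) \<in> O(\<lambda>n. ln (real n)))"

end

theory Submission
  imports Defs
begin

text \<open>
  At the first position of a path, a formula \<phi> S \<psi> holds iff \<psi> holds, so the satisfaction of a
  formula there depends only on the label of the initial state, and by totality there is always a
  path. What remains is to check the syntax of the instance and to evaluate a formula over an
  arbitrary finite basis. A formula is read as a binary tree (first argument, next sibling), with
  lists of truth values as the values of subtrees. Visiting the child with the longer encoding
  first, one has to store an intermediate value only when descending into a subtree of at most half
  the length, so a stack of logarithmic height is enough, and it fits into one number of
  polynomial size. Turing machines are replaced by while programs over polynomially bounded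
  counters.
\<close>

section \<open>While programs over bounded counters\<close>

text \<open>The degree of the polynomial is explicit. If R bounds all arities, a forest has at most
  R formulae, and the list of their truth values is coded by a number below q = 2 ^ (R + 1). A stack
  of log n such digits is below q ^ (log n) = n ^ (R + 1), so counters bounded by (n + 2) ^ (R + 1)
  suffice.

  Nothing about the way back to the root is stored. Ends of subformulae, siblings and parents are
  recomputed from a bare position by counting open argument slots, which is itself a search with
  bounded counters.

  Two obstacles shape the functions that are used. A counter cannot exceed its bound, so successors,
  sums and products are truncated, and each use needs a reason why the truncation is harmless.
  Moreover a program has to halt on malformed words too, so the evaluation loop is guarded by the
  syntax check, and the operations at the nodes are finite tables with default value 0.\<close>

datatype 'a tst = Pos nat | Head "'a cell set"

datatype 'a com =
    Skip
  | Accept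
  | Inc nat
  | Dec nat
  | Move move
  | Seq "'a com" "'a com"
  | Cond "'a tst" "'a com" "'a com"
  | While "'a tst" "'a com"

fun tval :: "'a list \<Rightarrow> 'a tst \<Rightarrow> nat \<Rightarrow> (nat \<Rightarrow> nat) \<Rightarrow> bool" where
  "tval w (Pos v) h s \<longleftrightarrow> s v \<noteq> 0"
| "tval w (Head S) h s \<longleftrightarrow> input_cell w h \<in> S"

fun tst_vars :: "'a tst \<Rightarrow> nat set" where
  "tst_vars (Pos v) = {v}"
| "tst_vars (Head S) = {}"

primrec vars :: "'a com \<Rightarrow> nat set" where
  "vars Skip = {}"
| "vars Accept = {}"
| "vars (Inc v) = {v}"
| "vars (Dec v) = {v}"
| "vars (Move d) = {}"
| "vars (Seq a b) = vars a \<union> vars b"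
| "vars (Cond t a b) = tst_vars t \<union> vars a \<union> vars b"
| "vars (While t a) = tst_vars t \<union> vars a"

lemma finite_vars: "finite (vars c)"
proof -
  have "finite (tst_vars t)" for t :: "'a tst" by (cases t) auto
  then show ?thesis by (induction c) auto
qed

text \<open>\<open>p\<close> is the outcome of the test at the head of the continuation. Semantics
  and machine branch by this same function.\<close>

fun follow :: "bool \<Rightarrow> 'a com list \<Rightarrow> 'a com list" where
  "follow p (Seq a b # K) = a # b # K"
| "follow p (Cond t a b # K) = (if p then a else b) # K"
| "follow p (While t a # K) = (if p then a # While t a # K else K)"
| "follow p (c # K) = K"
| "follow p [] = []"

text \<open>Accept has no transition: a program that gets stuck there accepts, one that ends rejects.\<close>

inductive small :: "'a list \<Rightarrow> nat \<Rightarrow> 'a com list \<times> nat \<times> (nat \<Rightarrow> nat)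
    \<Rightarrow> 'a com list \<times> nat \<times> (nat \<Rightarrow> nat) \<Rightarrow> bool" for w N where
  small_Skip: "small w N (Skip # K, h, s) (K, h, s)"
| small_Inc: "s v < N \<Longrightarrow> small w N (Inc v # K, h, s) (K, h, s(v := Suc (s v)))"
| small_Dec: "0 < s v \<Longrightarrow> small w N (Dec v # K, h, s) (K, h, s(v := s v - 1))"
| small_Move: "small w N (Move d # K, h, s) (K, min (move_head d h) (Suc (length w)), s)"
| small_Seq: "small w N (Seq a b # K, h, s) (a # b # K, h, s)"
| small_Cond: "small w N (Cond t a b # K, h, s) (follow (tval w t h s) (Cond t a b # K), h, s)"
| small_While: "small w N (While t a # K, h, s) (follow (tval w t h s) (While t a # K), h, s)"

text \<open>The continuations that can occur while \<open>c\<close> runs on top of \<open>K\<close>.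
  There are finitely many, since a loop puts itself below its body instead of being unfolded; so
  they can serve as control states.\<close>

fun conts :: "'a com \<Rightarrow> 'a com list \<Rightarrow> 'a com list set" where
  "conts (Seq a b) K = insert (Seq a b # K) (conts a (b # K) \<union> conts b K)"
| "conts (Cond t a b) K = insert (Cond t a b # K) (conts a K \<union> conts b K)"
| "conts (While t a) K = insert (While t a # K) (conts a (While t a # K))"
| "conts c K = {c # K}"

lemma finite_conts: "finite (conts c K)"
  by (induction c K rule: conts.induct) auto

lemma conts_self: "c # K \<in> conts c K"
  by (cases c) auto

lemma follow_conts: "cl \<in> conts c K \<Longrightarrow> follow p cl \<in> insert K (conts c K)"
  using conts_self by (induction c K rule: conts.induct) (fastforce split: if_splits)+

lemma vars_conts: "cl \<in> conts c K \<Longrightarrow> \<Union> (vars ` set cl) \<subseteq> vars c \<union> \<Union> (vars ` set K)"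
  by (induction c K rule: conts.induct) auto

section \<open>Binary counters on work tapes\<close>

datatype phase = Boot | Start | Scan | Back nat

text \<open>
  A counter is stored with the least significant digit first. Symbol 0 is blank, 1 and 2 are the
  binary digits zero and one, and 3 marks the first cell, because a machine cannot sense the end
  of its tape.
\<close>

fun tape :: "nat list \<Rightarrow> nat \<Rightarrow> nat" where
  "tape ds 0 = 3"
| "tape ds (Suc i) = (if i < length ds then ds ! i else 0)"

primrec dval :: "nat list \<Rightarrow> nat" where
  "dval [] = 0"
| "dval (d # ds) = (d - 1) + 2 * dval ds"

text \<open>Increment, decrement and zero test are instances of a single scan over the digits.\<close>

fun scan :: "nat \<Rightarrow> nat \<Rightarrow> (nat \<Rightarrow> nat) \<Rightarrow> nat list \<Rightarrow> nat list \<times> nat" where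
  "scan p p' sw [] = (if sw 0 = 0 then [] else [sw 0], 0)"
| "scan p p' sw (d # ds) =
     (if d = p then (p' # fst (scan p p' sw ds), snd (scan p p' sw ds)) else (sw d # ds, d))"

lemma tape_upd: "(tape (ys @ x # zs))(Suc (length ys) := y) = tape (ys @ y # zs)"
proof
  fix i show "((tape (ys @ x # zs))(Suc (length ys) := y)) i = tape (ys @ y # zs) i"
    by (cases i) (auto simp: nth_append nth_Cons split: nat.splits)
qed

lemma tape_upd_end: "(tape ys)(Suc (length ys) := y) = tape (ys @ (if y = 0 then [] else [y]))"
proof
  fix i show "((tape ys)(Suc (length ys) := y)) i = tape (ys @ (if y = 0 then [] else [y])) i"
    by (cases i) (auto simp: nth_append nth_Cons split: nat.splits)
qed

text \<open>A digit is appended only if all binary digits are one, that is, when the new value is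
  \<open>2 ^ length ds\<close>. Thus a tape grows only with the value of its counter.\<close>

lemma scan_inc:
  assumes "set ds \<subseteq> {1, 2}"
  shows "dval (fst (scan 2 1 (\<lambda>_. 2) ds)) = Suc (dval ds)"
    and "set (fst (scan 2 1 (\<lambda>_. 2) ds)) \<subseteq> {1, 2}"
    and "length (fst (scan 2 1 (\<lambda>_. 2) ds)) = length ds \<or>
      length (fst (scan 2 1 (\<lambda>_. 2) ds)) = Suc (length ds) \<and> Suc (dval ds) = 2 ^ length ds"
  using assms by (induction ds) auto

text \<open>Borrowing turns the zeros passed into ones. The number of digits stays the same, so
  zeros may remain at the top.\<close>

lemma scan_dec:
  assumes "set ds \<subseteq> {1, 2}" "dval ds > 0"
  shows "dval (fst (scan 1 2 (\<lambda>_. 1) ds)) = dval ds - 1"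
    and "set (fst (scan 1 2 (\<lambda>_. 1) ds)) \<subseteq> {1, 2}"
    and "length (fst (scan 1 2 (\<lambda>_. 1) ds)) = length ds"
  using assms by (induction ds) auto

text \<open>Nothing is rewritten: the scan skips zeros and stops at a one, or at the blank when the
  number is zero.\<close>

lemma scan_test:
  assumes "set ds \<subseteq> {1, 2}"
  shows "fst (scan 1 1 (\<lambda>g. g) ds) = ds"
    and "snd (scan 1 1 (\<lambda>g. g) ds) = 2 \<longleftrightarrow> dval ds \<noteq> 0"
  using assms by (induction ds) auto

section \<open>A Turing machine executing a program\<close>

fun tape_var :: "'a com list \<Rightarrow> nat option" where
  "tape_var (Inc v # K) = Some v"
| "tape_var (Dec v # K) = Some v"
| "tape_var (Cond (Pos v) a b # K) = Some v"
| "tape_var (While (Pos v) a # K) = Some v"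
| "tape_var _ = None"

fun passed :: "'a com list \<Rightarrow> nat" where
  "passed (Inc v # K) = 2"
| "passed _ = 1"

fun pass_write :: "'a com list \<Rightarrow> nat" where
  "pass_write (Dec v # K) = 2"
| "pass_write _ = 1"

fun stop_write :: "'a com list \<Rightarrow> nat \<Rightarrow> nat" where
  "stop_write (Inc v # K) g = 2"
| "stop_write (Dec v # K) g = 1"
| "stop_write _ g = g"

fun in_move :: "'a com list \<Rightarrow> move" where
  "in_move (Move d # K) = d"
| "in_move _ = Stay"

fun in_test :: "'a com list \<Rightarrow> 'a cell set" where
  "in_test (Cond (Head S) a b # K) = S"
| "in_test (While (Head S) a # K) = S"
| "in_test _ = {}"

text \<open>\<open>enc\<close> numbers the pairs of a continuation and a phase, because
  \<open>logspace_decidable\<close> asks for states that are natural numbers.\<close>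

locale counter_machine =
  fixes prog :: "'a com" and k :: nat and enc :: "'a com list \<times> phase \<Rightarrow> nat"
  assumes vars_prog: "vars prog \<subseteq> {..<k}"
    and inj_enc: "inj_on enc ((conts prog [] \<union> {[], [Accept]}) \<times> ({Boot, Start, Scan} \<union> Back ` {0..3}))"
begin

definition "ctrl = conts prog [] \<union> {[], [Accept]}"
definition "phases = {Boot, Start, Scan} \<union> Back ` {0..3}"
definition "Q = ctrl \<times> phases"

definition "tacts v g d gs = map (\<lambda>j. if Some j = v then (g, d) else (gs ! j, Stay)) [0..<k]"

text \<open>\<open>Boot\<close> writes the end markers. \<open>Scan\<close> moves right over the
  digits of the counter concerned, and \<open>Back g\<close> carries the digit \<open>g\<close> that
  ended the scan back to the marker, where it decides a branch. Commands that touch no counter are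
  executed in \<open>Start\<close> at once.\<close>

fun trans :: "'a com list \<times> phase \<Rightarrow> 'a cell \<Rightarrow> nat list
    \<Rightarrow> ('a com list \<times> phase) \<times> move \<times> (nat \<times> move) list" where
  "trans (cl, Boot) c gs = (([prog], Start), Stay, map (\<lambda>j. (3, Stay)) [0..<k])"
| "trans (cl, Start) c gs = (case tape_var cl of
      Some v \<Rightarrow> ((cl, Scan), Stay, tacts (Some v) (gs ! v) Move_Right gs)
    | None \<Rightarrow> ((follow (c \<in> in_test cl) cl, Start), in_move cl, tacts None 0 Stay gs))"
| "trans (cl, Scan) c gs = (case tape_var cl of
      Some v \<Rightarrow> if gs ! v = passed cl
        then ((cl, Scan), Stay, tacts (Some v) (pass_write cl) Move_Right gs)
        else ((cl, Back (gs ! v)), Stay, tacts (Some v) (stop_write cl (gs ! v)) Move_Left gs)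
    | None \<Rightarrow> ((cl, Scan), Stay, tacts None 0 Stay gs))"
| "trans (cl, Back g) c gs = (case tape_var cl of
      Some v \<Rightarrow> if gs ! v = 3
        then ((follow (g = 2) cl, Start), Stay, tacts None 0 Stay gs)
        else ((cl, Back g), Stay, tacts (Some v) (gs ! v) Move_Left gs)
    | None \<Rightarrow> ((cl, Back g), Stay, tacts None 0 Stay gs))"

definition M :: "(nat, nat, 'a) tm" where
  "M = \<lparr>states = enc ` Q, work_alphabet = {0..3}, num_tapes = k, blank = 0,
     start = enc ([], Boot), accept = enc ([Accept], Start), reject = enc ([], Start),
     delta = (\<lambda>q c gs. case trans (inv_into Q enc q) c gs of (q', d, acts) \<Rightarrow> (enc q', d, acts))\<rparr>"

lemma inj_Q: "inj_on enc Q"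
  using inj_enc by (simp add: Q_def ctrl_def phases_def)

lemma enc_eq: "x \<in> Q \<Longrightarrow> y \<in> Q \<Longrightarrow> enc x = enc y \<longleftrightarrow> x = y"
  using inj_Q by (auto simp: inj_on_def)

lemma dec_enc [simp]: "x \<in> Q \<Longrightarrow> inv_into Q enc (enc x) = x"
  using inj_Q by simp

lemma finite_Q: "finite Q"
  by (simp add: Q_def ctrl_def phases_def finite_conts)

lemma phases_simps [simp]:
  "Boot \<in> phases" "Start \<in> phases" "Scan \<in> phases" "Back g \<in> phases \<longleftrightarrow> g \<le> 3"
  by (auto simp: phases_def)

lemma in_Q [simp]: "(cl, ph) \<in> Q \<longleftrightarrow> cl \<in> ctrl \<and> ph \<in> phases"
  by (simp add: Q_def)

lemma ctrl_simps [simp]: "[] \<in> ctrl" "[Accept] \<in> ctrl" "[prog] \<in> ctrl"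
  using conts_self[of prog "[]"] by (auto simp: ctrl_def)

lemma follow_ctrl [simp]: "cl \<in> ctrl \<Longrightarrow> follow p cl \<in> ctrl"
  using follow_conts[of cl prog "[]" p] by (auto simp: ctrl_def)

lemma tape_var_vars: "tape_var cl = Some v \<Longrightarrow> v \<in> \<Union> (vars ` set cl)"
  by (cases cl rule: tape_var.cases) auto

lemma tape_var_k: "cl \<in> ctrl \<Longrightarrow> tape_var cl = Some v \<Longrightarrow> v < k"
  using vars_conts[of cl prog "[]"] tape_var_vars[of cl v] vars_prog by (auto simp: ctrl_def)

lemma writes: "pass_write cl \<le> 3" "g \<le> 3 \<Longrightarrow> stop_write cl g \<le> 3"
   apply (cases cl rule: pass_write.cases; simp)
  apply (cases "(cl, g)" rule: stop_write.cases; simp)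
  done

definition ok_acts :: "(nat \<times> move) list \<Rightarrow> bool" where
  "ok_acts acts \<longleftrightarrow> length acts = k \<and> fst ` set acts \<subseteq> {0..3}"

lemma ok_tacts: "set gs \<subseteq> {0..3} \<Longrightarrow> length gs = k \<Longrightarrow> g \<le> 3 \<Longrightarrow> ok_acts (tacts v g d gs)"
  unfolding ok_acts_def tacts_def by (auto simp: image_image dest: nth_mem)

lemma trans_closed:
  assumes "cl \<in> ctrl" "ph \<in> phases" "set gs \<subseteq> {0..3}" "length gs = k"
  shows "case trans (cl, ph) c gs of (q', d, acts) \<Rightarrow>
    q' \<in> Q \<and> ok_acts acts"
proof -
  have g: "gs ! v \<le> 3" if "tape_var cl = Some v" for v
    using tape_var_k[OF assms(1) that] assms(3,4) by (metis atLeastAtMost_iff nth_mem subsetD)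
  show ?thesis
    using assms(1,2) g
    by (cases ph)
       (auto simp: ok_acts_def[of "map f xs" for f xs] intro!: ok_tacts[OF assms(3,4)] writes
         split: option.splits)
qed

lemma turing_machine_M: "turing_machine \<Sigma> M"
  unfolding turing_machine_def
proof (intro conjI ballI impI)
  show "accept M \<noteq> reject M"
    by (simp add: M_def enc_eq)
  fix q c gs
  assume q: "q \<in> states M - {accept M, reject M}" and gs: "gs \<in> lists (work_alphabet M)"
    "length gs = num_tapes M"
  obtain cl ph where x: "q = enc (cl, ph)" "cl \<in> ctrl" "ph \<in> phases"
    using q by (auto simp: M_def Q_def)
  have "set gs \<subseteq> {0..3}" "length gs = k"
    using gs by (auto simp: M_def)
  then show "case delta M q c gs of (q', d, acts) \<Rightarrow>
      q' \<in> states M \<and> length acts = num_tapes M \<and> fst ` set acts \<subseteq> work_alphabet M"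
    using trans_closed[OF x(2,3), of gs c] x
    by (cases "trans (cl, ph) c gs") (simp add: M_def ok_acts_def)
qed (auto simp: M_def finite_Q)

text \<open>Between operations all work heads rest on the end markers, and an operation moves a
  single one; so one tape \<open>v\<close> with its head position \<open>i\<close> describes them
  all.\<close>

definition conf :: "'a com list \<times> phase \<Rightarrow> nat \<Rightarrow> (nat \<Rightarrow> nat list) \<Rightarrow> nat \<Rightarrow> nat \<Rightarrow> (nat, nat) config" where
  "conf q h D v i = (enc q, h, map (\<lambda>j. (tape (D j), if j = v then i else 0)) [0..<k])"

definition halted :: "'a com list \<times> phase \<Rightarrow> bool" where
  "halted q \<longleftrightarrow> q = ([Accept], Start) \<or> q = ([], Start)"

lemma step_enc:
  assumes "q \<in> Q" "\<not> halted q"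
    "trans q (input_cell w h) (map (\<lambda>(t, i). t i) ts) = (q', d, acts)"
  shows "step M w (enc q, h, ts) =
    (enc q', min (move_head d h) (Suc (length w)), map2 act ts acts)"
  using assms by (auto simp: step_def M_def enc_eq halted_def)

lemma step_halted: "halted q \<Longrightarrow> step M w (enc q, h, ts) = (enc q, h, ts)"
  by (auto simp: halted_def step_def M_def)

lemma reads: "map (\<lambda>(t, i). t i) (map (\<lambda>j. (tape (D j), if j = v then i else 0)) [0..<k])
    = map (\<lambda>j. if j = v then tape (D j) i else 3) [0..<k]"
  by auto

lemma act_none:
  "map2 act (map (\<lambda>j. (tape (D j), if j = v then i else 0)) [0..<k])
     (tacts None g d (map (\<lambda>j. if j = v then tape (D j) i else 3) [0..<k]))
   = map (\<lambda>j. (tape (D j), if j = v then i else 0)) [0..<k]"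
  unfolding tacts_def map2_map_map by (auto simp: act_def fun_eq_iff)

lemma act_var:
  assumes "(tape (D v))(i := g) = tape ds"
  shows "map2 act (map (\<lambda>j. (tape (D j), if j = v then i else 0)) [0..<k])
     (tacts (Some v) g d (map (\<lambda>j. if j = v then tape (D j) i else 3) [0..<k]))
   = map (\<lambda>j. (tape ((D(v := ds)) j), if j = v then move_head d i else 0)) [0..<k]"
  unfolding tacts_def map2_map_map using assms by (auto simp: act_def fun_eq_iff)

lemma conf_step:
  assumes "q \<in> Q" "\<not> halted q"
    "trans q (input_cell w h) (map (\<lambda>j. if j = v then tape (D j) i else 3) [0..<k]) = (q', d, acts)"
  shows "step M w (conf q h D v i) = (enc q', min (move_head d h) (Suc (length w)),
    map2 act (map (\<lambda>j. (tape (D j), if j = v then i else 0)) [0..<k]) acts)"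
  unfolding conf_def by (rule step_enc) (use assms in \<open>simp_all only: reads not_False_eq_True\<close>)

lemma step_start_none:
  assumes "cl \<in> ctrl" "\<not> halted (cl, Start)" "tape_var cl = None"
  shows "step M w (conf (cl, Start) h D v 0) =
    conf (follow (input_cell w h \<in> in_test cl) cl, Start)
      (min (move_head (in_move cl) h) (Suc (length w))) D v 0"
proof -
  let ?gs = "map (\<lambda>j. if j = v then tape (D j) 0 else 3) [0..<k]"
  have tr: "trans (cl, Start) (input_cell w h) ?gs = ((follow (input_cell w h \<in> in_test cl) cl, Start),
      in_move cl, tacts None 0 Stay ?gs)"
    using assms by simp
  then show ?thesis
    using conf_step[OF _ _ tr] act_none[of D v 0 0 Stay] assms by (simp add: conf_def)
qed

lemma step_var:
  assumes "cl \<in> ctrl" "ph \<in> phases" "\<not> halted (cl, ph)" "tape_var cl = Some v"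
    and "\<And>c gs. gs ! v = tape (D v) i \<Longrightarrow>
      trans (cl, ph) c gs = ((cl', ph'), Stay, tacts (Some v) g d gs)"
    and "(tape (D v))(i := g) = tape ds" and "h \<le> Suc (length w)"
  shows "step M w (conf (cl, ph) h D v i) = conf (cl', ph') h (D(v := ds)) v (move_head d i)"
proof -
  have v: "v < k" using assms tape_var_k by simp
  let ?gs = "map (\<lambda>j. if j = v then tape (D j) i else 3) [0..<k]"
  have "?gs ! v = tape (D v) i" using v by simp
  then have tr: "trans (cl, ph) (input_cell w h) ?gs = ((cl', ph'), Stay, tacts (Some v) g d ?gs)"
    by (rule assms(5))
  then show ?thesis
    using conf_step[OF _ _ tr] act_var[where D = D and v = v and i = i and g = g and ds = ds, OF assms(6)]
      assms by (simp add: conf_def del: fun_upd_apply)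
qed


lemma step_back_done:
  assumes "cl \<in> ctrl" "g \<le> 3" "tape_var cl = Some v" "h \<le> Suc (length w)"
  shows "step M w (conf (cl, Back g) h D v 0) = conf (follow (g = 2) cl, Start) h D v 0"
proof -
  let ?gs = "map (\<lambda>j. if j = v then tape (D j) 0 else 3) [0..<k]"
  have "?gs ! v = 3" using tape_var_k[OF assms(1,3)] by simp
  then have tr: "trans (cl, Back g) (input_cell w h) ?gs =
      ((follow (g = 2) cl, Start), Stay, tacts None 0 Stay ?gs)"
    using assms by simp
  then show ?thesis
    using conf_step[OF _ _ tr] act_none[of D v 0 0 Stay] assms
    by (simp add: conf_def halted_def min_absorb1 del: trans.simps)
qed

section \<open>Space-bounded runs and the simulation of program steps\<close>

definition ok :: "nat \<Rightarrow> (nat, nat) config \<Rightarrow> bool" where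
  "ok S c \<longleftrightarrow> (\<forall>(tp, i) \<in> set (snd (snd c)). Suc i \<le> S)"

text \<open>The space bound is demanded of every configuration entered, so correctness and space are
  proved by one induction.\<close>

definition run :: "'a list \<Rightarrow> nat \<Rightarrow> (nat, nat) config \<Rightarrow> (nat, nat) config \<Rightarrow> bool" where
  "run w S = (\<lambda>c c'. c' = step M w c \<and> ok S c')\<^sup>*\<^sup>*"

lemma run_refl: "run w S c c"
  by (simp add: run_def)

lemma run_trans: "run w S c c' \<Longrightarrow> run w S c' c'' \<Longrightarrow> run w S c c''"
  unfolding run_def by (rule rtranclp_trans)

lemma run_step: "step M w c = c' \<Longrightarrow> ok S c' \<Longrightarrow> run w S c' c'' \<Longrightarrow> run w S c c''"
  unfolding run_def by (rule converse_rtranclp_into_rtranclp) auto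

lemma ok_conf: "i < S \<Longrightarrow> ok S (conf q h D v i)"
  by (auto simp: ok_def conf_def)

lemma conf_0: "conf q h D v 0 = conf q h D v' 0"
  by (auto simp: conf_def)

lemma passed_pos: "passed cl \<noteq> 0" "passed cl \<le> 2"
  by (cases cl rule: passed.cases; simp)+

abbreviation "scan_of cl \<equiv> scan (passed cl) (pass_write cl) (stop_write cl)"

text \<open>Induction on the digits \<open>zs\<close> still to be read; those in \<open>ys\<close>
  have already been rewritten.\<close>

lemma scan_run:
  assumes "cl \<in> ctrl" "tape_var cl = Some v" "h \<le> Suc (length w)"
    and "D v = ys @ zs" "set zs \<subseteq> {1, 2}" "Suc (length (ys @ zs)) < S"
  shows "\<exists>j \<le> Suc (length (ys @ zs)). run w S (conf (cl, Scan) h D v (Suc (length ys)))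
      (conf (cl, Back (snd (scan_of cl zs))) h (D(v := ys @ fst (scan_of cl zs))) v j)"
  using assms(4-)
proof (induction zs arbitrary: ys D)
  case Nil
  \<comment> \<open>The blank 0 behind the last digit ends the scan, since \<open>passed cl\<close>
    is 1 or 2. An increment writes a new top digit here.\<close>
  have "step M w (conf (cl, Scan) h D v (Suc (length ys))) =
    conf (cl, Back 0) h (D(v := ys @ fst (scan_of cl []))) v (move_head Move_Left (Suc (length ys)))"
    using Nil assms passed_pos[of cl]
    by (intro step_var[where g = "stop_write cl 0"]) (auto simp: halted_def tape_upd_end)
  then show ?case
    using Nil by (intro exI[of _ "length ys"]) (auto intro!: run_step[OF _ ok_conf run_refl] simp del: fun_upd_apply)
next
  case (Cons z zs)
  have cell: "tape (D v) (Suc (length ys)) = z" using Cons by simp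
  show ?case
  proof (cases "z = passed cl")
    case True
    let ?D = "D(v := (ys @ [pass_write cl]) @ zs)"
    have 1: "step M w (conf (cl, Scan) h D v (Suc (length ys))) =
        conf (cl, Scan) h ?D v (move_head Move_Right (Suc (length ys)))"
      using Cons.prems assms True cell
      by (intro step_var[where g = "pass_write cl"]) (simp_all add: halted_def tape_upd)
    obtain j where j: "j \<le> Suc (length ((ys @ [pass_write cl]) @ zs))"
      "run w S (conf (cl, Scan) h ?D v (Suc (length (ys @ [pass_write cl]))))
        (conf (cl, Back (snd (scan_of cl zs))) h
          (?D(v := (ys @ [pass_write cl]) @ fst (scan_of cl zs))) v j)"
      using Cons.IH[of ?D "ys @ [pass_write cl]"] Cons.prems by (auto simp del: fun_upd_apply simp: fun_upd_same)
    show ?thesis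
      using j Cons.prems True
      by (intro exI[of _ j]) (auto intro!: run_step[OF 1 ok_conf] simp del: fun_upd_apply)
  next
    case False
    have "step M w (conf (cl, Scan) h D v (Suc (length ys))) =
      conf (cl, Back z) h (D(v := ys @ stop_write cl z # zs)) v (move_head Move_Left (Suc (length ys)))"
      using Cons.prems assms False cell
      by (intro step_var[where g = "stop_write cl z"]) (auto simp: halted_def tape_upd)
    then show ?thesis
      using Cons.prems False
      by (intro exI[of _ "length ys"]) (auto intro!: run_step[OF _ ok_conf run_refl] simp del: fun_upd_apply)
  qed
qed

text \<open>Digits and blanks differ from 3, so the head moves left until it meets the end marker
  and nowhere stops earlier.\<close>

lemma back_run:
  assumes "cl \<in> ctrl" "tape_var cl = Some v" "h \<le> Suc (length w)" "g \<le> 3"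
    and "set (D v) \<subseteq> {1, 2}" "i < S"
  shows "run w S (conf (cl, Back g) h D v i) (conf (follow (g = 2) cl, Start) h D v 0)"
  using assms(6)
proof (induction i)
  case 0
  then show ?case
    using assms by (intro run_step[OF step_back_done ok_conf run_refl]) auto
next
  case (Suc i)
  have "tape (D v) (Suc i) \<noteq> 3"
    using assms(5) nth_mem[of i "D v"] by (cases "i < length (D v)") fastforce+
  then have "step M w (conf (cl, Back g) h D v (Suc i)) =
      conf (cl, Back g) h (D(v := D v)) v (move_head Move_Left (Suc i))"
    using assms by (intro step_var[where g = "tape (D v) (Suc i)"]) (simp_all add: halted_def del: tape.simps)
  then have 1: "step M w (conf (cl, Back g) h D v (Suc i)) = conf (cl, Back g) h D v i"
    by simp
  show ?case
    using Suc by (intro run_step[OF 1 ok_conf]) simp_all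
qed

lemma op_run:
  assumes "cl \<in> ctrl" "tape_var cl = Some v" "h \<le> Suc (length w)"
    and "set (D v) \<subseteq> {1, 2}" "set (fst (scan_of cl (D v))) \<subseteq> {1, 2}"
    and "Suc (length (D v)) < S"
  shows "run w S (conf (cl, Start) h D 0 0)
    (conf (follow (snd (scan_of cl (D v)) = 2) cl, Start) h (D(v := fst (scan_of cl (D v)))) 0 0)"
proof -
  have nh: "\<not> halted (cl, ph)" for ph
    using assms(2) by (auto simp: halted_def)
  have "step M w (conf (cl, Start) h D v 0) =
      conf (cl, Scan) h (D(v := D v)) v (move_head Move_Right 0)"
    using assms nh by (intro step_var[where g = 3]) (auto simp: fun_eq_iff)
  then have 1: "run w S (conf (cl, Start) h D v 0) (conf (cl, Scan) h D v (Suc 0))"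
    using assms(6) by (intro run_step[OF _ ok_conf run_refl]) auto
  obtain j where j: "j \<le> Suc (length (D v))" "run w S (conf (cl, Scan) h D v (Suc 0))
      (conf (cl, Back (snd (scan_of cl (D v)))) h (D(v := fst (scan_of cl (D v)))) v j)"
    using scan_run[OF assms(1-3), of D "[]" "D v" S] assms(4,6) by auto
  have "snd (scan_of cl ds) \<le> 3" if "set ds \<subseteq> {1, 2}" for ds
    using that by (induction ds) auto
  then have 2: "run w S (conf (cl, Back (snd (scan_of cl (D v)))) h (D(v := fst (scan_of cl (D v)))) v j)
     (conf (follow (snd (scan_of cl (D v)) = 2) cl, Start) h (D(v := fst (scan_of cl (D v)))) v 0)"
    using assms j(1) by (intro back_run) auto
  show ?thesis
    using run_trans[OF 1 run_trans[OF j(2) 2]] by (metis conf_0)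
qed

text \<open>The length is bounded through \<open>N\<close> and not through the present value, as
  decrements leave zeros at the top. A number up to \<open>N\<close> has at most l binary digits
  with \<open>2 ^ (l - 1) \<le> N\<close>, hence the factor 2.\<close>

definition rep :: "nat \<Rightarrow> (nat \<Rightarrow> nat list) \<Rightarrow> (nat \<Rightarrow> nat) \<Rightarrow> bool" where
  "rep N D s \<longleftrightarrow> (\<forall>j<k. dval (D j) = s j \<and> set (D j) \<subseteq> {1, 2} \<and> 2 ^ length (D j) \<le> 2 * N)"

lemma rep_upd:
  "rep N D s \<Longrightarrow> dval ds = x \<Longrightarrow> set ds \<subseteq> {1, 2} \<Longrightarrow> 2 ^ length ds \<le> 2 * N \<Longrightarrow>
    rep N (D(v := ds)) (s(v := x))"
  by (simp add: rep_def)

lemma test_run: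
  assumes "cl \<in> ctrl" "rep N D s" "h \<le> Suc (length w)"
    and "\<And>l. 2 ^ l \<le> 2 * N \<Longrightarrow> Suc (Suc l) \<le> S" "0 < N"
    and "(\<exists>a b K. cl = Cond t a b # K) \<or> (\<exists>a K. cl = While t a # K)"
  shows "run w S (conf (cl, Start) h D 0 0) (conf (follow (tval w t h s) cl, Start) h D 0 0)"
proof (cases t)
  case (Pos v)
  have v: "tape_var cl = Some v" "passed cl = 1" "pass_write cl = 1" "stop_write cl = (\<lambda>g. g)"
    using assms(6) Pos by auto
  have D: "set (D v) \<subseteq> {1, 2}" "dval (D v) = s v" "Suc (length (D v)) < S"
    using tape_var_k[OF assms(1) v(1)] assms(2) assms(4)[of "length (D v)"] by (auto simp: rep_def)
  show ?thesis
    using op_run[OF assms(1) v(1) assms(3), of D S] D scan_test[OF D(1)] v(2-) Pos by simp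
next
  case (Head X)
  have v: "tape_var cl = None" "in_test cl = X" "in_move cl = Stay" "\<not> halted (cl, Start)"
    using assms(6) Head by (auto simp: halted_def)
  have "0 < S" using assms(4)[of 0] assms(5) by simp
  then show ?thesis
    using step_start_none[OF assms(1) v(4) v(1), of w h D 0] v Head assms(3)
    by (intro run_step[OF _ ok_conf run_refl]) auto
qed

text \<open>On a counter with l digits the head visits the marker, the digits and one blank, which
  explains the l + 2 cells required of \<open>S\<close>.\<close>

lemma small_run:
  assumes "small w N (cl, h, s) (cl', h', s')" "cl \<in> ctrl" "rep N D s" "h \<le> Suc (length w)"
    and S: "\<And>l. 2 ^ l \<le> 2 * N \<Longrightarrow> Suc (Suc l) \<le> S" "0 < N"
  shows "\<exists>D'. rep N D' s' \<and> cl' \<in> ctrl \<and> h' \<le> Suc (length w) \<and>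
    run w S (conf (cl, Start) h D 0 0) (conf (cl', Start) h' D' 0 0)"
proof -
  have S0: "0 < S" using S(1)[of 0] S(2) by simp
  have none: "run w S (conf (cl, Start) h D 0 0)
      (conf (follow (input_cell w h \<in> in_test cl) cl, Start)
      (min (move_head (in_move cl) h) (Suc (length w))) D 0 0)"
    if "tape_var cl = None" "\<not> halted (cl, Start)"
    using step_start_none[OF assms(2) that(2,1)] S0 by (intro run_step[OF _ ok_conf run_refl]) auto
  have fc: "follow p cl \<in> ctrl" for p using assms(2) by simp
  show ?thesis
    using assms(1)
  proof cases
    case (small_Skip)
    then show ?thesis using none fc[of True] assms by (auto simp: halted_def)
  next
    case (small_Inc v)
    have v: "tape_var cl = Some v" "passed cl = 2" "pass_write cl = 1" "stop_write cl = (\<lambda>_. 2)"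
      using small_Inc by auto
    have D: "set (D v) \<subseteq> {1, 2}" "dval (D v) = s v" "Suc (length (D v)) < S" "2 ^ length (D v) \<le> 2 * N"
      using tape_var_k[OF assms(2) v(1)] assms(3) S(1)[of "length (D v)"] by (auto simp: rep_def)
    \<comment> \<open>If a digit is added, \<open>2 ^ length (D v)\<close> equals the new value,
      which is at most \<open>N\<close>; so one more digit still respects
      \<open>2 * N\<close>.\<close>
    have "rep N (D(v := fst (scan 2 1 (\<lambda>_. 2) (D v)))) s'"
      unfolding small_Inc using scan_inc[OF D(1)] D(2,4) small_Inc(4)
      by (intro rep_upd assms(3)) auto
    then show ?thesis
      using op_run[OF assms(2) v(1) assms(4), of D S] D v(2-) small_Inc fc[of True]
        scan_inc[OF D(1)] assms(4) by auto
  next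
    case (small_Dec v)
    have v: "tape_var cl = Some v" "passed cl = 1" "pass_write cl = 2" "stop_write cl = (\<lambda>_. 1)"
      using small_Dec by auto
    have D: "set (D v) \<subseteq> {1, 2}" "dval (D v) = s v" "Suc (length (D v)) < S" "2 ^ length (D v) \<le> 2 * N"
      using tape_var_k[OF assms(2) v(1)] assms(3) S(1)[of "length (D v)"] by (auto simp: rep_def)
    have "rep N (D(v := fst (scan 1 2 (\<lambda>_. 1) (D v)))) s'"
      unfolding small_Dec using scan_dec[OF D(1)] D(2,4) small_Dec(4)
      by (intro rep_upd assms(3)) auto
    then show ?thesis
      using op_run[OF assms(2) v(1) assms(4), of D S] D v(2-) small_Dec fc[of True]
        scan_dec[OF D(1)] assms(4) by auto
  next
    case (small_Move d)
    then show ?thesis using none fc[of True] assms by (auto simp: halted_def)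
  next
    case (small_Seq a b K)
    then show ?thesis using none fc[of True] assms by (auto simp: halted_def)
  next
    case (small_Cond t a b K)
    then show ?thesis using test_run[OF assms(2-4) S, where t = t] assms fc by auto
  next
    case (small_While t a K)
    then show ?thesis using test_run[OF assms(2-4) S, where t = t] assms fc by auto
  qed
qed

lemma smalls_run:
  assumes "(small w N)\<^sup>*\<^sup>* (cl, h, s) (cl', h', s')" "cl \<in> ctrl" "rep N D s" "h \<le> Suc (length w)"
    and S: "\<And>l. 2 ^ l \<le> 2 * N \<Longrightarrow> Suc (Suc l) \<le> S" "0 < N"
  shows "\<exists>D'. run w S (conf (cl, Start) h D 0 0) (conf (cl', Start) h' D' 0 0)"
  using assms(1-4)
proof (induction "(cl, h, s)" arbitrary: cl h s D rule: converse_rtranclp_induct)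
  case base
  then show ?case using run_refl by blast
next
  case (step y)
  obtain cl1 h1 s1 where y: "y = (cl1, h1, s1)" by (cases y)
  show ?case
    using small_run[OF step(1)[unfolded y] step(4-6) S] step(3)[OF y] run_trans by blast
qed

lemma initial_run:
  assumes "0 < S"
  shows "run w S (initial M) (conf ([prog], Start) 0 (\<lambda>_. []) 0 0)"
proof -
  let ?ts = "replicate k (\<lambda>_. 0::nat, 0::nat)" and ?acts = "map (\<lambda>j. (3::nat, Stay)) [0..<k]"
  have ts: "?ts = map (\<lambda>j. (\<lambda>_. 0, 0)) [0..<k]"
    by (simp add: map_replicate_const)
  have t: "(\<lambda>_. 0)(0 := 3) = tape []"
  proof
    fix i show "((\<lambda>_. 0)(0 := 3)) i = tape [] i" by (cases i) auto
  qed
  have "initial M = (enc ([], Boot), 0, ?ts)"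
    by (simp add: initial_def M_def)
  moreover have "step M w (enc ([], Boot), 0, ?ts) =
      (enc ([prog], Start), min (move_head Stay 0) (Suc (length w)), map2 act ?ts ?acts)"
    by (rule step_enc) (auto simp: halted_def)
  moreover have "map2 act ?ts ?acts = map (\<lambda>j. (tape [], 0)) [0..<k]"
    unfolding ts map2_map_map by (auto simp: act_def t)
  ultimately have "step M w (initial M) = conf ([prog], Start) 0 (\<lambda>_. []) 0 0"
    by (auto simp: conf_def)
  then show ?thesis
    using assms by (intro run_step[OF _ ok_conf run_refl]) auto
qed

lemma run_config:
  assumes "run w S c c'" "ok S c"
  shows "\<exists>T. (step M w ^^ T) c = c' \<and> (\<forall>t\<le>T. ok S ((step M w ^^ t) c))"
  using assms unfolding run_def
proof (induction rule: rtranclp_induct)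
  case base
  then show ?case by (intro exI[of _ 0]) auto
next
  case (step c' c'')
  then obtain T where "(step M w ^^ T) c = c'" "\<forall>t\<le>T. ok S ((step M w ^^ t) c)" by blast
  then show ?case using step(2) by (intro exI[of _ "Suc T"]) (auto simp: le_Suc_eq)
qed

text \<open>The space bound has to hold at all times; once the halting configuration is reached, it
  repeats forever.\<close>

lemma halting_run:
  assumes "run w S (initial M) c" "step M w c = c" "0 < S"
  shows "(\<exists>t. config_at M w t = c) \<and> (\<forall>t. ok S (config_at M w t))"
proof -
  have "ok S (initial M)" using assms(3) by (auto simp: ok_def initial_def)
  then obtain T where T: "(step M w ^^ T) (initial M) = c" "\<forall>t\<le>T. ok S ((step M w ^^ t) (initial M))"
    using run_config[OF assms(1)] by blast
  have c: "(step M w ^^ (T + d)) (initial M) = c" for d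
    by (induction d) (auto simp: T assms)
  have "ok S (config_at M w t)" for t
  proof (cases "t \<le> T")
    case False
    then obtain d where "t = T + d" using le_Suc_ex[of T t] by auto
    then show ?thesis using T(1) T(2)[rule_format, of T] c[of d] by (simp add: config_at_def)
  qed (use T(2) in \<open>simp add: config_at_def\<close>)
  then show ?thesis using T(1) by (auto simp: config_at_def)
qed

lemma program_run:
  assumes "(small w N)\<^sup>*\<^sup>* ([prog], 0, \<lambda>_. 0) (if b then [Accept] else [], h, s)"
    and S: "\<And>l. 2 ^ l \<le> 2 * N \<Longrightarrow> Suc (Suc l) \<le> S" "0 < N"
  shows "(\<exists>t. fst (config_at M w t) = (if b then accept M else reject M)) \<and>
    (\<forall>t. ok S (config_at M w t))"
proof -
  have "rep N (\<lambda>_. []) (\<lambda>_. 0)" using S(2) by (simp add: rep_def)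
  then obtain D where D: "run w S (conf ([prog], Start) 0 (\<lambda>_. []) 0 0)
      (conf (if b then [Accept] else [], Start) h D 0 0)"
    using smalls_run[OF assms(1) _ _ _ S] by auto
  have S0: "0 < S" using S(1)[of 0] S(2) by simp
  have "step M w (conf (if b then [Accept] else [], Start) h D 0 0) =
      conf (if b then [Accept] else [], Start) h D 0 0"
    unfolding conf_def by (rule step_halted) (auto simp: halted_def)
  from halting_run[OF run_trans[OF initial_run[OF S0] D] this S0]
  obtain t where t: "config_at M w t = conf (if b then [Accept] else [], Start) h D 0 0"
    and ok: "\<forall>t. ok S (config_at M w t)" by blast
  have "fst (config_at M w t) = (if b then accept M else reject M)"
    unfolding t by (simp add: conf_def M_def)
  then show ?thesis using ok by blast
qed

end

section \<open>Logarithmic space for programs with polynomially bounded counters\<close>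

lemma logspace_bound:
  "(\<lambda>n. real (nat \<lfloor>log 2 (real (2 * (n + 2) ^ c))\<rfloor> + 2)) \<in> O(\<lambda>n. ln (real n))"
proof (rule bigoI[where c = "(3 + 2 * real c) / ln 2"], rule eventually_at_top_linorderI[of 2])
  fix n :: nat assume n: "2 \<le> n"
  \<comment> \<open>For n at least 2 the logarithm of n + 2 is at most twice that of n. The summands
    1 (from the factor 2) and 2 (extra cells) are absorbed by \<open>1 \<le> log 2 (real n)\<close>,
    which gives the constant 3 + 2c.\<close>
  have "n + 2 \<le> n\<^sup>2"
    using n mult_le_mono[OF n order_refl, of n] by (simp only: power2_eq_square)
  then have "real (n + 2) \<le> real n ^ 2"
    by (metis of_nat_le_iff of_nat_power)
  then have "log 2 (real (n + 2)) \<le> log 2 (real n ^ 2)"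
    using n by (intro log_mono) auto
  then have "log 2 (real (n + 2)) \<le> 2 * log 2 (real n)"
    using n by (simp add: log_nat_power)
  then have "real c * log 2 (real (n + 2)) \<le> real c * (2 * log 2 (real n))"
    by (rule mult_left_mono) simp
  moreover have "1 \<le> log 2 (real n)"
    using n by (simp add: le_log_iff)
  moreover have "log 2 (real (2 * (n + 2) ^ c)) = 1 + real c * log 2 (real (n + 2))"
    by (simp add: log_mult log_nat_power add.commute)
  ultimately have 1: "log 2 (real (2 * (n + 2) ^ c)) + 2 \<le> (3 + 2 * real c) * log 2 (real n)"
    by (simp add: algebra_simps)
  have "0 \<le> log 2 (real (2 * (n + 2) ^ c))"
    by (subst zero_le_log_cancel_iff) (auto simp: Suc_le_eq simp del: of_nat_mult of_nat_power)
  then have "real (nat \<lfloor>log 2 (real (2 * (n + 2) ^ c))\<rfloor> + 2) \<le> log 2 (real (2 * (n + 2) ^ c)) + 2"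
    by simp
  with 1 show "norm (real (nat \<lfloor>log 2 (real (2 * (n + 2) ^ c))\<rfloor> + 2)) \<le>
      (3 + 2 * real c) / ln 2 * norm (ln (real n))"
    using n by (simp add: log_def)
qed

theorem logspace_decidable_program:
  assumes "finite \<Sigma>" "L \<subseteq> lists \<Sigma>"
    and "\<And>w. w \<in> lists \<Sigma> \<Longrightarrow> \<exists>h s. (small w ((length w + 2) ^ c))\<^sup>*\<^sup>* ([prog], 0, \<lambda>_. 0)
      (if w \<in> L then [Accept] else [], h, s)"
  shows "logspace_decidable \<Sigma> L"
proof -
  obtain k where k: "vars prog \<subseteq> {..<k}"
    using finite_vars[of prog] unfolding finite_nat_set_iff_bounded by auto
  let ?Q = "(conts prog [] \<union> {[], [Accept]}) \<times> ({Boot, Start, Scan} \<union> Back ` {0..3})"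
  have "finite ?Q" by (simp add: finite_conts)
  then obtain enc :: "'a com list \<times> phase \<Rightarrow> nat" where "inj_on enc ?Q"
    using finite_imp_inj_to_nat_seg by blast
  then interpret counter_machine prog k enc
    using k by unfold_locales
  let ?S = "\<lambda>n. nat \<lfloor>log 2 (real (2 * (n + 2) ^ c))\<rfloor> + 2"
  have S: "Suc (Suc l) \<le> ?S n" if "2 ^ l \<le> 2 * (n + 2) ^ c" for l n
  proof -
    have "l \<le> nat \<lfloor>log 2 (real (2 * (n + 2) ^ c))\<rfloor>"
      by (rule le_nat_floor[OF le_log2_of_power[OF that]])
    then show ?thesis by linarith
  qed
  have *: "(\<exists>t. fst (config_at M w t) = (if w \<in> L then accept M else reject M)) \<and>
    (\<forall>t. ok (?S (length w)) (config_at M w t))" if w: "w \<in> lists \<Sigma>" for w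
  proof -
    obtain h s where "(small w ((length w + 2) ^ c))\<^sup>*\<^sup>* ([prog], 0, \<lambda>_. 0)
        (if w \<in> L then [Accept] else [], h, s)"
      using assms(3)[OF w] by blast
    then show ?thesis by (rule program_run) (use S in simp_all)
  qed
  have "decides M \<Sigma> L"
    unfolding decides_def by (intro ballI) (rule *[THEN conjunct1])
  moreover have "runs_in_space M \<Sigma> ?S"
    unfolding runs_in_space_def by (intro ballI allI) (rule *[THEN conjunct2, rule_format, unfolded ok_def, THEN bspec])
  ultimately show ?thesis
    unfolding logspace_decidable_def using assms(1,2) turing_machine_M logspace_bound[of c]
    by (intro conjI exI[of _ M] exI[of _ ?S])
qed

section \<open>Execution of while programs\<close>

text \<open>Quantifying over the continuation \<open>K\<close> makes executions composable in
  sequence.\<close>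

definition exec :: "'a list \<Rightarrow> nat \<Rightarrow> 'a com \<Rightarrow> nat \<times> (nat \<Rightarrow> nat) \<Rightarrow> nat \<times> (nat \<Rightarrow> nat) \<Rightarrow> bool" where
  "exec w N c \<sigma> \<sigma>' \<longleftrightarrow> (\<forall>K. (small w N)\<^sup>*\<^sup>* (c # K, \<sigma>) (K, \<sigma>'))"

lemma exec_Skip: "exec w N Skip \<sigma> \<sigma>"
  unfolding exec_def by (cases \<sigma>) (auto intro: small_Skip)

lemma exec_Inc: "s v < N \<Longrightarrow> exec w N (Inc v) (h, s) (h, s(v := Suc (s v)))"
  unfolding exec_def by (auto intro: small_Inc)

lemma exec_Dec: "0 < s v \<Longrightarrow> exec w N (Dec v) (h, s) (h, s(v := s v - 1))"
  unfolding exec_def by (intro allI r_into_rtranclp small_Dec)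

lemma exec_Move: "exec w N (Move d) (h, s) (min (move_head d h) (Suc (length w)), s)"
  unfolding exec_def by (auto intro: small_Move)

lemma exec_Seq: "exec w N a \<sigma> \<sigma>' \<Longrightarrow> exec w N b \<sigma>' \<sigma>'' \<Longrightarrow> exec w N (Seq a b) \<sigma> \<sigma>''"
  unfolding exec_def
  by (cases \<sigma>) (meson converse_rtranclp_into_rtranclp rtranclp_trans small_Seq)

lemma exec_Cond:
  "exec w N (if tval w t h s then a else b) (h, s) \<sigma>' \<Longrightarrow> exec w N (Cond t a b) (h, s) \<sigma>'"
  unfolding exec_def
  by (metis converse_rtranclp_into_rtranclp follow.simps(2) small_Cond)

lemma exec_While_True:
  "tval w t h s \<Longrightarrow> exec w N a (h, s) \<sigma>' \<Longrightarrow> exec w N (While t a) \<sigma>' \<sigma>'' \<Longrightarrow>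
    exec w N (While t a) (h, s) \<sigma>''"
  unfolding exec_def
  by (metis (no_types, lifting) converse_rtranclp_into_rtranclp follow.simps(3) rtranclp_trans small_While)

lemma exec_While_False: "\<not> tval w t h s \<Longrightarrow> exec w N (While t a) (h, s) (h, s)"
  unfolding exec_def
  by (metis follow.simps(3) r_into_rtranclp small_While)

lemma exec_Pos_0: "s a = 0 \<Longrightarrow> s = s' \<Longrightarrow> exec w N (While (Pos a) c) (h, s) (h, s')"
  using exec_While_False[of w "Pos a" h s] by simp

lemma exec_Pos_Suc:
  "Suc x = s a \<Longrightarrow> exec w N c (h, s) \<sigma> \<Longrightarrow> exec w N (While (Pos a) c) \<sigma> \<sigma>' \<Longrightarrow>
    exec w N (While (Pos a) c) (h, s) \<sigma>'"
  by (rule exec_While_True) auto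

lemma exec_eq: "exec w N c \<sigma> \<tau> \<Longrightarrow> \<tau> = \<tau>' \<Longrightarrow> exec w N c \<sigma> \<tau>'"
  by simp

section \<open>Elementary counter programs\<close>

definition "clear a = While (Pos a) (Dec a)"

lemma exec_clear: "exec w N (clear a) (h, s) (h, s(a := 0))"
proof (induction "s a" arbitrary: s)
  case 0
  then show ?case unfolding clear_def by (intro exec_Pos_0) (auto simp: fun_eq_iff)
next
  case (Suc x)
  have "x = (s(a := s a - 1)) a" using Suc(2) by (simp flip: Suc(2))
  then have "exec w N (clear a) (h, s(a := s a - 1)) (h, s(a := 0))"
    using Suc(1)[of "s(a := s a - 1)"] by simp
  moreover have "exec w N (Dec a) (h, s) (h, s(a := s a - 1))"
    by (rule exec_Dec) (simp flip: Suc(2))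
  ultimately show ?case
    unfolding clear_def using Suc(2) by (metis exec_Pos_Suc)
qed

definition "transfer a b = While (Pos a) (Seq (Dec a) (Inc b))"

lemma exec_transfer:
  "a \<noteq> b \<Longrightarrow> s a + s b \<le> N \<Longrightarrow>
    exec w N (transfer a b) (h, s) (h, s(a := 0, b := s a + s b))"
proof (induction "s a" arbitrary: s)
  case 0
  then show ?case unfolding transfer_def by (intro exec_Pos_0) (auto simp: fun_eq_iff)
next
  case (Suc x)
  let ?s = "s(a := s a - 1, b := Suc (s b))"
  have "exec w N (Seq (Dec a) (Inc b)) (h, s) (h, ?s)"
    using Suc(2-) exec_Inc[of "s(a := s a - 1)" b N w h]
    by (intro exec_Seq[OF exec_Dec]) (auto simp: fun_upd_def)
  moreover have "exec w N (transfer a b) (h, ?s) (h, ?s(a := 0, b := ?s a + ?s b))"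
    using Suc(2-) by (intro Suc(1)[of ?s]) auto
  moreover have "?s(a := 0, b := ?s a + ?s b) = s(a := 0, b := s a + s b)"
    using Suc(2-) by (auto simp: fun_eq_iff)
  ultimately show ?case
    unfolding transfer_def using Suc(2) by (metis exec_Pos_Suc)
qed

text \<open>Reading a counter out destroys it, so a second copy is collected in \<open>t\<close> and
  moved back to \<open>a\<close>.\<close>

definition "copy a b t = Seq (While (Pos a) (Seq (Dec a) (Seq (Inc b) (Inc t)))) (transfer t a)"

lemma exec_copy:
  assumes "distinct [a, b, t]" "s a \<le> N" "s b = 0" "s t = 0"
  shows "exec w N (copy a b t) (h, s) (h, s(b := s a))"
proof -
  have 1: "exec w N (While (Pos a) (Seq (Dec a) (Seq (Inc b) (Inc t)))) (h, s)
      (h, s(a := 0, b := s b + s a, t := s t + s a))"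
    if "s a + s b \<le> N" "s a + s t \<le> N" for s
    using that
  proof (induction "s a" arbitrary: s)
    case 0
      then show ?case by (intro exec_Pos_0) (auto simp: fun_eq_iff)
  next
    case (Suc x)
    let ?s = "s(a := s a - 1, b := Suc (s b), t := Suc (s t))"
    have "exec w N (Seq (Dec a) (Seq (Inc b) (Inc t))) (h, s) (h, ?s)"
      using Suc(2-) assms(1)
      by (intro exec_Seq[OF exec_Dec] exec_Seq[OF exec_Inc] exec_eq[OF exec_Inc]) (auto simp: fun_eq_iff)
    moreover have "exec w N (While (Pos a) (Seq (Dec a) (Seq (Inc b) (Inc t)))) (h, ?s)
        (h, ?s(a := 0, b := ?s b + ?s a, t := ?s t + ?s a))"
      using Suc(2-) assms(1) by (intro Suc(1)[of ?s]) auto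
    moreover have "?s(a := 0, b := ?s b + ?s a, t := ?s t + ?s a) =
        s(a := 0, b := s b + s a, t := s t + s a)"
      using Suc assms(1) by (auto simp: fun_eq_iff)
    ultimately show ?case
      using Suc(2) by (metis exec_Pos_Suc)
  qed
  show ?thesis
    unfolding copy_def
    apply (rule exec_Seq[OF 1])
      apply (use assms in simp)
     apply (use assms in simp)
    apply (rule exec_eq[OF exec_transfer])
      apply (use assms in \<open>auto simp: fun_eq_iff\<close>)
    done
qed

definition "rewind = While (Head (- {Left_End})) (Move Move_Left)"

lemma exec_rewind: "h \<le> Suc (length w) \<Longrightarrow> exec w N rewind (h, s) (0, s)"
proof (induction h)
  case 0
  then show ?case unfolding rewind_def by (intro exec_While_False) (simp add: input_cell_def)
next
  case (Suc h)
  have "exec w N (Move Move_Left) (Suc h, s) (h, s)"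
    using exec_Move[of w N Move_Left "Suc h" s] Suc by simp
  then show ?case
    using Suc unfolding rewind_def by (intro exec_While_True) (auto simp: input_cell_def)
qed

definition "advance a = While (Pos a) (Seq (Dec a) (Move Move_Right))"

lemma exec_advance:
  "h \<le> Suc (length w) \<Longrightarrow>
    exec w N (advance a) (h, s) (min (h + s a) (Suc (length w)), s(a := 0))"
proof (induction "s a" arbitrary: s h)
  case 0
  then show ?case unfolding advance_def by (intro exec_eq[OF exec_Pos_0[OF _ refl]]) auto
next
  case (Suc x)
  let ?s = "s(a := s a - 1)" and ?h = "min (Suc h) (Suc (length w))"
  have x: "s a = Suc x" using Suc(2) by (rule sym)
  have 1: "exec w N (Seq (Dec a) (Move Move_Right)) (h, s) (?h, ?s)"
    using x exec_Move[of w N Move_Right h ?s] by (intro exec_Seq[OF exec_Dec]) simp_all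
  have m: "min (min (Suc h) L + x) L = min (h + Suc x) L" for L by linarith
  have "exec w N (advance a) (?h, ?s) (min (?h + ?s a) (Suc (length w)), ?s(a := 0))"
    by (rule Suc(1)) (simp_all add: x)
  then have 2: "exec w N (advance a) (?h, ?s) (min (h + s a) (Suc (length w)), s(a := 0))"
    using m[of "Suc (length w)"] by (simp only: x fun_upd_same fun_upd_upd diff_Suc_1)
  show ?case
    using exec_Pos_Suc[OF Suc(2) 1 2[unfolded advance_def]] by (simp only: advance_def)
qed


text \<open>The loop counts the left end marker and the letters, \<open>length w + 1\<close> cells;
  the increment in front of it makes this \<open>length w + 2\<close>.\<close>

definition "add_length a =
  Seq (Inc a) (Seq (While (Head (- {Right_End})) (Seq (Inc a) (Move Move_Right))) rewind)"

lemma exec_add_length: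
  assumes "s a + length w + 2 \<le> N"
  shows "exec w N (add_length a) (0, s) (0, s(a := s a + length w + 2))"
proof -
  have 1: "exec w N (While (Head (- {Right_End})) (Seq (Inc a) (Move Move_Right))) (h, s)
      (Suc (length w), s(a := s a + d))" if "h + d = Suc (length w)" "s a + d \<le> N" for h d s
    using that
  proof (induction d arbitrary: h s)
    case 0
    then show ?case
      using exec_While_False[of w "Head (- {Right_End})" h s] by (auto simp: input_cell_def)
  next
    case (Suc d)
    let ?s = "s(a := Suc (s a))"
    have "exec w N (Seq (Inc a) (Move Move_Right)) (h, s) (Suc h, ?s)"
      using Suc(2-) exec_Move[of w N Move_Right h ?s] by (intro exec_Seq[OF exec_Inc]) auto
    moreover have "exec w N (While (Head (- {Right_End})) (Seq (Inc a) (Move Move_Right))) (Suc h, ?s)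
      (Suc (length w), ?s(a := ?s a + d))"
      using Suc(2-) by (intro Suc(1)[of "Suc h" ?s]) auto
    moreover have "?s(a := ?s a + d) = s(a := s a + Suc d)" by auto
    ultimately show ?case
      using Suc(2-) by (intro exec_While_True) (simp_all add: input_cell_def del: fun_upd_apply)
  qed
  show ?thesis
    unfolding add_length_def using assms
    by (intro exec_Seq[OF exec_Inc] exec_Seq[OF 1[where d = "Suc (length w)"]]
        exec_eq[OF exec_rewind]) auto
qed

text \<open>Multiplication by \<open>length w + 2\<close>, the step from which the counter bound is
  built up.\<close>

definition "scale a b = Seq (While (Pos a) (Seq (Dec a) (add_length b))) (transfer b a)"

lemma exec_scale:
  assumes "a \<noteq> b" "s b = 0" "s a * (length w + 2) \<le> N"
  shows "exec w N (scale a b) (0, s) (0, s(a := s a * (length w + 2)))"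
proof -
  have 1: "exec w N (While (Pos a) (Seq (Dec a) (add_length b))) (0, s)
      (0, s(a := 0, b := s b + s a * (length w + 2)))"
    if "s b + s a * (length w + 2) \<le> N" for s
    using that
  proof (induction "s a" arbitrary: s)
    case 0
      then show ?case by (intro exec_Pos_0) (auto simp: fun_eq_iff)
  next
    case (Suc x)
    let ?s = "s(a := s a - 1, b := s b + length w + 2)"
    have x: "s a = Suc x" using Suc by simp
    have "exec w N (Seq (Dec a) (add_length b)) (0, s) (0, ?s)"
      using Suc(2-) x assms(1) exec_add_length[of "s(a := s a - 1)" b w N]
      by (intro exec_Seq[OF exec_Dec]) auto
    moreover have "exec w N (While (Pos a) (Seq (Dec a) (add_length b))) (0, ?s)
        (0, ?s(a := 0, b := ?s b + ?s a * (length w + 2)))"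
      using Suc(3) x assms(1) by (intro Suc(1)[of ?s]) (auto simp: algebra_simps)
    moreover have "?s(a := 0, b := ?s b + ?s a * (length w + 2)) =
        s(a := 0, b := s b + s a * (length w + 2))"
      using x assms(1) by (auto simp: fun_eq_iff algebra_simps)
    ultimately show ?case
      using Suc(2) by (metis exec_Pos_Suc)
  qed
  show ?thesis
    unfolding scale_def
    apply (rule exec_Seq[OF 1])
     apply (use assms in simp)
    apply (rule exec_eq[OF exec_transfer])
      apply (use assms in \<open>auto simp: fun_eq_iff\<close>)
    done
qed

section \<open>Functions computable by while programs\<close>

definition ext :: "('e \<Rightarrow> nat) set \<Rightarrow> ('e \<times> nat \<Rightarrow> nat) set" where
  "ext G = insert snd ((\<lambda>g. g \<circ> fst) ` G)"

text \<open>A component other than \<open>snd\<close> has the form \<open>g \<circ> fst\<close>, and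
  inserting the dummy 0 recovers \<open>g\<close>. The two kinds are distinguishable because
  \<open>snd\<close> depends on the second component.\<close>

definition ext_var :: "nat \<Rightarrow> (('e \<Rightarrow> nat) \<Rightarrow> nat) \<Rightarrow> ('e \<times> nat \<Rightarrow> nat) \<Rightarrow> nat" where
  "ext_var m r g = (if g = snd then m else r (\<lambda>x. g (x, 0)))"

lemma ext_var_simps [simp]:
  fixes g :: "'e \<Rightarrow> nat"
  shows "ext_var m r snd = m" "ext_var m r (g \<circ> fst) = r g"
proof -
  have "g \<circ> fst \<noteq> (snd :: 'e \<times> nat \<Rightarrow> nat)"
  proof
    assume "g \<circ> fst = (snd :: 'e \<times> nat \<Rightarrow> nat)"
    from fun_cong[OF this, of "(undefined, 0)"] fun_cong[OF this, of "(undefined, 1)"]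
    show False by simp
  qed
  then show "ext_var m r (g \<circ> fst) = r g" by (simp add: ext_var_def)
qed (simp add: ext_var_def)

text \<open>The first iterate outside \<open>b\<close>; meaningful only if the iteration ever leaves
  \<open>b\<close>.\<close>

definition halt :: "('s \<Rightarrow> bool) \<Rightarrow> ('s \<Rightarrow> 's) \<Rightarrow> 's \<Rightarrow> 's" where
  "halt b f s = (f ^^ (LEAST t. \<not> b ((f ^^ t) s))) s"

text \<open>The parameter sym only serves to fix the type of the input symbols.\<close>

locale logspace =
  fixes deg :: nat and sym :: "'a itself"
  assumes deg_pos: "0 < deg"
begin

definition N :: "'a list \<Rightarrow> nat" where
  "N w = (length w + 2) ^ deg"

lemma N_ge: "length w + 2 \<le> N w"
  using deg_pos self_le_power[of "length w + 2" deg] by (simp add: N_def)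

text \<open>
  The environments e range over an arbitrary type, and G is the set of those numerical components
  of e that are available in program variables; r tells where they are stored. A program
  computing F stores the result in the first unused variable m; all variables from m on are zero
  before, and all from m + 1 on are zero afterwards.
\<close>

definition pre :: "('e \<Rightarrow> nat) set \<Rightarrow> nat \<Rightarrow> (('e \<Rightarrow> nat) \<Rightarrow> nat) \<Rightarrow> 'a list \<Rightarrow> 'e \<Rightarrow> (nat \<Rightarrow> nat) \<Rightarrow> bool" where
  "pre G m r w e s \<longleftrightarrow> (\<forall>v. s v \<le> N w) \<and> (\<forall>g\<in>G. s (r g) = g e) \<and> (\<forall>v\<ge>m. s v = 0)"

definition bounded :: "('e \<Rightarrow> nat) set \<Rightarrow> 'a list \<Rightarrow> 'e \<Rightarrow> bool" where
  "bounded G w e \<longleftrightarrow> (\<forall>g\<in>G. g e \<le> N w)"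

abbreviation runs :: "'a list \<Rightarrow> 'a com \<Rightarrow> (nat \<Rightarrow> nat) \<Rightarrow> (nat \<Rightarrow> nat) \<Rightarrow> bool" where
  "runs w c s s' \<equiv> exec w (N w) c (0, s) (0, s')"

definition fn :: "('e \<Rightarrow> nat) set \<Rightarrow> ('a list \<Rightarrow> 'e \<Rightarrow> nat) \<Rightarrow> bool" where
  "fn G F \<longleftrightarrow> (\<forall>w e. bounded G w e \<longrightarrow> F w e \<le> N w) \<and>
    (\<forall>m r. (\<forall>g\<in>G. r g < m) \<longrightarrow>
      (\<exists>c. \<forall>w e s. pre G m r w e s \<longrightarrow> runs w c s (s(m := F w e))))"

lemma pre_bounded: "pre G m r w e s \<Longrightarrow> bounded G w e"
  unfolding pre_def bounded_def by metis

lemma fnI: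
  assumes "\<And>w e. bounded G w e \<Longrightarrow> F w e \<le> N w"
    and "\<And>m r. (\<And>g. g \<in> G \<Longrightarrow> r g < m) \<Longrightarrow>
      \<exists>c. \<forall>w e s. pre G m r w e s \<longrightarrow> runs w c s (s(m := F w e))"
  shows "fn G F"
  using assms by (simp add: fn_def)

lemma fn_le: "fn G F \<Longrightarrow> bounded G w e \<Longrightarrow> F w e \<le> N w"
  by (simp add: fn_def)

lemma fn_le_pre: "fn G F \<Longrightarrow> pre G m r w e s \<Longrightarrow> F w e \<le> N w"
  by (rule fn_le[OF _ pre_bounded])

lemma fn_exec:
  assumes "fn G F" "\<And>g. g \<in> G \<Longrightarrow> r g < m"
  obtains c where "\<And>w e s. pre G m r w e s \<Longrightarrow> runs w c s (s(m := F w e))"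
  using assms unfolding fn_def by blast

lemma pre_upd:
  "pre G m r w e s \<Longrightarrow> (\<And>g. g \<in> G \<Longrightarrow> r g < m) \<Longrightarrow> x \<le> N w \<Longrightarrow> pre G (Suc m) r w e (s(m := x))"
  unfolding pre_def by fastforce

lemma pre_ext:
  "pre G m r w e s \<Longrightarrow> (\<And>g. g \<in> G \<Longrightarrow> r g < m) \<Longrightarrow> x \<le> N w \<Longrightarrow>
    pre (ext G) (Suc m) (ext_var m r) w (e, x) (s(m := x))"
  unfolding pre_def ext_def by fastforce

lemma ext_var_less:
  "(\<And>g. g \<in> G \<Longrightarrow> r g < m) \<Longrightarrow> g \<in> ext G \<Longrightarrow> ext_var m r g < Suc m"
  unfolding ext_def by (auto simp: less_Suc_eq)

lemma bounded_ext: "bounded (ext G) w (e, x) \<longleftrightarrow> bounded G w e \<and> x \<le> N w"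
  by (auto simp: bounded_def ext_def)

lemma fn_var:
  assumes "g \<in> G"
  shows "fn G (\<lambda>w e. g e)"
proof (rule fnI)
  fix m and r :: "('b \<Rightarrow> nat) \<Rightarrow> nat" assume r: "\<And>g. g \<in> G \<Longrightarrow> r g < m"
  have "runs w (copy (r g) m (Suc m)) s (s(m := g e))" if "pre G m r w e s" for w e s
  proof -
    have "s (r g) = g e" "\<And>v. s v \<le> N w" "s m = 0" "s (Suc m) = 0"
      using that assms by (auto simp: pre_def)
    then show ?thesis
      using exec_copy[of "r g" m "Suc m" s "N w" w 0] r[OF assms] by (metis distinct_length_2_or_more
          distinct_singleton less_SucI less_irrefl_nat lessI)
  qed
  then show "\<exists>c. \<forall>w e s. pre G m r w e s \<longrightarrow> runs w c s (s(m := g e))" by blast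
qed (use assms in \<open>auto simp: bounded_def\<close>)

lemma fn_snd: "fn (ext G) (\<lambda>w e. snd e)"
  by (rule fn_var) (simp add: ext_def)

text \<open>The program for \<open>F\<close> is reused: the component \<open>g\<close> of
  \<open>\<theta> e\<close> is found where the component \<open>g \<circ> \<theta>\<close> of
  \<open>e\<close> is stored.\<close>

lemma fn_embed:
  assumes F: "fn G F" and \<theta>: "\<And>g. g \<in> G \<Longrightarrow> g \<circ> \<theta> \<in> G'"
  shows "fn G' (\<lambda>w e. F w (\<theta> e))"
proof (rule fnI)
  fix m and r :: "('c \<Rightarrow> nat) \<Rightarrow> nat" assume r: "\<And>g. g \<in> G' \<Longrightarrow> r g < m"
  obtain c where "\<And>w e s. pre G m (\<lambda>g. r (g \<circ> \<theta>)) w e s \<Longrightarrow> runs w c s (s(m := F w e))"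
    using fn_exec[OF F, of "\<lambda>g. r (g \<circ> \<theta>)" m] r \<theta> by blast
  moreover have "pre G m (\<lambda>g. r (g \<circ> \<theta>)) w (\<theta> e) s" if "pre G' m r w e s" for w e s
    using that \<theta> by (auto simp: pre_def)
  ultimately show "\<exists>c. \<forall>w e s. pre G' m r w e s \<longrightarrow> runs w c s (s(m := F w (\<theta> e)))"
    by blast
next
  fix w e assume "bounded G' w e"
  then have "bounded G w (\<theta> e)" using \<theta> unfolding bounded_def by fastforce
  then show "F w (\<theta> e) \<le> N w" by (rule fn_le[OF F])
qed

lemma fn_weak: "fn G F \<Longrightarrow> fn (ext G) (\<lambda>w e. F w (fst e))"
  by (rule fn_embed) (auto simp: ext_def)

lemma fn_0: "fn G (\<lambda>w e. 0)"
proof (rule fnI)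
  fix m and r :: "('b \<Rightarrow> nat) \<Rightarrow> nat"
  have "runs w Skip s (s(m := 0))" if "pre G m r w e s" for w e s
    by (rule exec_eq[OF exec_Skip]) (use that in \<open>auto simp: pre_def\<close>)
  then show "\<exists>c. \<forall>w e s. pre G m r w e s \<longrightarrow> runs w c s (s(m := 0))" by blast
qed simp

lemma fn_pred:
  assumes "fn G F"
  shows "fn G (\<lambda>w e. F w e - 1)"
proof (rule fnI)
  fix m and r :: "('b \<Rightarrow> nat) \<Rightarrow> nat" assume r: "\<And>g. g \<in> G \<Longrightarrow> r g < m"
  obtain c where c: "\<And>w e s. pre G m r w e s \<Longrightarrow> runs w c s (s(m := F w e))"
    using fn_exec[where r = r, OF assms r] by blast
  have "runs w (Seq c (Cond (Pos m) (Dec m) Skip)) s (s(m := F w e - 1))"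
    if "pre G m r w e s" for w e s
    using exec_Dec[of "s(m := F w e)" m] exec_Skip
    by (intro exec_Seq[OF c[OF that]] exec_Cond) auto
  then show "\<exists>c. \<forall>w e s. pre G m r w e s \<longrightarrow> runs w c s (s(m := F w e - 1))" by blast
next
  fix w e assume "bounded G w e"
  then show "F w e - 1 \<le> N w" using fn_le[OF assms, of w e] by simp
qed

lemma fn_if_pos:
  assumes C: "fn G C" and A: "fn G A" and B: "fn G B"
  shows "fn G (\<lambda>w e. if 0 < C w e then A w e else B w e)"
proof (rule fnI)
  fix m and r :: "('b \<Rightarrow> nat) \<Rightarrow> nat" assume r: "\<And>g. g \<in> G \<Longrightarrow> r g < m"
  have r': "\<And>g. g \<in> G \<Longrightarrow> r g < Suc m" using r less_SucI by blast
  obtain c where c: "\<And>w e s. pre G m r w e s \<Longrightarrow> runs w c s (s(m := C w e))"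
    using fn_exec[where r = r, OF C r] by blast
  obtain a where a: "\<And>w e s. pre G (Suc m) r w e s \<Longrightarrow> runs w a s (s(Suc m := A w e))"
    using fn_exec[where r = r, OF A r'] by blast
  obtain b where b: "\<And>w e s. pre G (Suc m) r w e s \<Longrightarrow> runs w b s (s(Suc m := B w e))"
    using fn_exec[where r = r, OF B r'] by blast
  have "runs w (Seq c (Seq (Cond (Pos m) a b) (Seq (clear m) (transfer (Suc m) m)))) s
      (s(m := if 0 < C w e then A w e else B w e))" (is "exec _ _ _ _ (0, s(m := ?r))")
    if s: "pre G m r w e s" for w e s
  proof -
    have s': "pre G (Suc m) r w e (s(m := C w e))"
      using pre_upd[OF s r] fn_le_pre[OF C s] by blast
    have r: "?r \<le> N w" using fn_le_pre[OF A s] fn_le_pre[OF B s] by simp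
    have sm: "s m = 0" "s (Suc m) = 0" using s by (auto simp: pre_def)
    have "runs w (Cond (Pos m) a b) (s(m := C w e)) (s(m := C w e, Suc m := ?r))"
      using a[OF s'] b[OF s'] by (intro exec_Cond) auto
    moreover have "runs w (transfer (Suc m) m) (s(m := C w e, Suc m := ?r, m := 0)) (s(m := ?r))"
      by (rule exec_eq[OF exec_transfer]) (use sm r in \<open>auto simp: fun_eq_iff\<close>)
    ultimately show ?thesis
      by (intro exec_Seq[OF c[OF s]] exec_Seq[OF _ exec_Seq[OF exec_clear]])
  qed
  then show "\<exists>c. \<forall>w e s. pre G m r w e s \<longrightarrow>
      runs w c s (s(m := if 0 < C w e then A w e else B w e))" by blast
next
  fix w e assume "bounded G w e"
  then show "(if 0 < C w e then A w e else B w e) \<le> N w"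
    using fn_le[OF A, of w e] fn_le[OF B, of w e] by simp
qed

lemma fn_cell:
  assumes "fn G F"
  shows "fn G (\<lambda>w e. if input_cell w (F w e) \<in> S then 1 else 0)"
proof (rule fnI)
  fix m and r :: "('b \<Rightarrow> nat) \<Rightarrow> nat" assume r: "\<And>g. g \<in> G \<Longrightarrow> r g < m"
  obtain c where c: "\<And>w e s. pre G m r w e s \<Longrightarrow> runs w c s (s(m := F w e))"
    using fn_exec[where r = r, OF assms r] by blast
  have "runs w (Seq c (Seq (advance m) (Seq (Cond (Head S) (Inc m) Skip) rewind))) s
      (s(m := if input_cell w (F w e) \<in> S then 1 else 0))" if s: "pre G m r w e s" for w e s
  proof -
    \<comment> \<open>The head cannot pass the right end marker, but all positions beyond it show
      the same cell, so truncating the position is harmless.\<close>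
    have cell: "input_cell w (min x (Suc (length w))) = input_cell w x" for x
      by (auto simp: input_cell_def min_def)
    have "0 < N w" using N_ge[of w] by simp
    then have "exec w (N w) (Cond (Head S) (Inc m) Skip) (min (0 + F w e) (Suc (length w)), s(m := 0))
        (min (0 + F w e) (Suc (length w)), s(m := if input_cell w (F w e) \<in> S then 1 else 0))"
      using exec_Inc[of "s(m := 0)" m "N w" w] exec_Skip
      by (intro exec_Cond) (auto simp: cell)
    then show ?thesis
      using exec_advance[of 0 w "N w" m "s(m := F w e)"]
      by (intro exec_Seq[OF c[OF s]] exec_Seq[OF _ exec_Seq[OF _ exec_rewind]]) auto
  qed
  then show "\<exists>c. \<forall>w e s. pre G m r w e s \<longrightarrow>
      runs w c s (s(m := if input_cell w (F w e) \<in> S then 1 else 0))" by blast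
next
  fix w show "(if input_cell w (F w e) \<in> S then 1 else 0) \<le> N w" for e
    using N_ge[of w] by simp
qed

text \<open>The degree is fixed, so the multiplications by \<open>length w + 2\<close> are written
  out in the program, starting from 1.\<close>

lemma exec_power:
  assumes "j \<le> deg" "s m = 0" "s (Suc m) = 0"
  shows "runs w (((\<lambda>c. Seq c (scale m (Suc m))) ^^ j) (Inc m)) s (s(m := (length w + 2) ^ j))"
  using assms(1)
proof (induction j)
  case 0
  then show ?case using exec_Inc[of s m "N w" w 0] assms N_ge[of w] by (simp del: fun_upd_apply)
next
  case (Suc j)
  have "(length w + 2) ^ Suc j \<le> N w"
    unfolding N_def by (rule power_increasing) (use Suc in auto)
  then show ?case
    using Suc assms exec_scale[of m "Suc m" "s(m := (length w + 2) ^ j)" w "N w"]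
    by (auto intro!: exec_Seq simp: mult.commute fun_upd_other simp del: fun_upd_apply add_2_eq_Suc' simp: fun_upd_same)
qed

lemma fn_N: "fn G (\<lambda>w e. N w)"
proof (rule fnI)
  fix m and r :: "('b \<Rightarrow> nat) \<Rightarrow> nat"
  have "runs w (((\<lambda>c. Seq c (scale m (Suc m))) ^^ deg) (Inc m)) s (s(m := N w))"
    if "pre G m r w e s" for w e s
    using exec_power[of deg s m w] that by (simp add: pre_def N_def)
  then show "\<exists>c. \<forall>w e s. pre G m r w e s \<longrightarrow> runs w c s (s(m := N w))" by blast
qed simp

text \<open>A counter must not exceed \<open>N w\<close>. The program therefore computes
  \<open>N w - F w e\<close> first and increments only if this is positive.\<close>

lemma fn_Suc:
  assumes "fn G F"
  shows "fn G (\<lambda>w e. min (N w) (Suc (F w e)))"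
proof (rule fnI)
  fix m and r :: "('b \<Rightarrow> nat) \<Rightarrow> nat" assume r: "\<And>g. g \<in> G \<Longrightarrow> r g < m"
  have r': "\<And>g. g \<in> G \<Longrightarrow> r g < Suc m" using r less_SucI by blast
  obtain c where c: "\<And>w e s. pre G m r w e s \<Longrightarrow> runs w c s (s(m := F w e))"
    using fn_exec[where r = r, OF assms r] by blast
  obtain n where n: "\<And>w e s. pre G (Suc m) r w e s \<Longrightarrow> runs w n s (s(Suc m := N w))"
    using fn_exec[where r = r, OF fn_N r'] by blast
  let ?sub = "While (Pos (m + 2)) (Seq (Dec (m + 2)) (Dec (Suc m)))"
  have sub: "runs w ?sub s (s(m + 2 := 0, Suc m := s (Suc m) - s (m + 2)))"
    if "s (m + 2) \<le> s (Suc m)" for w s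
    using that
  proof (induction "s (m + 2)" arbitrary: s)
    case 0
      then show ?case by (intro exec_Pos_0) (auto simp: fun_eq_iff)
  next
    case (Suc x)
    let ?s = "s(m + 2 := s (m + 2) - 1, Suc m := s (Suc m) - 1)"
    have "runs w (Seq (Dec (m + 2)) (Dec (Suc m))) s ?s"
      using Suc(2-) exec_Dec[of "s(m + 2 := s (m + 2) - 1)" "Suc m" w "N w" 0]
      by (intro exec_Seq[OF exec_Dec]) auto
    moreover have "runs w ?sub ?s (?s(m + 2 := 0, Suc m := ?s (Suc m) - ?s (m + 2)))"
      using Suc(2-) by (intro Suc(1)[of ?s]) auto
    moreover have "?s(m + 2 := 0, Suc m := ?s (Suc m) - ?s (m + 2)) =
        s(m + 2 := 0, Suc m := s (Suc m) - s (m + 2))"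
      using Suc(2-) by (auto simp: fun_eq_iff)
    ultimately show ?case
      using Suc(2) by (metis exec_Pos_Suc)
  qed
  have "runs w (Seq c (Seq n (Seq (copy m (m + 2) (m + 3)) (Seq ?sub
      (Seq (Cond (Pos (Suc m)) (Inc m) Skip) (clear (Suc m))))))) s (s(m := min (N w) (Suc (F w e))))"
    if s: "pre G m r w e s" for w e s
  proof -
    let ?x = "F w e"
    have x: "?x \<le> N w" using fn_le_pre[OF assms s] .
    have sm: "s m = 0" "s (Suc m) = 0" "s (m + 2) = 0" "s (m + 3) = 0"
      using s by (auto simp: pre_def)
    have 1: "runs w n (s(m := ?x)) (s(m := ?x, Suc m := N w))"
      using n[OF pre_upd[OF s r x]] .
    have 2: "runs w (copy m (m + 2) (m + 3)) (s(m := ?x, Suc m := N w))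
       (s(m := ?x, Suc m := N w, m + 2 := ?x))"
      by (rule exec_eq[OF exec_copy]) (use sm x in auto)
    have 3: "runs w ?sub (s(m := ?x, Suc m := N w, m + 2 := ?x))
       (s(m := ?x, Suc m := N w - ?x))"
      by (rule exec_eq[OF sub]) (use sm x in \<open>auto simp: fun_eq_iff\<close>)
    have 4: "runs w (Cond (Pos (Suc m)) (Inc m) Skip) (s(m := ?x, Suc m := N w - ?x))
       (s(m := min (N w) (Suc ?x), Suc m := N w - ?x))"
    proof (rule exec_Cond, cases "?x < N w")
      case True
      have "runs w (Inc m) (s(m := ?x, Suc m := N w - ?x)) (s(m := min (N w) (Suc ?x), Suc m := N w - ?x))"
        by (rule exec_eq[OF exec_Inc]) (use True in \<open>auto simp: fun_eq_iff\<close>)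
      then show "runs w (if tval w (Pos (Suc m)) 0 (s(m := ?x, Suc m := N w - ?x)) then Inc m else Skip)
        (s(m := ?x, Suc m := N w - ?x)) (s(m := min (N w) (Suc ?x), Suc m := N w - ?x))"
        using True by simp
    next
      case False
      then show "runs w (if tval w (Pos (Suc m)) 0 (s(m := ?x, Suc m := N w - ?x)) then Inc m else Skip)
        (s(m := ?x, Suc m := N w - ?x)) (s(m := min (N w) (Suc ?x), Suc m := N w - ?x))"
        using x exec_Skip by (simp add: min_def)
    qed
    have 5: "runs w (clear (Suc m)) (s(m := min (N w) (Suc ?x), Suc m := N w - ?x))
        (s(m := min (N w) (Suc ?x)))"
      by (rule exec_eq[OF exec_clear]) (use sm in \<open>auto simp: fun_eq_iff\<close>)
    show ?thesis
      by (intro exec_Seq[OF c[OF s]] exec_Seq[OF 1] exec_Seq[OF 2] exec_Seq[OF 3] exec_Seq[OF 4] 5)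
  qed
  then show "\<exists>c. \<forall>w e s. pre G m r w e s \<longrightarrow> runs w c s (s(m := min (N w) (Suc (F w e))))"
    by blast
qed simp

end

context logspace
begin

text \<open>The body of the loop leaves its continuation flag in the variable following the state.\<close>

lemma fn_loop:
  fixes G :: "('e \<Rightarrow> nat) set"
  assumes X: "fn G X" and Y: "fn G Y" and Z: "fn G Z"
    and B: "fn (ext (ext (ext G))) (\<lambda>w p.
      if B w (fst (fst (fst p))) (snd (fst (fst p))) (snd (fst p)) (snd p) then 1 else 0)"
    and S1: "fn (ext (ext (ext G))) (\<lambda>w p. S1 w (fst (fst (fst p))) (snd (fst (fst p))) (snd (fst p)) (snd p))"
    and S2: "fn (ext (ext (ext G))) (\<lambda>w p. S2 w (fst (fst (fst p))) (snd (fst (fst p))) (snd (fst p)) (snd p))"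
    and S3: "fn (ext (ext (ext G))) (\<lambda>w p. S3 w (fst (fst (fst p))) (snd (fst (fst p))) (snd (fst p)) (snd p))"
    and halts: "\<And>w e. bounded G w e \<Longrightarrow> \<exists>t. \<not> (\<lambda>(x, y, z). B w e x y z)
      (((\<lambda>(x, y, z). (S1 w e x y z, S2 w e x y z, S3 w e x y z)) ^^ t) (X w e, Y w e, Z w e))"
  shows "fn G (\<lambda>w e. fst (snd (halt (\<lambda>(x, y, z). B w e x y z)
    (\<lambda>(x, y, z). (S1 w e x y z, S2 w e x y z, S3 w e x y z)) (X w e, Y w e, Z w e))))"
proof -
  define b where "b w e = (\<lambda>(x, y, z). B w e x y z)" for w e
  define f where "f w e = (\<lambda>(x, y, z). (S1 w e x y z, S2 w e x y z, S3 w e x y z))" for w e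
  define ini where "ini w e = (X w e, Y w e, Z w e)" for w e
  define okt where "okt w = (\<lambda>(x, y, z). x \<le> N w \<and> y \<le> N w \<and> z \<le> N w)" for w
  have f_ok: "okt w (f w e \<sigma>)" if "bounded G w e" "okt w \<sigma>" for w e \<sigma>
  proof (cases \<sigma>)
    case (fields x y z)
    then have "bounded (ext (ext (ext G))) w (((e, x), y), z)"
      using that by (simp add: bounded_ext okt_def)
    from fn_le[OF S1 this] fn_le[OF S2 this] fn_le[OF S3 this] show ?thesis
      by (simp add: fields f_def okt_def)
  qed
  have f_oks: "okt w ((f w e ^^ t) \<sigma>)" if "bounded G w e" "okt w \<sigma>" for w e \<sigma> t
    by (induction t) (use f_ok that in auto)
  have ini_ok: "okt w (ini w e)" if "bounded G w e" for w e
    using fn_le[OF X that] fn_le[OF Y that] fn_le[OF Z that] by (simp add: ini_def okt_def)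
  have "fn G (\<lambda>w e. fst (snd (halt (b w e) (f w e) (ini w e))))"
  proof (rule fnI)
    fix w e assume "bounded G w e"
    from f_oks[OF this ini_ok[OF this]] have "okt w (halt (b w e) (f w e) (ini w e))"
      by (simp add: halt_def)
    then show "fst (snd (halt (b w e) (f w e) (ini w e))) \<le> N w"
      by (simp add: okt_def split: prod.splits)
  next
    fix m and r :: "('e \<Rightarrow> nat) \<Rightarrow> nat" assume r: "\<And>g. g \<in> G \<Longrightarrow> r g < m"
    define m1 m2 m3 m4 m5 where ms: "m1 = Suc m" "m2 = Suc m1" "m3 = Suc m2" "m4 = Suc m3" "m5 = Suc m4"
    let ?r1 = "ext_var m r" let ?r2 = "ext_var m1 ?r1" let ?r3 = "ext_var m2 ?r2"
    let ?G3 = "ext (ext (ext G))"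
    have r1: "\<And>g. g \<in> ext G \<Longrightarrow> ?r1 g < m1" using ext_var_less[of G r, OF r] unfolding ms by blast
    have r2: "\<And>g. g \<in> ext (ext G) \<Longrightarrow> ?r2 g < m2" using ext_var_less[of "ext G" ?r1, OF r1] unfolding ms by blast
    have r3: "\<And>g. g \<in> ?G3 \<Longrightarrow> ?r3 g < m3" using ext_var_less[of "ext (ext G)" ?r2, OF r2] unfolding ms by blast
    have rm1: "\<And>g. g \<in> G \<Longrightarrow> r g < m1" using r unfolding ms by (simp add: less_SucI)
    have rm2: "\<And>g. g \<in> G \<Longrightarrow> r g < m2" using rm1 unfolding ms(2) by (simp add: less_SucI)
    have rm4: "\<And>g. g \<in> ?G3 \<Longrightarrow> ?r3 g < m4" using r3 unfolding ms(4) by (simp add: less_SucI)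
    have rm5: "\<And>g. g \<in> ?G3 \<Longrightarrow> ?r3 g < m5" using rm4 unfolding ms(5) by (simp add: less_SucI)
    obtain cX where cX: "\<And>w e s. pre G m r w e s \<Longrightarrow> runs w cX s (s(m := X w e))"
      using fn_exec[where r = r, OF X r] by blast
    obtain cY where cY: "\<And>w e s. pre G m1 r w e s \<Longrightarrow> runs w cY s (s(m1 := Y w e))"
      using fn_exec[where r = r, OF Y rm1] by blast
    obtain cZ where cZ: "\<And>w e s. pre G m2 r w e s \<Longrightarrow> runs w cZ s (s(m2 := Z w e))"
      using fn_exec[where r = r, OF Z rm2] by blast
    define fl where "fl w e \<sigma> = (if b w e \<sigma> then 1 else 0 :: nat)" for w e \<sigma>
    obtain cB where cB0: "\<And>w p s. pre ?G3 m3 ?r3 w p s \<Longrightarrow> runs w cB s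
        (s(m3 := if B w (fst (fst (fst p))) (snd (fst (fst p))) (snd (fst p)) (snd p) then 1 else 0))"
      using fn_exec[where r = ?r3, OF B r3] by blast
    have cB: "runs w cB s (s(m3 := fl w e (x, y, z)))"
      if "pre ?G3 m3 ?r3 w (((e, x), y), z) s" for w e x y z s
      using cB0[OF that] unfolding fl_def b_def by simp
    obtain c1 where c10: "\<And>w p s. pre ?G3 m3 ?r3 w p s \<Longrightarrow> runs w c1 s
        (s(m3 := S1 w (fst (fst (fst p))) (snd (fst (fst p))) (snd (fst p)) (snd p)))"
      using fn_exec[where r = ?r3, OF S1 r3] by blast
    have c1: "runs w c1 s (s(m3 := S1 w e x y z))"
      if "pre ?G3 m3 ?r3 w (((e, x), y), z) s" for w e x y z s
      using c10[OF that] by simp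
    obtain c2 where c20: "\<And>w p s. pre ?G3 m4 ?r3 w p s \<Longrightarrow> runs w c2 s
        (s(m4 := S2 w (fst (fst (fst p))) (snd (fst (fst p))) (snd (fst p)) (snd p)))"
      using fn_exec[where r = ?r3, OF S2 rm4] by blast
    have c2: "runs w c2 s (s(m4 := S2 w e x y z))"
      if "pre ?G3 m4 ?r3 w (((e, x), y), z) s" for w e x y z s
      using c20[OF that] by simp
    obtain c3 where c30: "\<And>w p s. pre ?G3 m5 ?r3 w p s \<Longrightarrow> runs w c3 s
        (s(m5 := S3 w (fst (fst (fst p))) (snd (fst (fst p))) (snd (fst p)) (snd p)))"
      using fn_exec[where r = ?r3, OF S3 rm5] by blast
    have c3: "runs w c3 s (s(m5 := S3 w e x y z))"
      if "pre ?G3 m5 ?r3 w (((e, x), y), z) s" for w e x y z s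
      using c30[OF that] by simp
    let ?st = "\<lambda>s (x, y, z). s(m := x, m1 := y, m2 := z)"
    have pre3: "pre ?G3 m3 ?r3 w (((e, x), y), z) (?st s (x, y, z))"
      if s: "pre G m r w e s" and ok: "okt w (x, y, z)" for w e s x y z
    proof -
      have xyz: "x \<le> N w" "y \<le> N w" "z \<le> N w" using ok by (auto simp: okt_def)
      have "pre (ext G) m1 ?r1 w (e, x) (s(m := x))"
        unfolding ms by (rule pre_ext[OF s r xyz(1)])
      then have "pre (ext (ext G)) m2 ?r2 w ((e, x), y) (s(m := x, m1 := y))"
        unfolding ms(2) using r1 xyz(2) by (rule pre_ext)
      then have "pre ?G3 m3 ?r3 w (((e, x), y), z) (s(m := x, m1 := y, m2 := z))"
        unfolding ms(3) using r2 xyz(3) by (rule pre_ext)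
      then show ?thesis by simp
    qed
    \<comment> \<open>The three new values are computed before any old one is erased, since each may
      depend on all of them; \<open>cB\<close> then refreshes the flag in \<open>m3\<close>.\<close>
    let ?body = "Seq (clear m3) (Seq c1 (Seq c2 (Seq c3 (Seq (clear m) (Seq (clear m1) (Seq (clear m2)
      (Seq (transfer m3 m) (Seq (transfer m4 m1) (Seq (transfer m5 m2) cB)))))))))"
    have body: "runs w ?body ((?st s \<sigma>)(m3 := v)) ((?st s (f w e \<sigma>))(m3 := fl w e (f w e \<sigma>)))"
      if s: "pre G m r w e s" and ok: "okt w \<sigma>" for w e s \<sigma> v
    proof (cases \<sigma>)
      case (fields x y z)
      let ?p = "(((e, x), y), z)"
      obtain x' y' z' where f': "f w e \<sigma> = (x', y', z')" by (cases "f w e \<sigma>")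
      have ok': "okt w (x', y', z')" using f_ok[OF pre_bounded[OF s] ok] by (simp add: f')
      have le: "x' \<le> N w" "y' \<le> N w" "z' \<le> N w" using ok' by (auto simp: okt_def)
      have v': "S1 w e x y z = x'" "S2 w e x y z = y'" "S3 w e x y z = z'"
        using f' by (auto simp: fields f_def)
      have z0: "s m = 0" "s m1 = 0" "s m2 = 0" "s m3 = 0" "s m4 = 0" "s m5 = 0"
        using s by (auto simp: pre_def ms)
      have d: "distinct [m, m1, m2, m3, m4, m5]" by (simp add: ms)
      let ?s = "?st s (x, y, z)" and ?s' = "?st s (x', y', z')"
      have p3: "pre ?G3 m3 ?r3 w ?p ?s" using pre3[OF s, of x y z] ok fields by blast
      have p4: "pre ?G3 m4 ?r3 w ?p (?s(m3 := x'))"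
        unfolding ms(4) by (rule pre_upd[OF p3 r3 le(1)])
      have p5: "pre ?G3 m5 ?r3 w ?p (?s(m3 := x', m4 := y'))"
        unfolding ms(5) by (rule pre_upd[OF p4 rm4 le(2)])
      have e0: "runs w (clear m3) (?s(m3 := v)) ?s"
        by (rule exec_eq[OF exec_clear]) (use d z0 in \<open>auto simp: fun_eq_iff\<close>)
      have e1: "runs w c1 ?s (?s(m3 := x'))"
        using c1[OF p3] by (simp only: v')
      have e2: "runs w c2 (?s(m3 := x')) (?s(m3 := x', m4 := y'))"
        using c2[OF p4] by (simp only: v')
      have e3: "runs w c3 (?s(m3 := x', m4 := y')) (?s(m3 := x', m4 := y', m5 := z'))"
        using c3[OF p5] by (simp only: v')
      let ?t = "?s(m3 := x', m4 := y', m5 := z', m := 0, m1 := 0, m2 := 0)"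
      have e4: "runs w (transfer m3 m) ?t (?t(m3 := 0, m := x'))"
        by (rule exec_eq[OF exec_transfer]) (use d le in auto)
      have e5: "runs w (transfer m4 m1) (?t(m3 := 0, m := x'))
          (?t(m3 := 0, m := x', m4 := 0, m1 := y'))"
        by (rule exec_eq[OF exec_transfer]) (use d le in auto)
      have e6: "runs w (transfer m5 m2) (?t(m3 := 0, m := x', m4 := 0, m1 := y')) ?s'"
        by (rule exec_eq[OF exec_transfer]) (use d le z0 in \<open>auto simp: fun_eq_iff\<close>)
      have e7: "runs w cB ?s' (?s'(m3 := fl w e (x', y', z')))"
        by (rule cB[OF pre3[OF s ok']])
      show ?thesis
        unfolding f'[unfolded fields] fields
        by (intro exec_Seq[OF e0] exec_Seq[OF e1] exec_Seq[OF e2] exec_Seq[OF e3]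
            exec_Seq[OF exec_clear] exec_Seq[OF e4] exec_Seq[OF e5] exec_Seq[OF e6] e7)
    qed
    have loop: "runs w (While (Pos m3) ?body) ((?st s \<sigma>)(m3 := fl w e \<sigma>))
        (?st s ((f w e ^^ t) \<sigma>))"
      if s: "pre G m r w e s" and "okt w \<sigma>" "\<And>t'. t' < t \<Longrightarrow> b w e ((f w e ^^ t') \<sigma>)"
        "\<not> b w e ((f w e ^^ t) \<sigma>)" for w e s \<sigma> t
      using that(2-)
    proof (induction t arbitrary: \<sigma>)
      case 0
      have f0: "fl w e \<sigma> = 0" using 0 by (simp add: fl_def)
      have eq: "(?st s \<sigma>)(m3 := fl w e \<sigma>) = ?st s \<sigma>"
        using s by (auto simp: f0 pre_def ms fun_eq_iff split: prod.splits)
      have "((?st s \<sigma>)(m3 := fl w e \<sigma>)) m3 = 0" by (simp add: f0)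
      from exec_Pos_0[OF this eq] show ?case by (simp only: funpow.simps id_apply)
    next
      case (Suc t)
      have b: "b w e \<sigma>" using Suc.prems(2)[of 0] by simp
      have "runs w (While (Pos m3) ?body) ((?st s (f w e \<sigma>))(m3 := fl w e (f w e \<sigma>)))
        (?st s ((f w e ^^ t) (f w e \<sigma>)))"
      proof (rule Suc.IH)
        show "okt w (f w e \<sigma>)" using f_ok[OF pre_bounded[OF s] Suc.prems(1)] .
        show "b w e ((f w e ^^ t') (f w e \<sigma>))" if "t' < t" for t'
          using Suc.prems(2)[of "Suc t'"] that by (simp add: funpow_swap1)
        show "\<not> b w e ((f w e ^^ t) (f w e \<sigma>))"
          using Suc.prems(3) by (simp add: funpow_swap1)
      qed
      moreover have "runs w ?body ((?st s \<sigma>)(m3 := fl w e \<sigma>))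
          ((?st s (f w e \<sigma>))(m3 := fl w e (f w e \<sigma>)))"
        by (rule body[OF s Suc.prems(1)])
      moreover have "Suc 0 = ((?st s \<sigma>)(m3 := fl w e \<sigma>)) m3" using b by (simp add: fl_def)
      ultimately show ?case
        using exec_Pos_Suc by (simp only: funpow_swap1 funpow.simps o_apply)
    qed
    \<comment> \<open>Of the final state only the middle component is kept; it moves from
      \<open>m1\<close> to the result variable \<open>m\<close>.\<close>
    let ?prog = "Seq cX (Seq cY (Seq cZ (Seq cB (Seq (While (Pos m3) ?body)
      (Seq (clear m) (Seq (transfer m1 m) (clear m2)))))))"
    have "runs w ?prog s (s(m := fst (snd (halt (b w e) (f w e) (ini w e)))))"
      if s: "pre G m r w e s" for w e s
    proof -
      let ?x = "X w e" and ?y = "Y w e" and ?z = "Z w e"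
      define t where "t = (LEAST t. \<not> b w e ((f w e ^^ t) (ini w e)))"
      have bd: "bounded G w e" by (rule pre_bounded[OF s])
      have "\<exists>t. \<not> b w e ((f w e ^^ t) (ini w e))"
        using halts[OF bd] unfolding b_def f_def ini_def .
      then have t: "\<not> b w e ((f w e ^^ t) (ini w e))"
        unfolding t_def by (rule LeastI_ex)
      have t': "b w e ((f w e ^^ t') (ini w e))" if "t' < t" for t'
        using not_less_Least that unfolding t_def by blast
      obtain x' y' z' where h: "halt (b w e) (f w e) (ini w e) = (x', y', z')"
        by (cases "halt (b w e) (f w e) (ini w e)")
      then have ft: "(f w e ^^ t) (ini w e) = (x', y', z')" by (simp add: halt_def t_def)
      have "okt w (x', y', z')" using f_oks[OF bd ini_ok[OF bd], of t] by (simp add: ft)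
      then have le': "y' \<le> N w" by (simp add: okt_def)
      have ok: "okt w (?x, ?y, ?z)" using ini_ok[OF bd] by (simp add: ini_def)
      then have le: "?x \<le> N w" "?y \<le> N w" "?z \<le> N w" by (auto simp: okt_def)
      have z0: "s m = 0" "s m1 = 0" "s m2 = 0"
        using s by (auto simp: pre_def ms)
      have d: "distinct [m, m1, m2]" by (simp add: ms)
      have p1: "pre G m1 r w e (s(m := ?x))" unfolding ms(1) by (rule pre_upd[OF s r le(1)])
      have p2: "pre G m2 r w e (s(m := ?x, m1 := ?y))" unfolding ms(2) by (rule pre_upd[OF p1 rm1 le(2)])
      have e4: "runs w cB (s(m := ?x, m1 := ?y, m2 := ?z)) ((?st s (ini w e))(m3 := fl w e (ini w e)))"
        using cB[OF pre3[OF s ok]] by (simp only: ini_def prod.case)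
      have e5: "runs w (While (Pos m3) ?body) ((?st s (ini w e))(m3 := fl w e (ini w e)))
          (s(m := x', m1 := y', m2 := z'))"
        using loop[OF s ini_ok[OF bd] t' t] by (simp only: ft prod.case)
      have e6: "runs w (transfer m1 m) (s(m := x', m1 := y', m2 := z', m := 0)) (s(m := y', m2 := z'))"
        by (rule exec_eq[OF exec_transfer]) (use d le' z0 in \<open>auto simp: fun_eq_iff\<close>)
      have e7: "runs w (clear m2) (s(m := y', m2 := z')) (s(m := y'))"
        by (rule exec_eq[OF exec_clear]) (use d z0 in \<open>auto simp: fun_eq_iff\<close>)
      show ?thesis
        unfolding h fst_conv snd_conv
        by (intro exec_Seq[OF cX[OF s]] exec_Seq[OF cY[OF p1]] exec_Seq[OF cZ[OF p2]] exec_Seq[OF e4]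
            exec_Seq[OF e5] exec_Seq[OF exec_clear] exec_Seq[OF e6] e7)
    qed
    then show "\<exists>c. \<forall>w e s. pre G m r w e s \<longrightarrow>
        runs w c s (s(m := fst (snd (halt (b w e) (f w e) (ini w e)))))" by blast
  qed
  then show ?thesis unfolding b_def f_def ini_def .
qed

lemma fn_cong_bounded:
  assumes "fn G A" "\<And>w e. bounded G w e \<Longrightarrow> A w e = B w e"
  shows "fn G B"
proof (rule fnI)
  fix w e assume "bounded G w e"
  then show "B w e \<le> N w" using fn_le[OF assms(1)] assms(2) by metis
next
  fix m and r :: "('b \<Rightarrow> nat) \<Rightarrow> nat" assume "\<And>g. g \<in> G \<Longrightarrow> r g < m"
  from fn_exec[where r = r, OF assms(1) this]
  obtain c where "\<And>w e s. pre G m r w e s \<Longrightarrow> runs w c s (s(m := A w e))" by blast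
  then show "\<exists>c. \<forall>w e s. pre G m r w e s \<longrightarrow> runs w c s (s(m := B w e))"
    using assms(2) pre_bounded by metis
qed

section \<open>Predicates, case distinction and primitive recursion\<close>

definition dc :: "('e \<Rightarrow> nat) set \<Rightarrow> ('a list \<Rightarrow> 'e \<Rightarrow> bool) \<Rightarrow> bool" where
  "dc G P \<longleftrightarrow> fn G (\<lambda>w e. if P w e then 1 else 0)"

lemma fn_min_const: "fn G (\<lambda>w e. min (N w) k)"
proof (induction k)
  case 0
  then show ?case using fn_0 by simp
next
  case (Suc k)
  have "min (N w) (Suc (min (N w) k)) = min (N w) (Suc k)" for w by (simp add: min_def)
  then show ?case using fn_Suc[OF Suc] by simp
qed

text \<open>Already for the empty word the bound is \<open>2 ^ deg\<close>, so constants up to it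
  are never truncated.\<close>

lemma fn_const:
  assumes "k \<le> 2 ^ deg"
  shows "fn G (\<lambda>w e. k)"
proof -
  have "k \<le> N w" for w
    using assms power_mono[of 2 "length w + 2" deg] by (simp add: N_def)
  then show ?thesis using fn_min_const[of G k] by (simp add: min_absorb2)
qed

lemma fn_1: "fn G (\<lambda>w e. Suc 0)"
  by (rule fn_const) simp

lemma fn_if:
  assumes "dc G P" "fn G A" "fn G B"
  shows "fn G (\<lambda>w e. if P w e then A w e else B w e)"
proof -
  have "(\<lambda>w e. if 0 < (if P w e then 1 else 0 :: nat) then A w e else B w e) =
      (\<lambda>w e. if P w e then A w e else B w e)"
    by (intro ext) simp
  then show ?thesis using fn_if_pos[OF assms(1)[unfolded dc_def] assms(2,3)] by simp
qed

lemma dc_if: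
  assumes "dc G P" "dc G A" "dc G B"
  shows "dc G (\<lambda>w e. if P w e then A w e else B w e)"
proof -
  have "(\<lambda>w e. if P w e then if A w e then 1 else 0 else if B w e then 1 else 0 :: nat) =
      (\<lambda>w e. if if P w e then A w e else B w e then 1 else 0)"
    by (intro ext) simp
  then show ?thesis using fn_if[OF assms(1) assms(2,3)[unfolded dc_def]] unfolding dc_def by simp
qed

lemma dc_cong: "dc G P \<Longrightarrow> (\<And>w e. P w e \<longleftrightarrow> Q w e) \<Longrightarrow> dc G Q"
  by (simp add: dc_def)

lemma fn_cong: "fn G A \<Longrightarrow> (\<And>w e. A w e = B w e) \<Longrightarrow> fn G B"
  by (rule fn_cong_bounded)

lemma dc_True: "dc G (\<lambda>w e. True)"
  using fn_1 by (simp add: dc_def)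

lemma dc_False: "dc G (\<lambda>w e. False)"
  using fn_0 by (simp add: dc_def)

lemma dc_not:
  assumes "dc G P"
  shows "dc G (\<lambda>w e. \<not> P w e)"
  by (rule dc_cong[OF dc_if[OF assms dc_False dc_True]]) simp

lemma dc_and:
  assumes "dc G P" "dc G Q"
  shows "dc G (\<lambda>w e. P w e \<and> Q w e)"
  by (rule dc_cong[OF dc_if[OF assms dc_False]]) simp

lemma dc_or:
  assumes "dc G P" "dc G Q"
  shows "dc G (\<lambda>w e. P w e \<or> Q w e)"
  by (rule dc_cong[OF dc_if[OF assms(1) dc_True assms(2)]]) simp

lemma dc_imp:
  assumes "dc G P" "dc G Q"
  shows "dc G (\<lambda>w e. P w e \<longrightarrow> Q w e)"
  by (rule dc_cong[OF dc_if[OF assms dc_True]]) simp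

lemma dc_iff:
  assumes "dc G P" "dc G Q"
  shows "dc G (\<lambda>w e. P w e = Q w e)"
  by (rule dc_cong[OF dc_if[OF assms dc_not[OF assms(2)]]]) auto

lemma dc_weak: "dc G P \<Longrightarrow> dc (ext G) (\<lambda>w e. P w (fst e))"
  unfolding dc_def by (rule fn_weak)

lemma dc_cell: "fn G F \<Longrightarrow> dc G (\<lambda>w e. input_cell w (F w e) \<in> S)"
  unfolding dc_def by (rule fn_cell)

lemma dc_pos:
  assumes "fn G F"
  shows "dc G (\<lambda>w e. 0 < F w e)"
  unfolding dc_def by (rule fn_if_pos[OF assms]) (simp_all add: fn_1 fn_0)

text \<open>A loop over index, accumulator and remaining rounds. The truncation of the index at
  \<open>N w\<close> is never felt, because the number of rounds is itself at most
  \<open>N w\<close>.\<close>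

lemma fn_rec:
  assumes K: "fn G K" and A: "fn G A"
    and S: "fn (ext (ext G)) (\<lambda>w p. S w (fst (fst p)) (snd (fst p)) (snd p))"
  shows "fn G (\<lambda>w e. rec_nat (A w e) (S w e) (K w e))"
proof -
  let ?f = "\<lambda>w e. \<lambda>(i, a, k). (min (N w) (Suc i), S w e i a, k - 1)"
  let ?b = "\<lambda>w e. \<lambda>(i, a, k). 0 < (k::nat)"
  have iter: "(?f w e ^^ t) (0, A w e, K w e) = (t, rec_nat (A w e) (S w e) t, K w e - t)"
    if "bounded G w e" "t \<le> K w e" for w e t
    using that(2)
  proof (induction t)
    case (Suc t)
    then have "min (N w) (Suc t) = Suc t" using fn_le[OF K that(1)] by simp
    then show ?case using Suc by simp
  qed simp
  have stop: "\<not> ?b w e ((?f w e ^^ K w e) (0, A w e, K w e))" if "bounded G w e" for w e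
    unfolding iter[OF that order_refl] by simp
  have lst: "(LEAST t. \<not> ?b w e ((?f w e ^^ t) (0, A w e, K w e))) = K w e" if "bounded G w e" for w e
  proof (rule Least_equality[of "\<lambda>t. \<not> ?b w e ((?f w e ^^ t) (0, A w e, K w e))", OF stop[OF that]])
    fix t assume "\<not> ?b w e ((?f w e ^^ t) (0, A w e, K w e))"
    then show "K w e \<le> t"
      using iter[OF that, of t] by (cases "t \<le> K w e") auto
  qed
  have "fn G (\<lambda>w e. fst (snd (halt (?b w e) (?f w e) (0, A w e, K w e))))"
  proof (rule fn_loop[where B = "\<lambda>w e i a k. 0 < k" and ?S1.0 = "\<lambda>w e i a k. min (N w) (Suc i)"
        and ?S2.0 = "\<lambda>w e i a k. S w e i a" and ?S3.0 = "\<lambda>w e i a k. k - 1", OF fn_0 A K])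
    show "fn (ext (ext (ext G))) (\<lambda>w p. if 0 < snd p then 1 else 0)"
      using dc_pos[OF fn_snd] by (simp add: dc_def)
    show "fn (ext (ext (ext G))) (\<lambda>w p. min (N w) (Suc (snd (fst (fst p)))))"
      by (rule fn_Suc[OF fn_weak[OF fn_weak[OF fn_snd]]])
    show "fn (ext (ext (ext G))) (\<lambda>w p. S w (fst (fst (fst p))) (snd (fst (fst p))) (snd (fst p)))"
      by (rule fn_weak[OF S])
    show "fn (ext (ext (ext G))) (\<lambda>w p. snd p - 1)"
      by (rule fn_pred[OF fn_snd])
    show "\<exists>t. \<not> ?b w e ((?f w e ^^ t) (0, A w e, K w e))" if "bounded G w e" for w e
      by (rule exI[of _ "K w e"]) (rule stop[OF that])
  qed
  moreover have "fst (snd (halt (?b w e) (?f w e) (0, A w e, K w e))) = rec_nat (A w e) (S w e) (K w e)"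
    if "bounded G w e" for w e
    unfolding halt_def lst[OF that] iter[OF that order_refl] by simp
  ultimately show ?thesis
    by (rule fn_cong_bounded)
qed

end

section \<open>Closure properties of the computable functions\<close>

context logspace
begin

lemma dc_embed:
  "dc G P \<Longrightarrow> (\<And>g. g \<in> G \<Longrightarrow> g \<circ> \<theta> \<in> G') \<Longrightarrow> dc G' (\<lambda>w e. P w (\<theta> e))"
  unfolding dc_def by (rule fn_embed)

text \<open>Recursion whose accumulator becomes 1 as soon as a witness is met and stays so.\<close>

lemma dc_ex_less:
  assumes K: "fn G K" and P: "dc (ext G) (\<lambda>w p. P w (fst p) (snd p))"
  shows "dc G (\<lambda>w e. \<exists>x<K w e. P w e x)"
proof -
  let ?S = "\<lambda>w e i a. if 0 < (a::nat) \<or> P w e i then 1 else (0::nat)"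
  have "rec_nat 0 (?S w e) k = (if \<exists>x<k. P w e x then 1 else 0)" for w e k
    by (induction k) (auto simp: less_Suc_eq)
  moreover have "fn (ext (ext G)) (\<lambda>w p. ?S w (fst (fst p)) (snd (fst p)) (snd p))"
    using dc_or[OF dc_pos[OF fn_snd] dc_weak[OF P]] by (simp add: dc_def)
  ultimately show ?thesis
    using fn_rec[OF K fn_0, of ?S] by (simp add: dc_def)
qed

lemma dc_all_less:
  assumes K: "fn G K" and P: "dc (ext G) (\<lambda>w p. P w (fst p) (snd p))"
  shows "dc G (\<lambda>w e. \<forall>x<K w e. P w e x)"
  by (rule dc_cong[OF dc_not[OF dc_ex_less[OF K dc_not[OF P]]]]) simp

text \<open>The disjunct \<open>K w e \<le> x\<close> bounds the search and supplies a default value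
  when there is no witness. Round i of the recursion increases the candidate as long as none of 0,
  ..., i is a witness.\<close>

lemma fn_least:
  assumes K: "fn G K" and P: "dc (ext G) (\<lambda>w p. P w (fst p) (snd p))"
  shows "fn G (\<lambda>w e. LEAST x. K w e \<le> x \<or> P w e x)"
proof -
  let ?S = "\<lambda>w e i a. if \<exists>y<min (N w) (Suc i). P w e y then a else min (N w) (Suc a)"
  have le: "(LEAST x. k \<le> x \<or> P w e x) \<le> k" for w e k
    by (rule Least_le) simp
  have rec: "rec_nat 0 (?S w e) k = (LEAST x. k \<le> x \<or> P w e x)" if "k \<le> N w" for w e k
    using that
  proof (induction k)
    case (Suc k)
    then have IH: "rec_nat 0 (?S w e) k = (LEAST x. k \<le> x \<or> P w e x)" by simp
    have "min (N w) (Suc k) = Suc k" using Suc.prems by (rule min_absorb2)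
    then have step: "rec_nat 0 (?S w e) (Suc k) = (if \<exists>y<Suc k. P w e y
        then LEAST x. k \<le> x \<or> P w e x else min (N w) (Suc (LEAST x. k \<le> x \<or> P w e x)))"
      by (simp only: nat.rec IH)
    show ?case
    proof (cases "\<exists>y<Suc k. P w e y")
      case True
      define l where "l = (LEAST x. P w e x)"
      have l: "P w e l" "\<And>x. P w e x \<Longrightarrow> l \<le> x"
        using True LeastI_ex[of "P w e"] unfolding l_def by (auto intro: Least_le)
      have "l \<le> k" using True l(2) by (meson le_trans less_Suc_eq_le)
      have "(LEAST x. c \<le> x \<or> P w e x) = l" if "l \<le> c" for c
        by (rule Least_equality) (use l that in auto)
      from this[of k] this[of "Suc k"] \<open>l \<le> k\<close>
      have "(LEAST x. k \<le> x \<or> P w e x) = (LEAST x. Suc k \<le> x \<or> P w e x)" by simp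
      then show ?thesis unfolding step using True by simp
    next
      case False
      then have "(LEAST x. k \<le> x \<or> P w e x) = k"
        by (intro Least_equality) (auto simp: less_Suc_eq not_less)
      moreover have "(LEAST x. Suc k \<le> x \<or> P w e x) = Suc k"
        using False by (intro Least_equality) (auto simp: not_less)
      ultimately show ?thesis unfolding step using False Suc.prems by (simp only: if_False min_absorb2)
    qed
  qed simp
  have "fn (ext (ext G)) (\<lambda>w p. ?S w (fst (fst p)) (snd (fst p)) (snd p))"
  proof (rule fn_if[OF dc_ex_less fn_snd fn_Suc[OF fn_snd]])
    show "fn (ext (ext G)) (\<lambda>w e. min (N w) (Suc (snd (fst e))))"
      by (rule fn_Suc[OF fn_weak[OF fn_snd]])
    show "dc (ext (ext (ext G))) (\<lambda>w p. P w (fst (fst (fst p))) (snd p))"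
    proof -
      \<comment> \<open>Index and accumulator of the enclosing recursion are dropped from the
        environment; the innermost variable becomes the argument of \<open>P\<close>.\<close>
      let ?\<theta> = "\<lambda>p :: (('b \<times> nat) \<times> nat) \<times> nat. (fst (fst (fst p)), snd p)"
      have "g \<circ> ?\<theta> \<in> ext (ext (ext G))" if g: "g \<in> ext G" for g
      proof (cases "g = snd")
        case True
        then have "g \<circ> ?\<theta> = snd" by (simp add: fun_eq_iff)
        then show ?thesis by (simp add: ext_def)
      next
        case False
        then obtain g' where g': "g' \<in> G" "g = g' \<circ> fst" using g by (auto simp: ext_def)
        then have "g \<circ> ?\<theta> = ((g' \<circ> fst) \<circ> fst) \<circ> fst" by (simp add: fun_eq_iff)
        then show ?thesis using g'(1) unfolding ext_def by blast
      qed
      from dc_embed[OF P this] show ?thesis by simp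
    qed
  qed
  from fn_rec[OF K fn_0 this] show ?thesis
    by (rule fn_cong_bounded) (rule rec[OF fn_le[OF K]])
qed


section \<open>Truncated arithmetic\<close>

lemma fn_monus:
  assumes "fn G A" "fn G B"
  shows "fn G (\<lambda>w e. A w e - B w e)"
proof -
  have rec: "rec_nat a (\<lambda>_ r. r - 1) b = a - b" for a b :: nat
    by (induction b) auto
  have "fn G (\<lambda>w e. rec_nat (A w e) (\<lambda>_ r. r - 1) (B w e))"
    by (rule fn_rec[OF assms(2,1), of "\<lambda>w e i r. r - 1"]) (rule fn_pred[OF fn_snd])
  then show ?thesis by (simp only: rec)
qed

lemma dc_less: "fn G A \<Longrightarrow> fn G B \<Longrightarrow> dc G (\<lambda>w e. A w e < B w e)"
  by (rule dc_cong[OF dc_pos[OF fn_monus]]) auto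

lemma dc_le: "fn G A \<Longrightarrow> fn G B \<Longrightarrow> dc G (\<lambda>w e. A w e \<le> B w e)"
  by (rule dc_cong[OF dc_not[OF dc_less[of G B A]]]) auto

lemma dc_eq: "fn G A \<Longrightarrow> fn G B \<Longrightarrow> dc G (\<lambda>w e. A w e = B w e)"
  by (rule dc_cong[OF dc_and[OF dc_le[of G A B] dc_le[of G B A]]]) auto

lemma fn_add:
  assumes "fn G A" "fn G B"
  shows "fn G (\<lambda>w e. min (N w) (A w e + B w e))"
proof -
  have rec: "rec_nat a (\<lambda>_ r. min (N w) (Suc r)) b = min (N w) (a + b)" if "a \<le> N w" for a b w
    using that by (induction b) auto
  have "fn G (\<lambda>w e. rec_nat (A w e) (\<lambda>_ r. min (N w) (Suc r)) (B w e))"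
    by (rule fn_rec[OF assms(2,1), of "\<lambda>w e i r. min (N w) (Suc r)"]) (rule fn_Suc[OF fn_snd])
  then show ?thesis
    by (rule fn_cong_bounded) (simp add: rec fn_le[OF assms(1)])
qed

lemma fn_mult:
  assumes "fn G A"
  shows "fn G (\<lambda>w e. min (N w) (q * A w e))"
proof (induction q)
  case 0
  then show ?case using fn_0 by simp
next
  case (Suc q)
  have "min (N w) (min (N w) (q * A w e) + A w e) = min (N w) (Suc q * A w e)" for w e
    by (simp add: min_def)
  then show ?case using fn_add[OF Suc assms] by simp
qed

text \<open>The quotient is the least x with \<open>A w e < q * Suc x\<close>. As products are
  truncated at \<open>N w\<close>, this comparison cannot succeed for \<open>A w e = N w\<close>,
  and the search then stops at its bound.\<close>

lemma fn_div:
  assumes "fn G A" "0 < q"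
  shows "fn G (\<lambda>w e. if A w e < N w then A w e div q else A w e)"
proof -
  have "fn G (\<lambda>w e. LEAST x. A w e \<le> x \<or> A w e < min (N w) (q * min (N w) (Suc x)))"
    by (rule fn_least[OF assms(1) dc_less[OF fn_weak[OF assms(1)] fn_mult[OF fn_Suc[OF fn_snd]]]])
  moreover have "(LEAST x. A w e \<le> x \<or> A w e < min (N w) (q * min (N w) (Suc x))) =
      (if A w e < N w then A w e div q else A w e)" for w e
  proof (cases "A w e < N w")
    case True
    have "A w e \<le> x \<or> A w e < min (N w) (q * min (N w) (Suc x)) \<longleftrightarrow> A w e div q \<le> x" for x
    proof -
      have 1: "A w e \<le> y \<Longrightarrow> A w e div q \<le> y" for y by (rule le_trans[OF div_le_dividend])
      have 2: "A w e < q * Suc x \<longleftrightarrow> A w e div q \<le> x"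
        using assms(2) by (metis div_less_iff_less_mult less_Suc_eq_le mult.commute)
      have 3: "A w e < q * N w"
        using True assms(2) by (metis less_le_trans mult_le_mono1 nat_mult_1 Suc_leI One_nat_def)
      show ?thesis using True 1[of x] 2 3 by (auto simp: min_def not_le)
    qed
    then have "(LEAST x. A w e \<le> x \<or> A w e < min (N w) (q * min (N w) (Suc x))) = A w e div q"
      by (simp add: Least_equality)
    then show ?thesis using True by simp
  next
    case False
    then have "A w e \<le> x \<or> A w e < min (N w) (q * min (N w) (Suc x)) \<longleftrightarrow> A w e \<le> x" for x by auto
    then show ?thesis using False by (simp add: Least_equality)
  qed
  ultimately show ?thesis by simp
qed

lemma fn_mod:
  assumes "fn G A" "0 < q"
  shows "fn G (\<lambda>w e. if A w e < N w then A w e mod q else 0)"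
proof -
  have "fn G (\<lambda>w e. if A w e < N w then A w e -
      min (N w) (q * (if A w e < N w then A w e div q else A w e)) else 0)"
    by (rule fn_if[OF dc_less[OF assms(1) fn_N] fn_monus[OF assms(1) fn_mult[OF fn_div[OF assms]]] fn_0])
  moreover have "A w e - min (N w) (q * (A w e div q)) = A w e mod q" if "A w e < N w" for w e
  proof -
    have "q * (A w e div q) \<le> A w e" by simp
    then have "q * (A w e div q) \<le> N w" using that by linarith
    then show ?thesis by (simp add: minus_mult_div_eq_mod min_absorb2)
  qed
  ultimately show ?thesis by (auto elim: fn_cong)
qed

text \<open>Functions given by a finite table are computable, with value 0 outside it. The
  conditions may overlap, because every entry agrees with \<open>H\<close>.\<close>

lemma fn_cases:
  assumes "finite D" "\<And>d. d \<in> D \<Longrightarrow> dc G (P d)" "\<And>d. d \<in> D \<Longrightarrow> fn G (F d)"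
    and "\<And>w e d. d \<in> D \<Longrightarrow> P d w e \<Longrightarrow> H w e = F d w e"
    and "\<And>w e. (\<And>d. d \<in> D \<Longrightarrow> \<not> P d w e) \<Longrightarrow> H w e = 0"
  shows "fn G H"
proof -
  have "fn G (\<lambda>w e. if \<exists>d\<in>D. P d w e then H w e else 0)"
    using assms(1-4)
  proof (induction D rule: finite_induct)
    case empty
    then show ?case using fn_0 by simp
  next
    case (insert d D)
    have "fn G (\<lambda>w e. if P d w e then F d w e else if \<exists>d\<in>D. P d w e then H w e else 0)"
      by (rule fn_if) (use insert in auto)
    then show ?case
    proof (rule fn_cong)
      fix w e show "(if P d w e then F d w e else if \<exists>d\<in>D. P d w e then H w e else 0) =
          (if \<exists>d\<in>insert d D. P d w e then H w e else 0)"
        using insert.prems(3)[of d w e] by auto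
    qed
  qed
  then show ?thesis by (rule fn_cong) (use assms(5) in auto)
qed

end

theorem (in logspace) decidable_predicate:
  assumes "finite \<Sigma>" "L \<subseteq> lists \<Sigma>" and P: "dc ({} :: (unit \<Rightarrow> nat) set) P"
    and "\<And>w. w \<in> lists \<Sigma> \<Longrightarrow> w \<in> L \<longleftrightarrow> P w ()"
  shows "logspace_decidable \<Sigma> L"
proof -
  obtain c where "\<And>w e s. pre ({} :: (unit \<Rightarrow> nat) set) 0 (\<lambda>_. 0) w e s \<Longrightarrow>
      runs w c s (s(0 := if P w e then 1 else 0))"
    by (rule fn_exec[where r = "\<lambda>_. 0" and m = 0, OF P[unfolded dc_def]]) (erule emptyE, rule that)
  note c = this[of _ "()"]
  have run: "(small w ((length w + 2) ^ deg))\<^sup>*\<^sup>* ([Seq c (Cond (Pos 0) Accept Skip)], 0, \<lambda>_. 0)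
      (if w \<in> L then [Accept] else [], 0, (\<lambda>_. 0)(0 := if P w () then 1 else 0))"
    (is "?R\<^sup>*\<^sup>* _ _") if w: "w \<in> lists \<Sigma>" for w
  proof -
    let ?s = "(\<lambda>_. 0)(0 := if P w () then 1 else 0) :: nat \<Rightarrow> nat"
    have 1: "?R ([Seq c (Cond (Pos 0) Accept Skip)], 0, \<lambda>_. 0) ([c, Cond (Pos 0) Accept Skip], 0, \<lambda>_. 0)"
      by (rule small_Seq)
    have 2: "?R\<^sup>*\<^sup>* ([c, Cond (Pos 0) Accept Skip], 0, \<lambda>_. 0) ([Cond (Pos 0) Accept Skip], 0, ?s)"
      using c[of w "\<lambda>_. 0"] by (simp add: pre_def exec_def N_def)
    have 3: "?R ([Cond (Pos 0) Accept Skip], 0, ?s) ([if P w () then Accept else Skip], 0, ?s)"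
      using small_Cond[of w "(length w + 2) ^ deg" "Pos 0" Accept Skip "[]" 0 ?s]
      by (cases "P w ()") simp_all
    have 4: "?R\<^sup>*\<^sup>* ([if P w () then Accept else Skip], 0, ?s) (if P w () then [Accept] else [], 0, ?s)"
      by (cases "P w ()") (auto intro: small_Skip)
    show ?thesis
      using converse_rtranclp_into_rtranclp[of ?R, OF 1 rtranclp_trans[OF 2
          converse_rtranclp_into_rtranclp[of ?R, OF 3 4]]] assms(4)[OF w] by simp
  qed
  show ?thesis
    by (rule logspace_decidable_program[OF assms(1,2), where prog = "Seq c (Cond (Pos 0) Accept Skip)" and c = deg])
       (rule exI, rule exI, erule run)
qed

section \<open>Formulae in prefix notation\<close>

definition sym_at :: "symbol list \<Rightarrow> symbol set \<Rightarrow> nat \<Rightarrow> bool" where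
  "sym_at w S j \<longleftrightarrow> j < length w \<and> w ! j \<in> S"

abbreviation "bits \<equiv> range Bit"

definition no_bit :: "symbol list \<Rightarrow> bool" where
  "no_bit v \<longleftrightarrow> v = [] \<or> hd v \<notin> bits"

lemma no_bit_simps [simp]: "no_bit []" "no_bit (x # v) \<longleftrightarrow> x \<notin> bits"
  by (auto simp: no_bit_def)

lemma no_bit_at: "no_bit v \<Longrightarrow> \<not> sym_at (u @ v) bits (length u)"
  by (cases v) (auto simp: sym_at_def)

section \<open>Open argument slots in prefix notation\<close>

fun ar :: "bool_fun set \<Rightarrow> symbol \<Rightarrow> nat" where
  "ar B (Fun_Sym f) = (if f \<in> B then fst f else 0)"
| "ar B Since_Sym = 2"
| "ar B _ = 0"

text \<open>\<open>a\<close> counts the formulae still to be read. A node symbol starts one of them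
  and asks for as many more as its arity; the bits of a name count for nothing.\<close>

definition upd :: "bool_fun set \<Rightarrow> symbol \<Rightarrow> nat \<Rightarrow> nat" where
  "upd B x a = (if x \<in> bits then a else a + ar B x - 1)"

definition dl :: "bool_fun set \<Rightarrow> nat \<Rightarrow> symbol list \<Rightarrow> nat" where
  "dl B k xs = foldl (\<lambda>a x. upd B x a) k xs"

lemma dl_simps [simp]:
  "dl B k [] = k" "dl B k (x # xs) = dl B (upd B x k) xs" "dl B k (xs @ ys) = dl B (dl B k xs) ys"
  by (simp_all add: dl_def)

lemma dl_bits [simp]: "dl B k (map Bit bs) = k"
  by (induction bs) (auto simp: upd_def)

fun args :: "'v fm \<Rightarrow> 'v fm list" where
  "args (Var x) = []"
| "args (App f \<phi>s) = \<phi>s"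
| "args (Since \<phi> \<psi>) = [\<phi>, \<psi>]"

fun head :: "'v fm \<Rightarrow> symbol" where
  "head (Var x) = Var_Sym"
| "head (App f \<phi>s) = Fun_Sym f"
| "head (Since \<phi> \<psi>) = Since_Sym"

fun var_name :: "name fm \<Rightarrow> name" where
  "var_name (Var x) = x"
| "var_name _ = []"

abbreviation encs :: "name fm list \<Rightarrow> symbol list" where
  "encs \<phi>s \<equiv> concat (map enc_fm \<phi>s)"

lemma enc_fm_split: "enc_fm \<phi> = head \<phi> # map Bit (var_name \<phi>) @ encs (args \<phi>)"
  by (cases \<phi>) auto

lemma head_no_bit: "head \<phi> \<notin> bits"
  by (cases \<phi>) auto

lemma ar_head: "\<phi> \<in> B_formulae B \<Longrightarrow> ar B (head \<phi>) = length (args \<phi>)"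
  by (cases rule: B_formulae.cases) auto

lemma args_B_formulae: "\<phi> \<in> B_formulae B \<Longrightarrow> set (args \<phi>) \<subseteq> B_formulae B"
  by (erule B_formulae.cases) auto

lemma var_name_args: "args \<phi> \<noteq> [] \<Longrightarrow> var_name \<phi> = []"
  by (cases \<phi>) auto

text \<open>All formulae are treated alike, as a head symbol with a list of arguments; this
  induction matches the decomposition in \<open>enc_fm_split\<close>.\<close>

lemma B_formulae_induct [consumes 1]:
  assumes "\<phi> \<in> B_formulae B"
    and "\<And>\<phi>. \<phi> \<in> B_formulae B \<Longrightarrow> (\<And>\<psi>. \<psi> \<in> set (args \<phi>) \<Longrightarrow> P \<psi>) \<Longrightarrow> P \<phi>"
  shows "P \<phi>"
  using assms(1)
proof (induction rule: B_formulae.induct)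
  case (1 x)
  show ?case by (rule assms(2)) (auto intro: B_formulae.intros)
next
  case (2 n f \<phi>s)
  show ?case by (rule assms(2)) (use 2 in \<open>auto intro: B_formulae.intros\<close>)
next
  case (3 \<phi> \<psi>)
  show ?case by (rule assms(2)) (use 3 in \<open>auto intro: B_formulae.intros\<close>)
qed

lemma upd_head: "\<phi> \<in> B_formulae B \<Longrightarrow> upd B (head \<phi>) (Suc k) = length (args \<phi>) + k"
  using head_no_bit[of \<phi>] by (simp add: upd_def ar_head)

lemma dl_encs_aux:
  assumes "\<And>\<phi> k. \<phi> \<in> set \<phi>s \<Longrightarrow> dl B (Suc k) (enc_fm \<phi>) = k"
  shows "dl B (length \<phi>s + k) (encs \<phi>s) = k"
  using assms by (induction \<phi>s) auto

lemma dl_enc_fm: "\<phi> \<in> B_formulae B \<Longrightarrow> dl B (Suc k) (enc_fm \<phi>) = k"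
proof (induction arbitrary: k rule: B_formulae_induct)
  case (1 \<phi>)
  then show ?case
    using dl_encs_aux[of "args \<phi>" B k] by (simp add: enc_fm_split upd_head)
qed

lemma dl_encs: "set \<phi>s \<subseteq> B_formulae B \<Longrightarrow> dl B (length \<phi>s + k) (encs \<phi>s) = k"
  using dl_enc_fm by (intro dl_encs_aux) auto

text \<open>Inside a formula the slots of its later siblings are open in addition; a symbol of a
  later formula is reached after each earlier one has closed its slot.\<close>

lemma dl_inner_aux:
  assumes "\<And>\<phi> k xs y ys. \<phi> \<in> set \<phi>s \<Longrightarrow> enc_fm \<phi> = xs @ y # ys \<Longrightarrow> y \<notin> bits \<Longrightarrow>
      k < dl B (Suc k) xs"
    and "set \<phi>s \<subseteq> B_formulae B" "encs \<phi>s = xs @ y # ys" "y \<notin> bits"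
  shows "k < dl B (length \<phi>s + k) xs"
  using assms
proof (induction \<phi>s arbitrary: xs)
  case (Cons \<phi> \<phi>s)
  have "enc_fm \<phi> @ encs \<phi>s = xs @ y # ys" using Cons.prems by simp
  then consider us where "enc_fm \<phi> = xs @ y # us" | us where "xs = enc_fm \<phi> @ us" "encs \<phi>s = us @ y # ys"
    by (auto simp: append_eq_append_conv2 append_eq_Cons_conv Cons_eq_append_conv)
  then show ?case
  proof cases
    case 1
    then have "length \<phi>s + k < dl B (Suc (length \<phi>s + k)) xs"
      using Cons.prems(1)[of \<phi>] Cons.prems(4) by simp
    then show ?thesis by simp
  next
    case 2
    then have "k < dl B (length \<phi>s + k) us"
    proof (intro Cons.IH)
      show "k < dl B (Suc k) xs" if "\<psi> \<in> set \<phi>s" "enc_fm \<psi> = xs @ y # ys" "y \<notin> bits" for \<psi> k xs y ys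
        by (rule Cons.prems(1)[of \<psi>]) (use that in auto)
    qed (use 2 Cons.prems(2,4) in auto)
    then show ?thesis using 2 Cons.prems(2) by (simp add: dl_enc_fm)
  qed
qed simp

text \<open>A symbol that starts a subformula fills a slot, so a slot of the whole formula is open
  just before it. Bits are excluded: the slot of a variable is closed before its name is
  read.\<close>

lemma dl_inner:
  "\<phi> \<in> B_formulae B \<Longrightarrow> enc_fm \<phi> = xs @ y # ys \<Longrightarrow> y \<notin> bits \<Longrightarrow> k < dl B (Suc k) xs"
proof (induction arbitrary: k xs y ys rule: B_formulae_induct)
  case (1 \<phi>)
  show ?case
  proof (cases xs)
    case (Cons x xs')
    have eq: "x = head \<phi>" "map Bit (var_name \<phi>) @ encs (args \<phi>) = xs' @ y # ys"
      using 1(3) Cons by (auto simp: enc_fm_split)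
    show ?thesis
    proof (cases "args \<phi> = []")
      case True
      then have "y \<in> set (map Bit (var_name \<phi>))" using eq(2) by simp
      then show ?thesis using 1(4) by auto
    next
      case False
      then have h: "encs (args \<phi>) = xs' @ y # ys" using eq(2) var_name_args by simp
      have "k < dl B (length (args \<phi>) + k) xs'"
        by (rule dl_inner_aux[OF 1(2) args_B_formulae[OF 1(1)] h 1(4)])
      then show ?thesis using Cons eq(1) 1(1) by (simp add: upd_head)
    qed
  qed simp
qed

section \<open>Navigation in a formula by positions alone\<close>

definition dep :: "bool_fun set \<Rightarrow> symbol list \<Rightarrow> nat \<Rightarrow> nat" where
  "dep B w j = dl B 1 (take j w)"

definition node_syms :: "bool_fun set \<Rightarrow> symbol set" where
  "node_syms B = {Var_Sym, Since_Sym} \<union> Fun_Sym ` B"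

abbreviation "node_at B w \<equiv> sym_at w (node_syms B)"

text \<open>The end of the subformula at \<open>i\<close>. Bits are skipped so that the name of a
  final variable is included; \<open>length w\<close> is the default.\<close>

definition en :: "bool_fun set \<Rightarrow> symbol list \<Rightarrow> nat \<Rightarrow> nat" where
  "en B w i = (LEAST j. length w \<le> j \<or> i < j \<and> \<not> sym_at w bits j \<and> dep B w j < dep B w i)"

definition has_left :: "bool_fun set \<Rightarrow> symbol list \<Rightarrow> nat \<Rightarrow> bool" where
  "has_left B w i \<longleftrightarrow> sym_at w {x. 0 < ar B x} i"

text \<open>In a formula, an earlier node that ends where \<open>i\<close> ends is an ancestor of
  \<open>i\<close>, and then \<open>i\<close> is the last argument of its parent. The root has no
  earlier node and is excluded separately.\<close>

definition has_right :: "bool_fun set \<Rightarrow> symbol list \<Rightarrow> nat \<Rightarrow> bool" where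
  "has_right B w i \<longleftrightarrow> i \<noteq> 0 \<and> \<not> (\<exists>p<i. node_at B w p \<and> en B w p = en B w i)"

text \<open>In a formula, the earlier nodes that end after \<open>i\<close> are the ancestors of
  \<open>i\<close>, and none of them ends before the parent does.\<close>

definition forest_end :: "bool_fun set \<Rightarrow> symbol list \<Rightarrow> nat \<Rightarrow> nat" where
  "forest_end B w i = (LEAST j. length w \<le> j \<or> i < j \<and> (\<exists>p<i. node_at B w p \<and> en B w p = j))"

definition heavy_left :: "bool_fun set \<Rightarrow> symbol list \<Rightarrow> nat \<Rightarrow> bool" where
  "heavy_left B w i \<longleftrightarrow> forest_end B w i - en B w i \<le> en B w i - Suc i"

text \<open>The parent in the binary tree. If \<open>i\<close> is a later sibling, several nodes may
  end at \<open>i\<close>, namely the previous sibling and its last descendants, but only the former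
  has a right child. Otherwise \<open>i\<close> is a first argument and stands right behind its
  parent.\<close>

definition parent :: "bool_fun set \<Rightarrow> symbol list \<Rightarrow> nat \<Rightarrow> nat" where
  "parent B w i = (if \<exists>j<i. node_at B w j \<and> en B w j = i \<and> has_right B w j
     then LEAST j. length w \<le> j \<or> node_at B w j \<and> en B w j = i \<and> has_right B w j else i - 1)"

lemma head_node: "\<phi> \<in> B_formulae B \<Longrightarrow> head \<phi> \<in> node_syms B"
  by (erule B_formulae.cases) (auto simp: node_syms_def)

lemma node_no_bit: "node_at B w p \<Longrightarrow> \<not> sym_at w bits p"
  by (auto simp: sym_at_def node_syms_def)

lemma dep_append: "dep B (u @ v) (length u + j) = dl B (dep B (u @ v) (length u)) (take j v)"
  by (simp add: dep_def)

lemma dep_end: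
  assumes "w = u @ encs \<phi>s @ v" "set \<phi>s \<subseteq> B_formulae B" "length \<phi>s \<le> dep B w (length u)"
  shows "dep B w (length u + length (encs \<phi>s)) = dep B w (length u) - length \<phi>s"
  using dep_append[of B u "encs \<phi>s @ v" "length (encs \<phi>s)"]
    dl_encs[OF assms(2), of "dep B w (length u) - length \<phi>s"] assms(1,3) by simp

lemma dep_inner:
  assumes "w = u @ enc_fm \<phi> @ v" "\<phi> \<in> B_formulae B" "0 < dep B w (length u)"
    and "length u \<le> j" "j < length u + length (enc_fm \<phi>)" "\<not> sym_at w bits j"
  shows "dep B w (length u) \<le> dep B w j"
proof -
  define d where "d = j - length u"
  have d: "j = length u + d" "d < length (enc_fm \<phi>)" using assms(4,5) by (auto simp: d_def)
  have "enc_fm \<phi> = take d (enc_fm \<phi>) @ enc_fm \<phi> ! d # drop (Suc d) (enc_fm \<phi>)"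
    using d(2) by (simp add: id_take_nth_drop)
  moreover have "enc_fm \<phi> ! d \<notin> bits"
    using assms(1,6) d by (auto simp: sym_at_def nth_append)
  ultimately have "dep B w (length u) - 1 < dl B (Suc (dep B w (length u) - 1)) (take d (enc_fm \<phi>))"
    by (rule dl_inner[OF assms(2)])
  then show ?thesis
    using dep_append[of B u "enc_fm \<phi> @ v" d] assms(1,3) d by simp
qed

text \<open>At the symbols of the formula other than bits the depth never falls below its initial
  value (\<open>dep_inner\<close>), and right behind the formula it is lower by one
  (\<open>dep_end\<close>).\<close>

lemma en_eq:
  assumes "w = u @ enc_fm \<phi> @ v" "\<phi> \<in> B_formulae B" "0 < dep B w (length u)" "no_bit v"
  shows "en B w (length u) = length u + length (enc_fm \<phi>)"
  unfolding en_def
proof (rule Least_equality)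
  let ?e = "length u + length (enc_fm \<phi>)"
  have "dep B w ?e = dep B w (length u) - 1"
    using dep_end[of w u "[\<phi>]" v B] assms by simp
  moreover have "\<not> sym_at w bits ?e"
    using no_bit_at[OF assms(4), of "u @ enc_fm \<phi>"] assms(1) by simp
  moreover have "length u < ?e" by (simp add: enc_fm_split)
  ultimately show "length w \<le> ?e \<or> length u < ?e \<and> \<not> sym_at w bits ?e \<and> dep B w ?e < dep B w (length u)"
    using assms(3) by simp
next
  fix j assume j: "length w \<le> j \<or> length u < j \<and> \<not> sym_at w bits j \<and> dep B w j < dep B w (length u)"
  show "length u + length (enc_fm \<phi>) \<le> j"
  proof (rule ccontr)
    assume *: "\<not> length u + length (enc_fm \<phi>) \<le> j"
    then have "\<not> length w \<le> j" using assms(1) by simp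
    then show False using dep_inner[OF assms(1-3), of j] j * by auto
  qed
qed

text \<open>Subformulae are nested: the depth at \<open>p\<close> is at least the initial one, and
  the position behind the whole formula lies below that.\<close>

lemma en_inner:
  assumes "w = u @ enc_fm \<phi> @ v" "\<phi> \<in> B_formulae B" "0 < dep B w (length u)" "no_bit v"
    and "length u \<le> p" "p < length u + length (enc_fm \<phi>)" "node_at B w p"
  shows "en B w p \<le> length u + length (enc_fm \<phi>)"
  unfolding en_def
proof (rule Least_le)
  let ?e = "length u + length (enc_fm \<phi>)"
  have "dep B w ?e = dep B w (length u) - 1"
    using dep_end[of w u "[\<phi>]" v B] assms by simp
  moreover have "\<not> sym_at w bits ?e"
    using no_bit_at[OF assms(4), of "u @ enc_fm \<phi>"] assms(1) by simp
  moreover have "dep B w (length u) \<le> dep B w p"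
    by (rule dep_inner[OF assms(1-3,5,6) node_no_bit[OF assms(7)]])
  ultimately have "dep B w ?e < dep B w p" using assms(3) by linarith
  moreover note \<open>\<not> sym_at w bits ?e\<close>
  ultimately show "length w \<le> ?e \<or> p < ?e \<and> \<not> sym_at w bits ?e \<and> dep B w ?e < dep B w p"
    using assms(6) by simp
qed

text \<open>
  A forest is read as a binary tree in which the left child of a node is its first argument and the
  right child is its next sibling. A node stores its position and the length of its forest.
\<close>

datatype bt = Leaf | Branch nat nat bt bt

fun pos :: "bt \<Rightarrow> nat" where
  "pos (Branch i s l r) = i"
| "pos Leaf = 0"

fun weight :: "bt \<Rightarrow> nat" where
  "weight (Branch i s l r) = s"
| "weight Leaf = 0"

function tree :: "nat \<Rightarrow> name fm list \<Rightarrow> bt" where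
  "tree i [] = Leaf"
| "tree i (\<phi> # \<phi>s) = Branch i (length (encs (\<phi> # \<phi>s))) (tree (Suc i) (args \<phi>))
     (tree (i + length (enc_fm \<phi>)) \<phi>s)"
  by pat_completeness auto
termination
  by (relation "measure (\<lambda>(i, \<phi>s). length (encs \<phi>s))") (auto simp: enc_fm_split)

text \<open>The forest at position i is maximal: its last formula ends where the parent of i ends.\<close>

definition forest_at :: "bool_fun set \<Rightarrow> symbol list \<Rightarrow> nat \<Rightarrow> name fm list \<Rightarrow> bool" where
  "forest_at B w i \<phi>s \<longleftrightarrow>
     set \<phi>s \<subseteq> B_formulae B \<and> length \<phi>s \<le> dep B w i \<and> (i = 0 \<longrightarrow> length \<phi>s = 1) \<and>
     (\<exists>u v. w = u @ encs \<phi>s @ v \<and> length u = i \<and> no_bit v) \<and>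
     (\<forall>p<i. node_at B w p \<longrightarrow> en B w p \<le> i \<or> i + length (encs \<phi>s) \<le> en B w p) \<and>
     (i \<noteq> 0 \<longrightarrow> (\<exists>p<i. node_at B w p \<and> en B w p = i + length (encs \<phi>s)))"

lemma forest_at_root:
  assumes "\<phi> \<in> B_formulae B" "w = enc_fm \<phi> @ Init_Sym # v"
  shows "forest_at B w 0 [\<phi>]"
  using assms unfolding forest_at_def
  by (auto simp: dep_def intro!: exI[of _ "Init_Sym # v"])

lemma no_bit_encs: "no_bit v \<Longrightarrow> no_bit (encs \<phi>s @ v)"
  by (cases \<phi>s) (auto simp: enc_fm_split head_no_bit)

text \<open>The navigation functions look only at the word. The invariant, with its nesting of
  intervals and the maximality of the forest, makes them agree with the formula, and it is inherited
  by the arguments and by the later siblings.\<close>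

lemma forest_at_facts:
  assumes "forest_at B w i (\<phi> # \<phi>s)"
  shows "en B w i = i + length (enc_fm \<phi>)" (is ?en)
    and "has_left B w i \<longleftrightarrow> args \<phi> \<noteq> []" (is ?left)
    and "has_right B w i \<longleftrightarrow> \<phi>s \<noteq> []" (is ?right)
    and "\<phi>s \<noteq> [] \<Longrightarrow> forest_end B w i = i + length (encs (\<phi> # \<phi>s))"
    and "sym_at w {head \<phi>} i" (is ?head)
    and "args \<phi> \<noteq> [] \<Longrightarrow> forest_at B w (Suc i) (args \<phi>)"
    and "\<phi>s \<noteq> [] \<Longrightarrow> forest_at B w (i + length (enc_fm \<phi>)) \<phi>s"
proof -
  obtain u v where w: "w = u @ encs (\<phi> # \<phi>s) @ v" and u: "length u = i" and v: "no_bit v"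
    using assms by (auto simp: forest_at_def)
  have \<phi>: "\<phi> \<in> B_formulae B" and \<phi>s: "set \<phi>s \<subseteq> B_formulae B" and d: "Suc (length \<phi>s) \<le> dep B w i"
    and i0: "i = 0 \<Longrightarrow> \<phi>s = []"
    using assms by (auto simp: forest_at_def)
  let ?e = "i + length (encs (\<phi> # \<phi>s))" and ?j = "i + length (enc_fm \<phi>)"
  have nest: "\<And>p. p < i \<Longrightarrow> node_at B w p \<Longrightarrow> en B w p \<le> i \<or> ?e \<le> en B w p"
    and par: "i \<noteq> 0 \<Longrightarrow> \<exists>p<i. node_at B w p \<and> en B w p = ?e"
    using assms by (auto simp: forest_at_def)
  have w': "w = u @ enc_fm \<phi> @ (encs \<phi>s @ v)" using w by simp
  have v': "no_bit (encs \<phi>s @ v)" using no_bit_encs[OF v] .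
  have pos: "0 < dep B w (length u)" using d u by simp
  have ij: "i < ?j" by (simp add: enc_fm_split)
  have je: "\<phi>s \<noteq> [] \<Longrightarrow> ?j < ?e" by (cases \<phi>s) (simp_all add: enc_fm_split)
  show en: ?en using en_eq[OF w' \<phi> pos v'] u by simp
  have wi: "w ! i = head \<phi>" "i < length w"
    using u by (simp_all add: w' enc_fm_split nth_append)
  show head: ?head using wi by (simp add: sym_at_def)
  have node: "node_at B w i" using wi head_node[OF \<phi>] by (simp add: sym_at_def)
  show ?left using wi ar_head[OF \<phi>] by (simp add: has_left_def sym_at_def)
  show ?right
  proof (cases "\<phi>s = []")
    case True
    then show ?thesis using par en by (auto simp: has_right_def)
  next
    case False
    then have "i \<noteq> 0" using i0 by blast
    \<comment> \<open>The end of the first formula lies strictly between \<open>i\<close> and the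
      end of the forest, where no earlier node may end.\<close>
    moreover have "en B w p \<noteq> ?j" if "p < i" "node_at B w p" for p
      using nest[OF that] ij je[OF False] by linarith
    ultimately show ?thesis using False en by (auto simp: has_right_def)
  qed
  show "forest_end B w i = ?e" if "\<phi>s \<noteq> []"
    unfolding forest_end_def
  proof (rule Least_equality)
    show "length w \<le> ?e \<or> i < ?e \<and> (\<exists>p<i. node_at B w p \<and> en B w p = ?e)"
      using par i0 that ij je by fastforce
    fix j assume "length w \<le> j \<or> i < j \<and> (\<exists>p<i. node_at B w p \<and> en B w p = j)"
    then show "?e \<le> j"
    proof
      assume "length w \<le> j"
      then show ?thesis using w u by simp
    next
      assume "i < j \<and> (\<exists>p<i. node_at B w p \<and> en B w p = j)"
      then show ?thesis using nest by fastforce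
    qed
  qed
  show "forest_at B w (Suc i) (args \<phi>)" if ne: "args \<phi> \<noteq> []"
  proof -
    have wa: "w = (u @ [head \<phi>]) @ encs (args \<phi>) @ (encs \<phi>s @ v)"
      using w' var_name_args[OF ne] by (simp add: enc_fm_split)
    have len: "Suc i + length (encs (args \<phi>)) = ?j"
      using var_name_args[OF ne] by (simp add: enc_fm_split)
    have "dep B w (Suc i) = upd B (head \<phi>) (dep B w i)"
      using dep_append[of B u "head \<phi> # encs (args \<phi>) @ (encs \<phi>s @ v)" 1] wa u by simp
    also have "\<dots> = length (args \<phi>) + (dep B w i - 1)"
      using upd_head[OF \<phi>, of "dep B w i - 1"] d by simp
    finally have "length (args \<phi>) \<le> dep B w (Suc i)" by simp
    moreover have "en B w p \<le> Suc i \<or> ?j \<le> en B w p" if "p < Suc i" "node_at B w p" for p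
    proof (cases "p = i")
      case False
      then show ?thesis using nest[of p] that by auto
    qed (simp add: en)
    \<comment> \<open>Maximality of the argument forest is witnessed by \<open>i\<close> itself,
      which ends where its last argument ends.\<close>
    ultimately show ?thesis
      unfolding forest_at_def len using args_B_formulae[OF \<phi>] wa v' u node en
      by (intro conjI exI[of _ "u @ [head \<phi>]"] exI[of _ "encs \<phi>s @ v"]) auto
  qed
  show "forest_at B w ?j \<phi>s" if ne: "\<phi>s \<noteq> []"
  proof -
    have "dep B w ?j = dep B w i - 1"
      using dep_end[of w u "[\<phi>]" "encs \<phi>s @ v" B] w' \<phi> pos u by simp
    then have "length \<phi>s \<le> dep B w ?j" using d by simp
    moreover have "en B w p \<le> ?j \<or> ?e \<le> en B w p" if p: "p < ?j" "node_at B w p" for p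
    proof (cases "p < i")
      case True
      then show ?thesis using nest[OF True p(2)] by auto
    next
      case False
      \<comment> \<open>Here \<open>p\<close> lies in the first formula and so ends no later than
        it.\<close>
      then show ?thesis using en_inner[OF w' \<phi> pos v', of p] p u by simp
    qed
    moreover have "?j + length (encs \<phi>s) = ?e" by simp
    moreover have "\<exists>p<?j. node_at B w p \<and> en B w p = ?e"
      using par i0 ne ij by (meson less_trans)
    moreover have "\<exists>u v. w = u @ encs \<phi>s @ v \<and> length u = ?j \<and> no_bit v"
      using w v u by (intro exI[of _ "u @ enc_fm \<phi>"] exI[of _ v]) simp
    ultimately show ?thesis
      unfolding forest_at_def using \<phi>s ij by (simp only:) blast
  qed
qed

text \<open>A smaller candidate would be an earlier node with the same end, which
  \<open>has_right B w i\<close> rules out.\<close>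

lemma parent_right:
  assumes "has_right B w i" "node_at B w i" "i < en B w i"
  shows "parent B w (en B w i) = i"
proof -
  have "(LEAST j. length w \<le> j \<or> node_at B w j \<and> en B w j = en B w i \<and> has_right B w j) = i"
  proof (rule Least_equality)
    fix j assume j: "length w \<le> j \<or> node_at B w j \<and> en B w j = en B w i \<and> has_right B w j"
    show "i \<le> j"
    proof (rule ccontr)
      assume "\<not> i \<le> j"
      then show False using j assms(1,2) by (auto simp: has_right_def sym_at_def)
    qed
  qed (use assms in auto)
  then show ?thesis using assms by (auto simp: parent_def)
qed

text \<open>No node before \<open>Suc i\<close> ends there: earlier ones end by \<open>i\<close> or
  beyond the formula at \<open>i\<close>, and that formula has at least two symbols. So the last
  case of \<open>parent\<close> applies.\<close>

lemma parent_left: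
  assumes "forest_at B w i (\<phi> # \<phi>s)" "args \<phi> \<noteq> []"
  shows "parent B w (Suc i) = i"
proof -
  have "has_right B w j \<Longrightarrow> en B w j \<noteq> Suc i" if "j < Suc i" "node_at B w j" for j
  proof -
    have "length (enc_fm \<phi>) \<ge> 2" using assms(2) by (cases "args \<phi>") (auto simp: enc_fm_split)
    then have "en B w j \<noteq> Suc i"
      using assms(1) forest_at_facts(1)[OF assms(1)] that by (auto simp: forest_at_def less_Suc_eq)
    then show ?thesis by simp
  qed
  then show ?thesis by (auto simp: parent_def)
qed


section \<open>Recognition of well-formed formulae\<close>

fun parses :: "bool_fun set \<Rightarrow> bool \<Rightarrow> nat \<Rightarrow> symbol list \<Rightarrow> bool" where
  "parses B name_allowed k [] \<longleftrightarrow> k = 0"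
| "parses B name_allowed k (Bit b # xs) \<longleftrightarrow> name_allowed \<and> parses B name_allowed k xs"
| "parses B name_allowed k (x # xs) \<longleftrightarrow>
     x \<in> node_syms B \<and> 0 < k \<and> parses B (x = Var_Sym) (k + ar B x - 1) xs"

lemma parses_no_bit:
  "x \<notin> bits \<Longrightarrow> parses B a k (x # xs) \<longleftrightarrow>
     x \<in> node_syms B \<and> 0 < k \<and> parses B (x = Var_Sym) (k + ar B x - 1) xs"
  by (cases x) auto

text \<open>The recogniser remembers only the number of open slots and whether a bit may follow. Its
  run can therefore be replaced by conditions on single positions, which bounded quantifiers can
  check.\<close>

lemma parses_iff:
  "parses B a k xs \<longleftrightarrow> dl B k xs = 0 \<and> (\<forall>j<length xs. if xs ! j \<in> bits
     then (if j = 0 then a else xs ! (j - 1) \<in> insert Var_Sym bits)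
     else xs ! j \<in> node_syms B \<and> 0 < dl B k (take j xs))"
proof (induction xs arbitrary: a k)
  case (Cons x xs)
  let ?Q = "\<lambda>a k xs j. if xs ! j \<in> bits then (if j = 0 then a else xs ! (j - 1) \<in> insert Var_Sym bits)
      else xs ! j \<in> node_syms B \<and> 0 < dl B k (take j xs)"
  let ?a = "x \<in> insert Var_Sym bits"
  have Suc_Q: "?Q a k (x # xs) (Suc j) \<longleftrightarrow> ?Q ?a (upd B x k) xs j" for j
    by (cases j) (simp_all del: insert_iff)
  have "(\<forall>j<length (x # xs). ?Q a k (x # xs) j) \<longleftrightarrow>
      ?Q a k (x # xs) 0 \<and> (\<forall>j<length xs. ?Q ?a (upd B x k) xs j)"
    unfolding list.size add_0_right add_Suc_right All_less_Suc2 Suc_Q by (rule refl)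
  then have rhs: "dl B k (x # xs) = 0 \<and> (\<forall>j<length (x # xs). ?Q a k (x # xs) j) \<longleftrightarrow>
      ?Q a k (x # xs) 0 \<and> parses B ?a (upd B x k) xs"
    unfolding Cons.IH dl_simps by blast
  show ?case
  proof (cases "x \<in> bits")
    case True
    then obtain b where "x = Bit b" by auto
    then show ?thesis unfolding rhs by (cases a) (simp_all add: upd_def)
  next
    case False
    then show ?thesis unfolding rhs by (auto simp: parses_no_bit upd_def)
  qed
qed simp

text \<open>The remaining word is the rest of a name followed by \<open>k\<close> formulae. Prefix
  notation is parsed from right to left: a symbol gathers as many of the formulae behind it as its
  arity demands.\<close>

lemma parses_encs:
  "parses B a k xs \<Longrightarrow> \<exists>bs \<phi>s. xs = map Bit bs @ encs \<phi>s \<and> (\<not> a \<longrightarrow> bs = []) \<and>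
     length \<phi>s = k \<and> set \<phi>s \<subseteq> B_formulae B"
proof (induction xs arbitrary: a k)
  case Nil
  then show ?case by simp
next
  case (Cons x xs)
  show ?case
  proof (cases "x \<in> bits")
    case True
    then obtain b where b: "x = Bit b" by auto
    with Cons obtain bs \<phi>s where "xs = map Bit bs @ encs \<phi>s" "length \<phi>s = k" "set \<phi>s \<subseteq> B_formulae B" "a"
      by force
    then show ?thesis using b by (intro exI[of _ "b # bs"] exI[of _ \<phi>s]) simp
  next
    case False
    then have x: "x \<in> node_syms B" "0 < k" "parses B (x = Var_Sym) (k + ar B x - 1) xs"
      using Cons.prems by (auto simp: parses_no_bit)
    from Cons.IH[OF x(3)] obtain bs \<phi>s where IH: "xs = map Bit bs @ encs \<phi>s"
      "x \<noteq> Var_Sym \<longrightarrow> bs = []" "length \<phi>s = k + ar B x - 1" "set \<phi>s \<subseteq> B_formulae B" by blast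
    consider "x = Var_Sym" | n f where "x = Fun_Sym (n, f)" "(n, f) \<in> B" | "x = Since_Sym"
      using x(1) by (auto simp: node_syms_def)
    then show ?thesis
    proof cases
      case 1
      then show ?thesis using IH x(2)
        by (intro exI[of _ "[]"] exI[of _ "Var bs # \<phi>s"]) (auto intro: B_formulae.intros)
    next
      case 2
      then have l: "n \<le> length \<phi>s" "bs = []" using IH x(2) by auto
      have "App (n, f) (take n \<phi>s) \<in> B_formulae B"
        using 2 l IH(4) by (intro B_formulae.intros) (auto dest: in_set_takeD)
      moreover have "encs \<phi>s = encs (take n \<phi>s) @ encs (drop n \<phi>s)"
        by (metis append_take_drop_id concat_append map_append)
      ultimately show ?thesis using IH x(2) 2 l
        by (intro exI[of _ "[]"] exI[of _ "App (n, f) (take n \<phi>s) # drop n \<phi>s"])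
           (auto dest: in_set_dropD)
    next
      case 3
      then have "Suc k = length \<phi>s" using IH x(2) by simp
      then obtain \<phi> \<psi> \<phi>s' where "\<phi>s = \<phi> # \<psi> # \<phi>s'" "length \<phi>s' = k - 1"
        using x(2) by (cases \<phi>s; cases "tl \<phi>s") auto
      then show ?thesis using IH x(2) 3
        by (intro exI[of _ "[]"] exI[of _ "Since \<phi> \<psi> # \<phi>s'"]) (auto intro: B_formulae.intros)
    qed
  qed
qed

lemma parses_bits: "no_bit xs \<Longrightarrow> parses B a k xs \<Longrightarrow> parses B True k (map Bit bs @ xs)"
proof (induction bs)
  case Nil
  then show ?case by (cases xs) (auto simp: parses_no_bit)
qed simp

lemma parses_any: "no_bit xs \<Longrightarrow> parses B a k xs \<Longrightarrow> parses B a' k xs"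
  by (cases xs) (auto simp: parses_no_bit)

lemma parses_encs_aux:
  assumes "\<And>\<phi> a k xs. \<phi> \<in> set \<phi>s \<Longrightarrow> no_bit xs \<Longrightarrow> parses B False k xs \<Longrightarrow>
      parses B a (Suc k) (enc_fm \<phi> @ xs)"
    and "no_bit xs" "parses B False k xs"
  shows "parses B a (length \<phi>s + k) (encs \<phi>s @ xs)"
  using assms(1)
proof (induction \<phi>s arbitrary: a)
  case Nil
  then show ?case using parses_any[OF assms(2,3)] by simp
next
  case (Cons \<phi> \<phi>s)
  have "parses B False (length \<phi>s + k) (encs \<phi>s @ xs)"
  proof (rule Cons.IH)
    fix \<psi> a k xs assume "\<psi> \<in> set \<phi>s" "no_bit xs" "parses B False k xs"
    then show "parses B a (Suc k) (enc_fm \<psi> @ xs)" by (intro Cons.prems list.set_intros(2))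
  qed
  from Cons.prems[OF list.set_intros(1) no_bit_encs[OF assms(2)] this] show ?case by simp
qed

lemma parses_enc_fm:
  "\<phi> \<in> B_formulae B \<Longrightarrow> no_bit xs \<Longrightarrow> parses B False k xs \<Longrightarrow> parses B a (Suc k) (enc_fm \<phi> @ xs)"
proof (induction arbitrary: a k xs rule: B_formulae_induct)
  case (1 \<phi>)
  have p: "parses B False (length (args \<phi>) + k) (encs (args \<phi>) @ xs)"
  proof (rule parses_encs_aux[OF _ 1(3,4)])
    fix \<psi> a k xs assume "\<psi> \<in> set (args \<phi>)" "no_bit xs" "parses B False k xs"
    then show "parses B a (Suc k) (enc_fm \<psi> @ xs)" by (rule 1(2))
  qed
  have "parses B (head \<phi> = Var_Sym) (length (args \<phi>) + k) (map Bit (var_name \<phi>) @ encs (args \<phi>) @ xs)"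
    by (cases \<phi>) (use p parses_bits[OF no_bit_encs[OF 1(3)] p] in auto)
  then show ?case
    using head_no_bit[of \<phi>] head_node[OF 1(1)] ar_head[OF 1(1)]
    by (simp add: enc_fm_split parses_no_bit add.commute)
qed

text \<open>\<open>Init_Sym\<close> does not occur in a formula, so its first occurrence marks the
  end of the formula.\<close>

definition init_pos :: "symbol list \<Rightarrow> nat" where
  "init_pos w = (LEAST j. length w \<le> j \<or> sym_at w {Init_Sym} j)"

definition wf_formula :: "bool_fun set \<Rightarrow> symbol list \<Rightarrow> bool" where
  "wf_formula B w \<longleftrightarrow> init_pos w < length w \<and> dep B w (init_pos w) = 0 \<and>
     (\<forall>j<init_pos w. if sym_at w bits j then 0 < j \<and> sym_at w (insert Var_Sym bits) (j - 1)
        else node_at B w j \<and> 0 < dep B w j)"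

lemma wf_formula_parses:
  "wf_formula B w \<longleftrightarrow> init_pos w < length w \<and> parses B False 1 (take (init_pos w) w)"
  unfolding wf_formula_def parses_iff
  by (auto simp: sym_at_def dep_def min_def cong: if_cong)

lemma init_pos_sym: "init_pos w < length w \<Longrightarrow> w ! init_pos w = Init_Sym"
  using LeastI[of "\<lambda>j. length w \<le> j \<or> sym_at w {Init_Sym} j" "length w"]
  unfolding init_pos_def[symmetric] by (auto simp: sym_at_def)

lemma set_enc_fm: "\<phi> \<in> B_formulae B \<Longrightarrow> set (enc_fm \<phi>) \<subseteq> bits \<union> node_syms B"
proof (induction rule: B_formulae_induct)
  case (1 \<phi>)
  then have "set (encs (args \<phi>)) \<subseteq> bits \<union> node_syms B" by auto
  then show ?case unfolding enc_fm_split[of \<phi>] using head_node[of \<phi> B] 1 by auto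
qed

lemma init_pos_eq:
  assumes "\<phi> \<in> B_formulae B" "w = enc_fm \<phi> @ Init_Sym # v"
  shows "init_pos w = length (enc_fm \<phi>)"
  unfolding init_pos_def
proof (rule Least_equality)
  fix j assume j: "length w \<le> j \<or> sym_at w {Init_Sym} j"
  show "length (enc_fm \<phi>) \<le> j"
  proof (rule ccontr)
    assume *: "\<not> length (enc_fm \<phi>) \<le> j"
    then have "w ! j \<in> set (enc_fm \<phi>)" using assms(2) by (simp add: nth_append)
    then have "w ! j \<in> bits \<union> node_syms B" using set_enc_fm[OF assms(1)] by blast
    then show False using j * assms(2) by (auto simp: sym_at_def node_syms_def)
  qed
qed (simp add: assms(2) sym_at_def nth_append)

lemma wf_formula_iff:
  "wf_formula B w \<longleftrightarrow> (\<exists>\<phi>\<in>B_formulae B. \<exists>v. w = enc_fm \<phi> @ Init_Sym # v)"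
proof
  assume w: "wf_formula B w"
  then obtain \<phi>s where \<phi>s: "take (init_pos w) w = encs \<phi>s" "length \<phi>s = 1" "set \<phi>s \<subseteq> B_formulae B"
    using parses_encs[of B False 1 "take (init_pos w) w"] unfolding wf_formula_parses by auto
  then obtain \<phi> where \<phi>: "\<phi>s = [\<phi>]" by (cases \<phi>s) auto
  have "w = take (init_pos w) w @ w ! init_pos w # drop (Suc (init_pos w)) w"
    using w by (intro id_take_nth_drop) (simp add: wf_formula_def)
  then show "\<exists>\<phi>\<in>B_formulae B. \<exists>v. w = enc_fm \<phi> @ Init_Sym # v"
    using \<phi>s \<phi> w init_pos_sym[of w] by (auto simp: wf_formula_def)
next
  assume "\<exists>\<phi>\<in>B_formulae B. \<exists>v. w = enc_fm \<phi> @ Init_Sym # v"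
  then obtain \<phi> v where \<phi>: "\<phi> \<in> B_formulae B" "w = enc_fm \<phi> @ Init_Sym # v" by blast
  then show "wf_formula B w"
    using init_pos_eq[OF \<phi>] parses_enc_fm[OF \<phi>(1), of "[]" 0 False] by (simp add: wf_formula_parses)
qed

section \<open>Evaluation of forests in logarithmic space\<close>

lemma halt_reach:
  assumes "(\<lambda>\<sigma> \<sigma>'. b \<sigma> \<and> \<sigma>' = f \<sigma>)\<^sup>*\<^sup>* \<sigma> \<sigma>'" "\<not> b \<sigma>'"
  shows "halt b f \<sigma> = \<sigma>'" "\<exists>t. \<not> b ((f ^^ t) \<sigma>)"
proof -
  have "\<exists>t. (f ^^ t) \<sigma> = \<sigma>' \<and> (\<forall>t'<t. b ((f ^^ t') \<sigma>))"
    using assms(1)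
  proof (induction rule: rtranclp_induct)
    case base
    then show ?case by (intro exI[of _ 0]) simp
  next
    case (step \<tau> \<tau>')
    then obtain t where "(f ^^ t) \<sigma> = \<tau>" "\<forall>t'<t. b ((f ^^ t') \<sigma>)" by blast
    then show ?case using step(2) by (intro exI[of _ "Suc t"]) (auto simp: less_Suc_eq)
  qed
  then obtain t where t: "(f ^^ t) \<sigma> = \<sigma>'" "\<forall>t'<t. b ((f ^^ t') \<sigma>)" by blast
  have "(LEAST t. \<not> b ((f ^^ t) \<sigma>)) = t"
    using t assms(2) by (intro Least_equality) (auto simp: not_le[symmetric])
  then show "halt b f \<sigma> = \<sigma>'" by (simp add: halt_def t)
  show "\<exists>t. \<not> b ((f ^^ t) \<sigma>)" using t assms(2) by (intro exI[of _ t]) simp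
qed

text \<open>
  The evaluation visits the heavier child first, so that only the values of the heavier children
  along the current path have to be remembered. They are the base-q digits of the stack. Mode 0
  means that the subtree at the current position has yet to be evaluated, and mode v + 1 that its
  value is v.
\<close>

locale tree_steps =
  fixes hl hr hv :: "nat \<Rightarrow> bool" and rc pa :: "nat \<Rightarrow> nat" and opr :: "nat \<Rightarrow> nat \<Rightarrow> nat \<Rightarrow> nat"
    and z q cap :: nat
begin

text \<open>Truncated in the forms that \<open>fn_add\<close>, \<open>fn_mult\<close>,
  \<open>fn_div\<close> and \<open>fn_mod\<close> offer; on the stacks of an evaluation this is
  plain base-q arithmetic by \<open>stack_ops\<close>.\<close>

definition push where "push s v = min cap (min cap (q * s) + v)"
definition top where "top s = (if s < cap then s mod q else 0)"
definition pop where "pop s = (if s < cap then s div q else s)"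

text \<open>A right child may also stand at \<open>Suc (pa i)\<close>, namely if the parent has no
  arguments and takes up one symbol; hence the condition on \<open>hl\<close>.\<close>

definition "from_left i \<longleftrightarrow> hl (pa i) \<and> Suc (pa i) = i"

definition next_pos :: "nat \<Rightarrow> nat \<Rightarrow> nat \<Rightarrow> nat" where
  "next_pos i m s =
     (if m = 0 then if hl i \<and> (\<not> hr i \<or> hv i) then Suc i else if hr i then rc i else i
      else if from_left i then if hr (pa i) \<and> hv (pa i) then rc (pa i) else pa i
      else if hl (pa i) \<and> \<not> hv (pa i) then Suc (pa i) else pa i)"

definition next_mode :: "nat \<Rightarrow> nat \<Rightarrow> nat \<Rightarrow> nat" where
  "next_mode i m s =
     (if m = 0 then if hl i \<or> hr i then 0 else Suc (opr i z z)
      else if from_left i then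
        if \<not> hr (pa i) then Suc (opr (pa i) (m - 1) z)
        else if hv (pa i) then 0 else Suc (opr (pa i) (m - 1) (top s))
      else
        if \<not> hl (pa i) then Suc (opr (pa i) z (m - 1))
        else if hv (pa i) then Suc (opr (pa i) (top s) (m - 1)) else 0)"

definition next_stack :: "nat \<Rightarrow> nat \<Rightarrow> nat \<Rightarrow> nat" where
  "next_stack i m s =
     (if m = 0 then s
      else if from_left i then
        if \<not> hr (pa i) then s else if hv (pa i) then push s (m - 1) else pop s
      else
        if \<not> hl (pa i) then s else if hv (pa i) then pop s else push s (m - 1))"

lemmas next_defs = next_pos_def next_mode_def next_stack_def

definition cont :: "nat \<times> nat \<times> nat \<Rightarrow> bool" where
  "cont = (\<lambda>(i, m, s). i \<noteq> 0 \<or> m = 0)"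

definition step :: "nat \<times> nat \<times> nat \<Rightarrow> nat \<times> nat \<times> nat" where
  "step = (\<lambda>(i, m, s). (next_pos i m s, next_mode i m s, next_stack i m s))"

end

locale tree_machine = tree_steps +
  fixes b n :: nat
  assumes q_def: "q = 2 ^ b" and opr_less: "\<And>i x y. opr i x y < q" and z_less: "z < q"
    and cap: "n ^ b \<le> cap"
begin

definition reach :: "nat \<times> nat \<times> nat \<Rightarrow> nat \<times> nat \<times> nat \<Rightarrow> bool" where
  "reach = (\<lambda>\<sigma> \<sigma>'. cont \<sigma> \<and> \<sigma>' = step \<sigma>)\<^sup>*\<^sup>*"

text \<open>The navigation functions agree with the tree, and every node outweighs its two children
  together, so that the lighter child weighs less than half of it.\<close>

primrec good :: "bt \<Rightarrow> bool" where
  "good Leaf = True"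
| "good (Branch i s l r) \<longleftrightarrow> hl i = (l \<noteq> Leaf) \<and> hr i = (r \<noteq> Leaf) \<and>
     (l \<noteq> Leaf \<longrightarrow> pos l = Suc i \<and> pa (Suc i) = i) \<and>
     (r \<noteq> Leaf \<longrightarrow> pos r = rc i \<and> pa (rc i) = i \<and> rc i \<noteq> 0 \<and> (l \<noteq> Leaf \<longrightarrow> rc i \<noteq> Suc i)) \<and>
     (l \<noteq> Leaf \<and> r \<noteq> Leaf \<longrightarrow> hv i = (weight r \<le> weight l)) \<and>
     weight l + weight r < s \<and> good l \<and> good r"

primrec val :: "bt \<Rightarrow> nat" where
  "val Leaf = z"
| "val (Branch i s l r) = opr i (val l) (val r)"

lemma val_less: "val t < q"
  by (cases t) (simp_all add: z_less opr_less)

lemma reach_trans [trans]: "reach \<sigma> \<sigma>' \<Longrightarrow> reach \<sigma>' \<sigma>'' \<Longrightarrow> reach \<sigma> \<sigma>''"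
  unfolding reach_def by (rule rtranclp_trans)

lemma reach_step:
  "i \<noteq> 0 \<or> m = 0 \<Longrightarrow> next_pos i m s = i' \<Longrightarrow> next_mode i m s = m' \<Longrightarrow> next_stack i m s = s' \<Longrightarrow>
    reach (i, m, s) (i', m', s')"
  unfolding reach_def by (rule r_into_rtranclp) (auto simp: cont_def step_def)

text \<open>Since \<open>q ^ Suc k = (2 ^ Suc k) ^ b \<le> n ^ b \<le> cap\<close>, no truncation
  takes place and a push can be undone.\<close>

lemma stack_ops:
  assumes "s < q ^ k" "v < q" "2 ^ Suc k \<le> n"
  shows "push s v < q ^ Suc k" "top (push s v) = v" "pop (push s v) = s"
proof -
  have "(2 ^ Suc k) ^ b \<le> n ^ b" by (rule power_mono[OF assms(3)]) simp
  then have cap': "q ^ Suc k \<le> cap"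
    using cap unfolding q_def by (simp only: power_mult[symmetric] mult.commute[of b])
  have "q * s + v < q * Suc s" using assms(2) by simp
  also have "\<dots> \<le> q ^ Suc k" using mult_le_mono2[of "Suc s" "q ^ k" q] assms(1) by simp
  finally have less: "q * s + v < q ^ Suc k" .
  then have eq: "push s v = q * s + v" using cap' by (simp add: push_def min_def)
  have q: "0 < q" by (simp add: q_def)
  show "push s v < q ^ Suc k" using less eq by simp
  show "top (push s v) = v" "pop (push s v) = s"
    using eq less cap' assms(2) q by (simp_all add: top_def pop_def)
qed

lemma weight_pos: "good t \<Longrightarrow> t \<noteq> Leaf \<Longrightarrow> 0 < weight t"
  by (cases t) auto

text \<open>The lighter child has at most half the weight of the node, which pays for one more digit
  on the stack. The second bound provides the room for that digit.\<close>

lemma light_bound: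
  assumes "2 ^ k * s \<le> n" "x + y < s" "y \<le> x" "0 < y"
  shows "2 ^ Suc k * y \<le> n" "2 ^ Suc k \<le> n"
proof -
  have "2 ^ Suc k * y \<le> 2 ^ k * s" using assms(2,3) by simp
  then show 1: "2 ^ Suc k * y \<le> n" using assms(1) by linarith
  have "2 ^ Suc k * 1 \<le> 2 ^ Suc k * y" using assms(4) by (intro mult_le_mono2) simp
  then show "2 ^ Suc k \<le> n" using 1 by linarith
qed

text \<open>The invariant trades stack digits against weight: the heavier child inherits the stack
  and \<open>k\<close> as they are, the lighter one gets one more digit and half the weight. The
  stack found on entry is restored on return, which makes the induction go through for arbitrary
  \<open>s\<close> and \<open>k\<close>.\<close>

lemma eval_tree:
  "good t \<Longrightarrow> t \<noteq> Leaf \<Longrightarrow> s < q ^ k \<Longrightarrow> 2 ^ k * weight t \<le> n \<Longrightarrow>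
    reach (pos t, 0, s) (pos t, Suc (val t), s)"
proof (induction t arbitrary: k s)
  case (Branch i sz l r)
  have g: "hl i = (l \<noteq> Leaf)" "hr i = (r \<noteq> Leaf)" "good l" "good r" "weight l + weight r < sz"
    "l \<noteq> Leaf \<Longrightarrow> pos l = Suc i" "l \<noteq> Leaf \<Longrightarrow> pa (Suc i) = i"
    "r \<noteq> Leaf \<Longrightarrow> pos r = rc i" "r \<noteq> Leaf \<Longrightarrow> pa (rc i) = i" "r \<noteq> Leaf \<Longrightarrow> rc i \<noteq> 0"
    "l \<noteq> Leaf \<Longrightarrow> r \<noteq> Leaf \<Longrightarrow> rc i \<noteq> Suc i"
    "l \<noteq> Leaf \<Longrightarrow> r \<noteq> Leaf \<Longrightarrow> hv i = (weight r \<le> weight l)"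
    using Branch.prems(1) by auto
  have n: "2 ^ k * sz \<le> n" using Branch.prems(4) by simp
  have kl: "2 ^ k * weight l \<le> n" and kr: "2 ^ k * weight r \<le> n"
    using n g(5) mult_le_mono2[of "weight l" sz "2 ^ k"] mult_le_mono2[of "weight r" sz "2 ^ k"]
    by linarith+
  have fl: "l \<noteq> Leaf \<Longrightarrow> from_left (Suc i)"
    using g by (simp add: from_left_def)
  have fr: "r \<noteq> Leaf \<Longrightarrow> \<not> from_left (rc i)"
    using g by (auto simp: from_left_def)
  have sk: "s < q ^ k" by fact
  consider "l = Leaf" "r = Leaf" | "l \<noteq> Leaf" "r = Leaf" | "l = Leaf" "r \<noteq> Leaf"
    | "l \<noteq> Leaf" "r \<noteq> Leaf" "hv i" | "l \<noteq> Leaf" "r \<noteq> Leaf" "\<not> hv i" by blast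
  then show ?case
  proof cases
    case 1
    have "reach (i, 0, s) (i, Suc (opr i z z), s)"
      by (rule reach_step) (use 1 g in \<open>simp_all add: next_defs\<close>)
    then show ?thesis using 1 by simp
  next
    case 2
    have "reach (i, 0, s) (pos l, 0, s)"
      by (rule reach_step) (use 2 g in \<open>simp_all add: next_defs\<close>)
    also have "reach (pos l, 0, s) (pos l, Suc (val l), s)"
      by (rule Branch.IH(1)[OF g(3) 2(1) sk kl])
    also have "reach (pos l, Suc (val l), s) (i, Suc (opr i (val l) z), s)"
      by (rule reach_step) (use 2 g fl in \<open>simp_all add: next_defs\<close>)
    finally show ?thesis using 2 by simp
  next
    case 3
    have "reach (i, 0, s) (pos r, 0, s)"
      by (rule reach_step) (use 3 g in \<open>simp_all add: next_defs\<close>)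
    also have "reach (pos r, 0, s) (pos r, Suc (val r), s)"
      by (rule Branch.IH(2)[OF g(4) 3(2) sk kr])
    also have "reach (pos r, Suc (val r), s) (i, Suc (opr i z (val r)), s)"
      by (rule reach_step) (use 3 g fr in \<open>simp_all add: next_defs\<close>)
    finally show ?thesis using 3 by simp
  next
    case 4
    note lb = light_bound[OF n g(5) _ weight_pos[OF g(4) 4(2)]]
    have le: "weight r \<le> weight l" using 4 g(12) by blast
    note st = stack_ops[OF sk val_less[of l] lb(2)[OF le]]
    have "reach (i, 0, s) (pos l, 0, s)"
      by (rule reach_step) (use 4 g in \<open>simp_all add: next_defs\<close>)
    also have "reach (pos l, 0, s) (pos l, Suc (val l), s)"
      by (rule Branch.IH(1)[OF g(3) 4(1) sk kl])
    also have "reach (pos l, Suc (val l), s) (pos r, 0, push s (val l))"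
      by (rule reach_step) (use 4 g fl in \<open>simp_all add: next_defs\<close>)
    also have "reach (pos r, 0, push s (val l)) (pos r, Suc (val r), push s (val l))"
      by (rule Branch.IH(2)[OF g(4) 4(2) st(1) lb(1)[OF le]])
    also have "reach (pos r, Suc (val r), push s (val l)) (i, Suc (opr i (val l) (val r)), s)"
      by (rule reach_step) (use 4 g fr st in \<open>simp_all add: next_defs\<close>)
    finally show ?thesis by simp
  next
    case 5
    note lb = light_bound[OF n g(5)[unfolded add.commute[of "weight l"]] _ weight_pos[OF g(3) 5(1)]]
    have le: "weight l \<le> weight r" using 5 g(12) by auto
    note st = stack_ops[OF sk val_less[of r] lb(2)[OF le]]
    have "reach (i, 0, s) (pos r, 0, s)"
      by (rule reach_step) (use 5 g in \<open>simp_all add: next_defs\<close>)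
    also have "reach (pos r, 0, s) (pos r, Suc (val r), s)"
      by (rule Branch.IH(2)[OF g(4) 5(2) sk kr])
    also have "reach (pos r, Suc (val r), s) (pos l, 0, push s (val r))"
      by (rule reach_step) (use 5 g fr in \<open>simp_all add: next_defs\<close>)
    also have "reach (pos l, 0, push s (val r)) (pos l, Suc (val l), push s (val r))"
      by (rule Branch.IH(1)[OF g(3) 5(1) st(1) lb(1)[OF le]])
    also have "reach (pos l, Suc (val l), push s (val r)) (i, Suc (opr i (val l) (val r)), s)"
      by (rule reach_step) (use 5 g fl st in \<open>simp_all add: next_defs\<close>)
    finally show ?thesis by simp
  qed
qed simp

lemma halt_tree:
  assumes "good t" "t \<noteq> Leaf" "pos t = 0" "weight t \<le> n"
  shows "halt cont step (0, 0, 0) = (0, Suc (val t), 0)" "\<exists>k. \<not> cont ((step ^^ k) (0, 0, 0))"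
proof -
  have "reach (0, 0, 0) (0, Suc (val t), 0)"
    using eval_tree[OF assms(1,2), of 0 0] assms(3,4) by simp
  moreover have "\<not> cont (0, Suc (val t), 0)" by (simp add: cont_def)
  ultimately show "halt cont step (0, 0, 0) = (0, Suc (val t), 0)" "\<exists>k. \<not> cont ((step ^^ k) (0, 0, 0))"
    unfolding reach_def by (rule halt_reach)+
qed

end

text \<open>Binary notation below a leading one, which preserves the length of the list. The empty
  list has code 1, and \<open>Suc 0\<close> is therefore the value of an empty forest.\<close>

fun code :: "bool list \<Rightarrow> nat" where
  "code [] = 1"
| "code (c # bs) = 2 * code bs + (if c then 1 else 0)"

fun decode :: "nat \<Rightarrow> bool list" where
  "decode x = (if x \<le> 1 then [] else odd x # decode (x div 2))"

declare decode.simps [simp del]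

lemma code_pos: "0 < code bs"
  by (induction bs) auto

lemma decode_code: "decode (code bs) = bs"
proof (induction bs)
  case (Cons c bs)
  then show ?case using code_pos[of bs] by (subst decode.simps) auto
qed (simp add: decode.simps)

lemma code_less: "code bs < 2 ^ Suc (length bs)"
  by (induction bs) auto

fun sym_val :: "symbol \<Rightarrow> bool \<Rightarrow> bool list \<Rightarrow> bool" where
  "sym_val Var_Sym t bs = t"
| "sym_val Since_Sym t bs = bs ! 1"
| "sym_val (Fun_Sym (k, f)) t bs = f bs"
| "sym_val _ t bs = False"

text \<open>The truth value of the first formula of a forest, computed from its arguments
  \<open>a\<close>, is put in front of those of the later siblings \<open>c\<close>. The test
  against \<open>q\<close> keeps the result bounded for arbitrary operands.\<close>

definition comb :: "nat \<Rightarrow> symbol \<Rightarrow> bool \<Rightarrow> nat \<Rightarrow> nat \<Rightarrow> nat" where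
  "comb q x t a c = (if code (sym_val x t (decode a) # decode c) < q
     then code (sym_val x t (decode a) # decode c) else 0)"

fun bev :: "(name \<Rightarrow> bool) \<Rightarrow> name fm \<Rightarrow> bool" where
  "bev T (Var x) \<longleftrightarrow> T x"
| "bev T (App (k, f) \<phi>s) \<longleftrightarrow> f (map (bev T) \<phi>s)"
| "bev T (Since \<phi> \<psi>) \<longleftrightarrow> bev T \<psi>"

lemma bev_args: "bev T \<phi> = sym_val (head \<phi>) (T (var_name \<phi>)) (map (bev T) (args \<phi>))"
  by (cases \<phi>) auto

text \<open>At position 0 the witness for \<open>Since\<close> can only be 0, and the condition on
  later positions is void. So only the label of the first state matters.\<close>

lemma sat_0: "sat K p 0 \<phi> \<longleftrightarrow> bev (\<lambda>x. x \<in> label K (p 0)) \<phi>"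
proof (induction "(\<lambda>x. x \<in> label K (p 0))" \<phi> rule: bev.induct)
  case (2 k f \<phi>s)
  then have "map (sat K p 0) \<phi>s = map (bev (\<lambda>x. x \<in> label K (p 0))) \<phi>s" by simp
  then show ?case by (simp only: sat.simps bev.simps)
qed auto

definition next_sym :: "symbol list \<Rightarrow> nat \<Rightarrow> nat" where
  "next_sym w i = (LEAST j. length w \<le> j \<or> i < j \<and> \<not> sym_at w bits j)"

definition name_at :: "symbol list \<Rightarrow> nat \<Rightarrow> name" where
  "name_at w i = map (\<lambda>k. sym_at w {Bit True} (Suc i + k)) [0..<next_sym w i - Suc i]"

lemma next_sym_eq:
  assumes "w = u @ x # map Bit bs @ v" "no_bit v"
  shows "next_sym w (length u) = Suc (length u + length bs)"
  unfolding next_sym_def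
proof (rule Least_equality)
  let ?j = "Suc (length u + length bs)"
  show "length w \<le> ?j \<or> length u < ?j \<and> \<not> sym_at w bits ?j"
    using no_bit_at[OF assms(2), of "u @ x # map Bit bs"] assms(1) by simp
  fix j assume j: "length w \<le> j \<or> length u < j \<and> \<not> sym_at w bits j"
  show "?j \<le> j"
  proof (rule ccontr)
    assume *: "\<not> ?j \<le> j"
    then have "j < length w" using assms(1) by simp
    then have "length u < j" using j by linarith
    then obtain d where d: "j = Suc (length u + d)" using less_imp_Suc_add[of "length u" j] by auto
    then have "w ! j = Bit (bs ! d)" using * assms(1) by (simp add: nth_append)
    then show False using j \<open>j < length w\<close> by (auto simp: sym_at_def)
  qed
qed

lemma name_at_eq:
  assumes "w = u @ x # map Bit bs @ v" "no_bit v"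
  shows "name_at w (length u) = bs"
proof -
  have "sym_at w {Bit True} (Suc (length u) + k) \<longleftrightarrow> bs ! k" if "k < length bs" for k
    using that assms(1) by (simp add: sym_at_def nth_append)
  then show ?thesis
    unfolding name_at_def next_sym_eq[OF assms] by (auto intro: nth_equalityI)
qed

lemma tree_Leaf [simp]: "tree i \<phi>s = Leaf \<longleftrightarrow> \<phi>s = []"
  by (cases \<phi>s) auto

lemma pos_tree: "\<phi>s \<noteq> [] \<Longrightarrow> pos (tree i \<phi>s) = i"
  by (cases \<phi>s) auto

lemma weight_tree: "weight (tree i \<phi>s) = length (encs \<phi>s)"
  by (cases \<phi>s) auto

lemma length_enc_fm: "length (enc_fm \<phi>) = Suc (length (var_name \<phi>) + length (encs (args \<phi>)))"
  using arg_cong[OF enc_fm_split[of \<phi>], of length] by simp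

lemma length_encs_pos: "\<phi>s \<noteq> [] \<Longrightarrow> 0 < length (encs \<phi>s)"
  by (cases \<phi>s) (simp_all add: length_enc_fm del: length_greater_0_conv)

lemma length_enc_fm_args: "args \<phi> \<noteq> [] \<Longrightarrow> length (enc_fm \<phi>) = Suc (length (encs (args \<phi>)))"
  by (simp add: length_enc_fm var_name_args)

text \<open>The guards leave finitely many cases with a possibly nonzero value, so that the function
  can be tabulated.\<close>

definition op_at :: "bool_fun set \<Rightarrow> symbol list \<Rightarrow> nat \<Rightarrow> (nat \<Rightarrow> bool) \<Rightarrow> nat \<Rightarrow> nat \<Rightarrow> nat \<Rightarrow> nat" where
  "op_at B w q T i a c =
     (if node_at B w i \<and> a < q \<and> c < q then comb q (w ! i) (T i) a c else 0)"

text \<open>A list of at most \<open>R\<close> truth values has a code below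
  \<open>2 ^ Suc R\<close>; this fixes the base \<open>q\<close> of the stack and with it the
  exponent in the bound on \<open>cap\<close>.\<close>

locale formula_machine =
  fixes B :: "bool_fun set" and w :: "symbol list" and R q cap :: nat and T :: "nat \<Rightarrow> bool"
  assumes q: "q = 2 ^ Suc R" and R: "2 \<le> R" "\<And>f. f \<in> B \<Longrightarrow> fst f \<le> R"
    and cap': "length w ^ Suc R \<le> cap"
begin

lemma op_at_less: "op_at B w q T i a c < q"
proof -
  have "0 < q" by (simp add: q)
  then show ?thesis by (simp add: op_at_def comb_def)
qed

sublocale tree_machine "has_left B w" "has_right B w" "heavy_left B w" "en B w" "parent B w" "op_at B w q T"
  "Suc 0" q cap "Suc R" "length w"
proof
  show "Suc 0 < q" using one_less_power[of "2::nat" "Suc R"] by (simp add: q)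
qed (use cap' q op_at_less in simp_all)

lemma good_tree: "forest_at B w i \<phi>s \<or> \<phi>s = [] \<Longrightarrow> good (tree i \<phi>s)"
proof (induction i \<phi>s rule: tree.induct)
  case (2 i \<phi> \<phi>s)
  then have f: "forest_at B w i (\<phi> # \<phi>s)" by simp
  note facts = forest_at_facts[OF f]
  have lr: "good (tree (Suc i) (args \<phi>))" "good (tree (i + length (enc_fm \<phi>)) \<phi>s)"
    using 2 facts(6,7) by blast+
  have "\<phi> \<in> B_formulae B" using f by (simp add: forest_at_def)
  then have node: "node_at B w i"
    using facts(5) head_node[of \<phi> B] by (auto simp: sym_at_def)
  have hv: "heavy_left B w i \<longleftrightarrow> length (encs \<phi>s) \<le> length (encs (args \<phi>))"
    if "args \<phi> \<noteq> []" "\<phi>s \<noteq> []"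
    using facts(1) facts(4)[OF that(2)] length_enc_fm_args[OF that(1)] by (simp add: heavy_left_def)
  have pr: "parent B w (en B w i) = i" if "\<phi>s \<noteq> []"
    by (rule parent_right) (use that facts(1,3) node in \<open>simp_all add: length_enc_fm\<close>)
  have "en B w i \<noteq> 0" "args \<phi> \<noteq> [] \<longrightarrow> en B w i \<noteq> Suc i"
    using facts(1) length_encs_pos[of "args \<phi>"] by (simp_all add: length_enc_fm)
  then show ?case
    using lr facts(1-3) hv pr parent_left[OF f]
    by (simp add: pos_tree weight_tree length_enc_fm)
qed simp

text \<open>Induction along the construction of the tree. The bound on the number of formulae keeps
  all codes below \<open>q\<close>, so the guards of \<open>op_at\<close> and \<open>comb\<close>
  are passed.\<close>

lemma val_tree:
  assumes names: "\<And>i. T i \<longleftrightarrow> T' (name_at w i)"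
  shows "forest_at B w i \<phi>s \<or> \<phi>s = [] \<Longrightarrow> length \<phi>s \<le> R \<Longrightarrow>
    val (tree i \<phi>s) = code (map (bev T') \<phi>s)"
proof (induction i \<phi>s rule: tree.induct)
  case (2 i \<phi> \<phi>s)
  then have f: "forest_at B w i (\<phi> # \<phi>s)" by simp
  note facts = forest_at_facts[OF f]
  have \<phi>: "\<phi> \<in> B_formulae B" using f by (simp add: forest_at_def)
  have "length (args \<phi>) \<le> R"
    using \<phi> by cases (use R in auto)
  then have l: "val (tree (Suc i) (args \<phi>)) = code (map (bev T') (args \<phi>))"
    using 2 facts(6) by blast
  have r: "val (tree (i + length (enc_fm \<phi>)) \<phi>s) = code (map (bev T') \<phi>s)"
    using 2 facts(7) by auto
  have node: "node_at B w i" and wi: "w ! i = head \<phi>"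
    using facts(5) head_node[OF \<phi>] by (auto simp: sym_at_def)
  have "T' (name_at w i) \<longleftrightarrow> T' (var_name \<phi>)" if x: "\<phi> = Var x" for x
  proof -
    obtain u v where w: "w = u @ encs (\<phi> # \<phi>s) @ v" and u: "length u = i" and v: "no_bit v"
      using f by (auto simp: forest_at_def)
    have "w = u @ Var_Sym # map Bit x @ (encs \<phi>s @ v)" using w x by simp
    from name_at_eq[OF this no_bit_encs[OF v]] show ?thesis using u x by simp
  qed
  then have sv: "sym_val (head \<phi>) (T i) (map (bev T') (args \<phi>)) = bev T' \<phi>"
    unfolding bev_args[of T' \<phi>] names by (cases \<phi>) auto
  have "code (map (bev T') (\<phi> # \<phi>s)) < q"
    using code_less[of "map (bev T') (\<phi> # \<phi>s)"] 2(4) power_increasing[of "Suc (length (\<phi> # \<phi>s))" "Suc R" "2::nat"]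
    by (simp add: q)
  moreover have "code (map (bev T') (args \<phi>)) < q" "code (map (bev T') \<phi>s) < q"
    unfolding l[symmetric] r[symmetric] by (rule val_less)+
  ultimately have "op_at B w q T i (code (map (bev T') (args \<phi>))) (code (map (bev T') \<phi>s)) =
      code (map (bev T') (\<phi> # \<phi>s))"
    using node by (simp add: op_at_def comb_def wi decode_code sv)
  then show ?case using l r by simp
qed simp

lemma formula_machine:
  assumes "\<phi> \<in> B_formulae B" "w = enc_fm \<phi> @ Init_Sym # v" "\<And>i. T i \<longleftrightarrow> T' (name_at w i)"
  shows "halt cont step (0, 0, 0) = (0, Suc (code [bev T' \<phi>]), 0)"
    and "\<exists>k. \<not> cont ((step ^^ k) (0, 0, 0))"
proof -
  have f: "forest_at B w 0 [\<phi>]" by (rule forest_at_root[OF assms(1,2)])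
  have "good (tree 0 [\<phi>])" using good_tree f by blast
  moreover have "val (tree 0 [\<phi>]) = code [bev T' \<phi>]"
    using val_tree[OF assms(3), of 0 "[\<phi>]"] f R by simp
  moreover have "weight (tree 0 [\<phi>]) \<le> length w" by (simp add: assms(2))
  ultimately show "halt cont step (0, 0, 0) = (0, Suc (code [bev T' \<phi>]), 0)"
    and "\<exists>k. \<not> cont ((step ^^ k) (0, 0, 0))"
    using halt_tree[of "tree 0 [\<phi>]"] by (simp_all del: code.simps)
qed

end

section \<open>Encodings of Kripke structures\<close>

fun nm :: "symbol list \<Rightarrow> name" where
  "nm (Bit b # xs) = b # nm xs"
| "nm _ = []"

fun rst :: "symbol list \<Rightarrow> symbol list" where
  "rst (Bit b # xs) = rst xs"
| "rst xs = xs"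

lemma nm_rst: "map Bit (nm xs) @ rst xs = xs"
  by (induction xs rule: nm.induct) auto

lemma no_bit_rst: "no_bit (rst xs)"
  by (induction xs rule: rst.induct) auto

lemma nm_bits [simp]: "no_bit v \<Longrightarrow> nm (map Bit bs @ v) = bs"
  by (induction bs) (cases v rule: nm.cases; auto)+

lemma rst_bits [simp]: "no_bit v \<Longrightarrow> rst (map Bit bs @ v) = v"
  by (induction bs) (cases v rule: nm.cases; auto)+

text \<open>Defined for arbitrary words, by the name behind \<open>\<sigma>\<close> and the name
  behind the next symbol. For worlds only the first component is of interest.\<close>

fun pairs :: "symbol \<Rightarrow> symbol list \<Rightarrow> (name \<times> name) set" where
  "pairs \<sigma> [] = {}"
| "pairs \<sigma> (x # xs) = (if x = \<sigma> then {(nm xs, nm (tl (rst xs)))} else {}) \<union> pairs \<sigma> xs"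

lemma drop_at:
  assumes "i < length w"
  shows "name_at w i = nm (drop (Suc i) w)" "drop (next_sym w i) w = rst (drop (Suc i) w)"
    "next_sym w i \<le> length w"
proof -
  define v where "v = drop (Suc i) w"
  have w: "w = take i w @ w ! i # map Bit (nm v) @ rst v"
    unfolding nm_rst v_def by (rule id_take_nth_drop[OF assms])
  have i: "length (take i w) = i" using assms by simp
  show "name_at w i = nm (drop (Suc i) w)"
    using name_at_eq[OF w no_bit_rst] unfolding i v_def .
  have n: "next_sym w i = Suc (i + length (nm v))"
    using next_sym_eq[OF w no_bit_rst] unfolding i .
  have "drop (next_sym w i) w = drop (length (nm v)) v"
    unfolding n v_def by (simp add: add.commute)
  also have "v = map Bit (nm v) @ rst v" by (rule nm_rst[symmetric])
  then have "drop (length (nm v)) v = rst v"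
    by (metis append_eq_conv_conj length_map)
  finally show "drop (next_sym w i) w = rst (drop (Suc i) w)" by (simp add: v_def)
  show "next_sym w i \<le> length w"
    unfolding next_sym_def by (rule Least_le) simp
qed

lemma name_at_end: "length w \<le> i \<Longrightarrow> name_at w i = []"
proof -
  assume "length w \<le> i"
  moreover have "next_sym w i \<le> length w" unfolding next_sym_def by (rule Least_le) simp
  ultimately show ?thesis by (simp add: name_at_def)
qed

lemma name_at_next:
  assumes "i < length w"
  shows "name_at w (next_sym w i) = nm (tl (rst (drop (Suc i) w)))"
proof (cases "next_sym w i < length w")
  case True
  then show ?thesis
    unfolding drop_at(2)[OF assms, symmetric] drop_at(1)[OF True] by (simp add: drop_Suc tl_drop)
next
  case False
  then show ?thesis using name_at_end[of w "next_sym w i"] drop_at(2)[OF assms] by simp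
qed

lemma pairs_drop:
  "pairs \<sigma> w = (\<lambda>i. (nm (drop (Suc i) w), nm (tl (rst (drop (Suc i) w))))) ` {i. sym_at w {\<sigma>} i}"
proof (induction w)
  case (Cons x w)
  have "{i. sym_at (x # w) {\<sigma>} i} = (if x = \<sigma> then {0} else {}) \<union> Suc ` {i. sym_at w {\<sigma>} i}"
  proof (rule set_eqI)
    fix i show "i \<in> {i. sym_at (x # w) {\<sigma>} i} \<longleftrightarrow>
        i \<in> (if x = \<sigma> then {0} else {}) \<union> Suc ` {i. sym_at w {\<sigma>} i}"
      by (cases i) (auto simp: sym_at_def)
  qed
  then show ?case by (simp add: Cons image_Un image_image)
qed (simp add: sym_at_def)

text \<open>Membership in a listed set becomes a search for a position, which counters can carry
  out.\<close>

lemma pairs_positions: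
  "pairs \<sigma> w = (\<lambda>i. (name_at w i, name_at w (next_sym w i))) ` {i. sym_at w {\<sigma>} i}"
  unfolding pairs_drop by (rule image_cong) (auto simp: sym_at_def drop_at name_at_next)

lemma pairs_append: "\<sigma> \<notin> set u \<Longrightarrow> pairs \<sigma> (u @ v) = pairs \<sigma> v"
  by (induction u) auto

abbreviation "worlds_word ws \<equiv> concat (map (\<lambda>s. World_Sym # enc_name s) ws)"
abbreviation "pairs_word m ps \<equiv> concat (map (enc_pair m) ps)"

lemma no_bit_worlds: "no_bit v \<Longrightarrow> no_bit (worlds_word ws @ v)"
  by (cases ws) auto

lemma no_bit_pairs: "m \<notin> bits \<Longrightarrow> no_bit v \<Longrightarrow> no_bit (pairs_word m ps @ v)"
  by (cases ps) (auto simp: enc_pair_def)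

lemma pairs_worlds:
  "no_bit v \<Longrightarrow> fst ` pairs World_Sym (worlds_word ws @ v) = set ws \<union> fst ` pairs World_Sym v"
proof (induction ws)
  case (Cons s ws)
  have nb: "no_bit (worlds_word ws @ v)" using no_bit_worlds[OF Cons.prems] .
  have "pairs World_Sym (map Bit s @ worlds_word ws @ v) = pairs World_Sym (worlds_word ws @ v)"
    by (rule pairs_append) auto
  then show ?case using Cons nb by auto
qed simp

lemma pairs_pairs:
  assumes "m \<notin> bits" "m \<noteq> Sep" "no_bit v"
  shows "pairs m (pairs_word m ps @ v) = set ps \<union> pairs m v"
proof (induction ps)
  case (Cons p ps)
  obtain x y where p: "p = (x, y)" by (cases p)
  let ?v = "pairs_word m ps @ v"
  have nb: "no_bit ?v" using no_bit_pairs[OF assms(1,3)] .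
  have "pairs m (map Bit x @ Sep # map Bit y @ ?v) = pairs m ?v"
    using pairs_append[of m "map Bit x @ Sep # map Bit y" ?v] assms by auto
  moreover have "nm (map Bit x @ Sep # map Bit y @ ?v) = x"
    by (rule nm_bits) auto
  moreover have "nm (tl (rst (map Bit x @ Sep # map Bit y @ ?v))) = y"
    using nb by (subst rst_bits) auto
  moreover have "pairs_word m (p # ps) @ v = m # map Bit x @ Sep # map Bit y @ ?v"
    by (simp add: p enc_pair_def)
  ultimately show ?case using Cons by (simp add: p)
qed simp

text \<open>
  State 0 skips the formula and state 1 reads the initial state and the worlds; 2 and 3 read the
  two components of an edge, 4 and 5 those of a label; 6 rejects.
\<close>

fun dfa :: "nat \<Rightarrow> symbol \<Rightarrow> nat" where
  "dfa s (Bit b) = s"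
| "dfa s Init_Sym = (if s = 0 then 1 else 6)"
| "dfa s World_Sym = (if s = 0 then 0 else if s = 1 then 1 else 6)"
| "dfa s Edge_Sym = (if s = 0 then 0 else if s = 1 \<or> s = 3 then 2 else 6)"
| "dfa s Label_Sym = (if s = 0 then 0 else if s = 1 \<or> s = 3 \<or> s = 5 then 4 else 6)"
| "dfa s Sep = (if s = 0 then 0 else if s = 2 then 3 else if s = 4 then 5 else 6)"
| "dfa s _ = (if s = 0 then 0 else 6)"

lemma dfa_le: "s \<le> 6 \<Longrightarrow> dfa s x \<le> 6"
  by (cases "(s, x)" rule: dfa.cases) auto

lemma dfa_dead: "foldl dfa 6 xs = 6"
proof (induction xs)
  case (Cons x xs)
  have "dfa 6 x = 6" by (cases "(6::nat, x)" rule: dfa.cases) auto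
  then show ?case using Cons by simp
qed simp

lemma dfa_0: "Init_Sym \<notin> set xs \<Longrightarrow> foldl dfa 0 xs = 0"
proof (induction xs)
  case (Cons x xs)
  have "dfa 0 x = 0" using Cons.prems by (cases "(0::nat, x)" rule: dfa.cases) auto
  then show ?case using Cons by simp
qed simp

lemma dfa_bits [simp]: "foldl dfa s (map Bit bs) = s"
  by (induction bs) auto

text \<open>The shape of the words that lead from each state to acceptance; the bits in front
  complete a name that has already been begun.\<close>

inductive dfa_words :: "nat \<Rightarrow> symbol list \<Rightarrow> bool" where
  "dfa_words 1 (map Bit bs @ worlds_word ws @ pairs_word Edge_Sym es @ pairs_word Label_Sym ls)"
| "dfa_words 2 (map Bit bs @ Sep # map Bit cs @ pairs_word Edge_Sym es @ pairs_word Label_Sym ls)"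
| "dfa_words 3 (map Bit bs @ pairs_word Edge_Sym es @ pairs_word Label_Sym ls)"
| "dfa_words 4 (map Bit bs @ Sep # map Bit cs @ pairs_word Label_Sym ls)"
| "dfa_words 5 (map Bit bs @ pairs_word Label_Sym ls)"

lemma dfa_words_dead: "\<not> dfa_words 6 xs"
  by (auto elim: dfa_words.cases)

lemma dfa_words_cases:
  "dfa_words 1 xs \<Longrightarrow> \<exists>bs ws es ls. xs = map Bit bs @ worlds_word ws @ pairs_word Edge_Sym es @ pairs_word Label_Sym ls"
  "dfa_words 2 xs \<Longrightarrow> \<exists>bs cs es ls. xs = map Bit bs @ Sep # map Bit cs @ pairs_word Edge_Sym es @ pairs_word Label_Sym ls"
  "dfa_words 3 xs \<Longrightarrow> \<exists>bs es ls. xs = map Bit bs @ pairs_word Edge_Sym es @ pairs_word Label_Sym ls"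
  "dfa_words 4 xs \<Longrightarrow> \<exists>bs cs ls. xs = map Bit bs @ Sep # map Bit cs @ pairs_word Label_Sym ls"
  "dfa_words 5 xs \<Longrightarrow> \<exists>bs ls. xs = map Bit bs @ pairs_word Label_Sym ls"
  by (erule dfa_words.cases; (simp; fail)?; blast)+

lemma dfa_words_Bit: "dfa_words s xs \<Longrightarrow> dfa_words s (Bit b # xs)"
  by (induction rule: dfa_words.induct) (use dfa_words.intros[of "b # bs" for bs] in simp_all)

lemma dfa_words_step:
  assumes "dfa_words (dfa s x) xs" "s \<in> {1..5}"
  shows "dfa_words s (x # xs)"
proof (cases x)
  case (Bit b)
  then show ?thesis using assms dfa_words_Bit by simp
next
  case World_Sym
  then have s: "s = 1" "dfa_words 1 xs" using assms by (auto simp: dfa_words_dead split: if_splits)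
  then obtain bs ws es ls where
    "xs = map Bit bs @ worlds_word ws @ pairs_word Edge_Sym es @ pairs_word Label_Sym ls"
    using dfa_words_cases(1) by blast
  then show ?thesis using dfa_words.intros(1)[of "[]" "bs # ws" es ls] s World_Sym by simp
next
  case Edge_Sym
  then have s: "s = 1 \<or> s = 3" "dfa_words 2 xs"
    using assms by (auto simp: dfa_words_dead split: if_splits)
  then obtain bs cs es ls where
    "xs = map Bit bs @ Sep # map Bit cs @ pairs_word Edge_Sym es @ pairs_word Label_Sym ls"
    using dfa_words_cases(2) by blast
  then show ?thesis
    using dfa_words.intros(1)[of "[]" "[]" "(bs, cs) # es" ls] dfa_words.intros(3)[of "[]" "(bs, cs) # es" ls]
      s Edge_Sym by (auto simp: enc_pair_def)
next
  case Label_Sym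
  then have s: "s = 1 \<or> s = 3 \<or> s = 5" "dfa_words 4 xs"
    using assms by (auto simp: dfa_words_dead split: if_splits)
  then obtain bs cs ls where "xs = map Bit bs @ Sep # map Bit cs @ pairs_word Label_Sym ls"
    using dfa_words_cases(4) by blast
  then show ?thesis
    using dfa_words.intros(1)[of "[]" "[]" "[]" "(bs, cs) # ls"] dfa_words.intros(3)[of "[]" "[]" "(bs, cs) # ls"]
      dfa_words.intros(5)[of "[]" "(bs, cs) # ls"] s Label_Sym by (auto simp: enc_pair_def)
next
  case Sep
  then have "s = 2 \<and> dfa_words 3 xs \<or> s = 4 \<and> dfa_words 5 xs"
    using assms by (auto simp: dfa_words_dead split: if_splits)
  then show ?thesis
  proof
    assume s: "s = 2 \<and> dfa_words 3 xs"
    then obtain bs es ls where "xs = map Bit bs @ pairs_word Edge_Sym es @ pairs_word Label_Sym ls"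
      using dfa_words_cases(3) by blast
    then show ?thesis using dfa_words.intros(2)[of "[]" bs es ls] s Sep by simp
  next
    assume s: "s = 4 \<and> dfa_words 5 xs"
    then obtain bs ls where "xs = map Bit bs @ pairs_word Label_Sym ls"
      using dfa_words_cases(5) by blast
    then show ?thesis using dfa_words.intros(4)[of "[]" bs ls] s Sep by simp
  qed
qed (use assms in \<open>auto simp: dfa_words_dead split: if_splits\<close>)

lemma dfa_range: "s \<in> {1..5} \<Longrightarrow> dfa s x \<in> {1..6}"
  by (cases "(s, x)" rule: dfa.cases) auto

lemma dfa_sound: "foldl dfa s xs \<in> {1, 3, 5} \<Longrightarrow> s \<in> {1..5} \<Longrightarrow> dfa_words s xs"
proof (induction xs arbitrary: s)
  case Nil
  then show ?case
    using dfa_words.intros(1)[of "[]" "[]" "[]" "[]"] dfa_words.intros(3)[of "[]" "[]" "[]"]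
      dfa_words.intros(5)[of "[]" "[]"] by auto
next
  case (Cons x xs)
  then have "dfa s x \<noteq> 6" using dfa_dead[of xs] by auto
  then have "dfa s x \<in> {1..5}" using dfa_range[OF Cons.prems(2), of x] by auto
  then show ?case using Cons dfa_words_step by simp
qed

lemma dfa_worlds: "foldl dfa 1 (worlds_word ws) = 1"
  by (induction ws) auto

lemma dfa_edges: "s \<in> {1, 3} \<Longrightarrow> foldl dfa s (pairs_word Edge_Sym es) \<in> {1, 3}"
proof (induction es arbitrary: s)
  case (Cons p es)
  have "foldl dfa s (enc_pair Edge_Sym p) = 3"
    using Cons.prems by (cases p) (auto simp: enc_pair_def)
  then show ?case using Cons.IH[of 3] by simp
qed simp

lemma dfa_labels: "s \<in> {1, 3, 5} \<Longrightarrow> foldl dfa s (pairs_word Label_Sym ls) \<in> {1, 3, 5}"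
proof (induction ls arbitrary: s)
  case (Cons p ls)
  have "foldl dfa s (enc_pair Label_Sym p) = 5"
    using Cons.prems by (cases p) (auto simp: enc_pair_def)
  then show ?case using Cons.IH[of 5] by simp
qed simp

lemma dfa_iff:
  "foldl dfa 1 v \<in> {1, 3, 5} \<longleftrightarrow> (\<exists>a ws es ls.
     v = map Bit a @ worlds_word ws @ pairs_word Edge_Sym es @ pairs_word Label_Sym ls)"
  (is "?l \<longleftrightarrow> ?r")
proof
  assume ?l
  then have "dfa_words 1 v" by (rule dfa_sound) simp
  then show ?r by (rule dfa_words_cases(1))
next
  assume ?r
  then obtain a ws es ls where
    v: "v = map Bit a @ worlds_word ws @ pairs_word Edge_Sym es @ pairs_word Label_Sym ls" by blast
  have "foldl dfa 1 v = foldl dfa (foldl dfa 1 (pairs_word Edge_Sym es)) (pairs_word Label_Sym ls)"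
    unfolding v foldl_append dfa_bits dfa_worlds ..
  moreover have "foldl dfa 1 (pairs_word Edge_Sym es) \<in> {1, 3}" by (rule dfa_edges) simp
  then have "foldl dfa (foldl dfa 1 (pairs_word Edge_Sym es)) (pairs_word Label_Sym ls) \<in> {1, 3, 5}"
    by (intro dfa_labels) auto
  ultimately show ?l by (simp only:)
qed

section \<open>Instances described by words\<close>

definition accepted :: "name \<Rightarrow> symbol list \<Rightarrow> bool" where
  "accepted a w \<longleftrightarrow> foldl dfa 0 w \<in> {1, 3, 5} \<and> a \<in> fst ` pairs World_Sym w \<and>
     (\<forall>(x, y)\<in>pairs Edge_Sym w. x \<in> fst ` pairs World_Sym w \<and> y \<in> fst ` pairs World_Sym w) \<and>
     (\<forall>x\<in>fst ` pairs World_Sym w. \<exists>y. (x, y) \<in> pairs Edge_Sym w) \<and>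
     (\<forall>(s, x)\<in>pairs Label_Sym w. s \<in> fst ` pairs World_Sym w)"

lemma sets_of_word:
  assumes "\<phi> \<in> B_formulae B"
    and w: "w = enc_fm \<phi> @ Init_Sym # map Bit a @
      worlds_word ws @ pairs_word Edge_Sym es @ pairs_word Label_Sym ls"
  shows "fst ` pairs World_Sym w = set ws" "pairs Edge_Sym w = set es" "pairs Label_Sym w = set ls"
proof -
  have e: "\<sigma> \<notin> set (enc_fm \<phi> @ Init_Sym # map Bit a)" if "\<sigma> \<in> {World_Sym, Edge_Sym, Label_Sym}" for \<sigma>
    using set_enc_fm[OF assms(1)] that by (auto simp: node_syms_def)
  have p: "m' \<notin> set (pairs_word m ps)" if "m' \<notin> insert Sep bits" "m' \<noteq> m" for m m' ps
    using that by (auto simp: enc_pair_def)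
  have wo: "m \<notin> set (worlds_word ws)" if "m \<in> {Edge_Sym, Label_Sym}" for m
    using that by auto
  let ?E = "pairs_word Edge_Sym es" and ?L = "pairs_word Label_Sym ls"
  have nl: "no_bit ?L" using no_bit_pairs[of Label_Sym "[]" ls] by auto
  have ne: "no_bit (?E @ ?L)" by (rule no_bit_pairs[OF _ nl]) auto
  have w': "w = (enc_fm \<phi> @ Init_Sym # map Bit a) @ worlds_word ws @ ?E @ ?L" using w by simp
  have "pairs World_Sym (?E @ ?L) = {}"
    using pairs_append[of World_Sym "?E @ ?L" "[]"] p by auto
  then show "fst ` pairs World_Sym w = set ws"
    unfolding w' using pairs_append[OF e[of World_Sym]] pairs_worlds[OF ne, of ws] by simp
  have "pairs Edge_Sym ?L = {}" using pairs_append[of Edge_Sym ?L "[]"] p by auto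
  then show "pairs Edge_Sym w = set es"
    unfolding w' using pairs_append[OF e[of Edge_Sym]] pairs_append[OF wo[of Edge_Sym]]
      pairs_pairs[OF _ _ nl, of Edge_Sym es] by auto
  have "pairs Label_Sym ?L = set ls"
    using pairs_pairs[of Label_Sym "[]" ls] by auto
  moreover have lb: "Label_Sym \<notin> set ?E" by (rule p) auto
  ultimately show "pairs Label_Sym w = set ls"
    unfolding w' using pairs_append[OF e[of Label_Sym]] pairs_append[OF wo[of Label_Sym]]
      pairs_append[OF lb] by auto
qed

text \<open>By totality a successor can be chosen for every state; the path iterates this
  choice.\<close>

lemma path_exists:
  assumes "kripke_structure K" "a \<in> worlds K"
  shows "\<exists>p. is_path K p \<and> p 0 = a"
proof -
  define f where "f s = (SOME t. (s, t) \<in> rel K)" for s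
  have f: "(s, f s) \<in> rel K \<and> f s \<in> worlds K" if "s \<in> worlds K" for s
  proof -
    have "\<exists>t. (s, t) \<in> rel K" using assms(1) that by (auto simp: kripke_structure_def)
    then have "(s, f s) \<in> rel K" unfolding f_def by (rule someI_ex)
    then show ?thesis using assms(1) by (auto simp: kripke_structure_def)
  qed
  have "(f ^^ i) a \<in> worlds K" for i
    by (induction i) (use f assms(2) in auto)
  then have "is_path K (\<lambda>i. (f ^^ i) a)" using f by (simp add: is_path_def)
  then show ?thesis by (intro exI[of _ "\<lambda>i. (f ^^ i) a"]) simp
qed

text \<open>Everything is expressed by the word: the structure is read back from the listed sets,
  and a path from the initial state always exists.\<close>

lemma MC_Since_iff:
  "w \<in> MC_Since B \<longleftrightarrow> (\<exists>\<phi>\<in>B_formulae B. \<exists>v. w = enc_fm \<phi> @ Init_Sym # v \<and>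
     accepted (name_at w (init_pos w)) w \<and>
     bev (\<lambda>x. (name_at w (init_pos w), x) \<in> pairs Label_Sym w) \<phi>)" (is "_ \<longleftrightarrow> ?r")
proof -
  have dfa: "foldl dfa 0 w = foldl dfa 1 v"
    if "\<phi> \<in> B_formulae B" "w = enc_fm \<phi> @ Init_Sym # v" for \<phi> v
  proof -
    have "Init_Sym \<notin> set (enc_fm \<phi>)" using set_enc_fm[OF that(1)] by (auto simp: node_syms_def)
    then show ?thesis using dfa_0 that(2) by simp
  qed
  have a: "name_at w (init_pos w) = a"
    if "\<phi> \<in> B_formulae B" "w = enc_fm \<phi> @ Init_Sym # map Bit a @
      worlds_word ws @ pairs_word Edge_Sym es @ pairs_word Label_Sym ls" for \<phi> a ws es ls
  proof -
    have "no_bit (worlds_word ws @ pairs_word Edge_Sym es @ pairs_word Label_Sym ls)"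
      using no_bit_pairs[of Label_Sym "[]" ls] by (intro no_bit_worlds no_bit_pairs) auto
    from name_at_eq[OF that(2) this] show ?thesis by (simp add: init_pos_eq[OF that])
  qed
  show ?thesis
  proof
    assume "w \<in> MC_Since B"
    then obtain \<phi> K a p ws es ls where \<phi>: "\<phi> \<in> B_formulae B" and K: "kripke_structure K" "a \<in> worlds K"
      and s: "set ws = worlds K" "set es = rel K" "set ls = {(s, x). s \<in> worlds K \<and> x \<in> label K s}"
      and w: "w = enc_fm \<phi> @ Init_Sym # map Bit a @
        worlds_word ws @ pairs_word Edge_Sym es @ pairs_word Label_Sym ls"
      and p: "is_path K p" "p 0 = a" "sat K p 0 \<phi>"
      unfolding MC_Since_def encodes_instance_def encodes_kripke_def by blast
    note sets = sets_of_word[OF \<phi> w]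
    have "foldl dfa 0 w \<in> {1, 3, 5}"
      using dfa[OF \<phi> w] dfa_iff[of "map Bit a @ worlds_word ws @ pairs_word Edge_Sym es @ pairs_word Label_Sym ls"]
      by metis
    moreover have "rel K \<subseteq> worlds K \<times> worlds K" "\<forall>s\<in>worlds K. \<exists>t. (s, t) \<in> rel K"
      using K(1) by (auto simp: kripke_structure_def)
    ultimately have "accepted a w"
      unfolding accepted_def sets s using K(2) by auto
    moreover have "(a, x) \<in> pairs Label_Sym w \<longleftrightarrow> x \<in> label K (p 0)" for x
      unfolding sets s p(2) using K(2) by simp
    then have "bev (\<lambda>x. (a, x) \<in> pairs Label_Sym w) \<phi>"
      using p(3) unfolding sat_0 by simp
    ultimately show ?r
      unfolding a[OF \<phi> w] by (intro bexI[OF _ \<phi>] exI conjI) (rule w)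
  next
    assume ?r
    then obtain \<phi> v where \<phi>: "\<phi> \<in> B_formulae B" and w: "w = enc_fm \<phi> @ Init_Sym # v"
      and acc: "accepted (name_at w (init_pos w)) w"
      and b: "bev (\<lambda>x. (name_at w (init_pos w), x) \<in> pairs Label_Sym w) \<phi>" by blast
    have "foldl dfa 1 v \<in> {1, 3, 5}" using acc dfa[OF \<phi> w] by (simp add: accepted_def)
    then obtain a ws es ls where
      v: "v = map Bit a @ worlds_word ws @ pairs_word Edge_Sym es @ pairs_word Label_Sym ls"
      unfolding dfa_iff by blast
    note w' = w[unfolded v]
    note sets = sets_of_word[OF \<phi> w']
    note a' = a[OF \<phi> w']
    \<comment> \<open>A state is labelled by exactly the names listed with it.
      \<open>accepted\<close> requires the states of listed labels to be worlds, so the word does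
      encode this structure.\<close>
    define K where "K = \<lparr>worlds = set ws, rel = set es, label = \<lambda>s. {x. (s, x) \<in> set ls}\<rparr>"
    have K: "kripke_structure K" "a \<in> worlds K"
      and ls: "set ls = {(s, x). s \<in> worlds K \<and> x \<in> label K s}"
      using acc unfolding a' accepted_def sets by (auto simp: K_def kripke_structure_def)
    obtain p where p: "is_path K p" "p 0 = a" using path_exists[OF K] by blast
    have "sat K p 0 \<phi>" unfolding sat_0 using b unfolding a' sets by (simp add: p K_def)
    moreover have "encodes_instance w \<phi> K a"
      unfolding encodes_instance_def encodes_kripke_def
      using w' ls by (intro exI[of _ "worlds_word ws @ pairs_word Edge_Sym es @ pairs_word Label_Sym ls"])
        (auto simp: K_def)
    ultimately show "w \<in> MC_Since B"
      unfolding MC_Since_def using \<phi> K p by blast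
  qed
qed

lemma MC_Since_lists: "MC_Since B \<subseteq> lists (alphabet B)"
proof
  fix w assume "w \<in> MC_Since B"
  then obtain \<phi> a u where \<phi>: "\<phi> \<in> B_formulae B" and w: "w = enc_fm \<phi> @ Init_Sym # map Bit a @ u"
    and u: "\<exists>ws es ls. u = worlds_word ws @ pairs_word Edge_Sym es @ pairs_word Label_Sym ls"
    unfolding MC_Since_def encodes_instance_def encodes_kripke_def by blast
  have "set u \<subseteq> alphabet B" using u by (auto simp: alphabet_def enc_pair_def split: if_splits)
  moreover have "set (enc_fm \<phi>) \<subseteq> alphabet B"
    using set_enc_fm[OF \<phi>] by (auto simp: alphabet_def node_syms_def)
  ultimately show "w \<in> lists (alphabet B)"
    unfolding w by (auto simp: alphabet_def)
qed

section \<open>Deciding the model checking problem\<close>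

text \<open>The degree \<open>Suc R\<close> makes \<open>N w\<close> at least
  \<open>length w ^ Suc R\<close>, the capacity that the evaluation stack needs.\<close>

locale since_machine = logspace deg "TYPE(symbol)" for deg +
  fixes B :: "bool_fun set" and R :: nat
  assumes fin: "finite B" and R: "2 \<le> R" "\<And>f. f \<in> B \<Longrightarrow> fst f \<le> R" and deg: "deg = Suc R"
begin

lemma N_eq: "N w = (length w + 2) ^ Suc R"
  unfolding N_def by (rule arg_cong[OF deg, of "\<lambda>d. (length w + 2) ^ d"])

lemma dc_sym_at:
  assumes "fn G F"
  shows "dc G (\<lambda>w e. sym_at w S (F w e))"
proof (rule dc_cong[OF dc_cell[OF fn_Suc[OF assms], of "Inp ` S"]])
  fix w e
  \<comment> \<open>Letter x is in input cell x + 1. As \<open>N w\<close> exceeds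
    \<open>length w + 1\<close>, truncation never moves a position into the word.\<close>
  have "input_cell w (min (N w) (Suc x)) = (if x < length w then Inp (w ! x) else Right_End)" for x
    using N_ge[of w] by (auto simp: input_cell_def min_def)
  then show "(input_cell w (min (N w) (Suc (F w e))) \<in> Inp ` S) = sym_at w S (F w e)"
    by (auto simp: sym_at_def)
qed

lemma fn_length: "fn G (\<lambda>w e. length w)"
proof (rule fn_cong)
  show "fn G (\<lambda>w e. LEAST x. N w \<le> x \<or> \<not> sym_at w UNIV x)"
    by (rule fn_least[OF fn_N]) (rule dc_not dc_sym_at fn_snd)+
  show "(LEAST x. N w \<le> x \<or> \<not> sym_at w UNIV x) = length w" for w
    by (rule Least_equality) (use N_ge[of w] in \<open>auto simp: sym_at_def\<close>)
qed

lemmas basic = dc_not dc_and dc_or dc_imp dc_iff dc_less dc_le dc_eq dc_if fn_if fn_Suc fn_pred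
  fn_monus fn_add fn_0 fn_1 fn_N fn_length dc_ex_less dc_all_less dc_sym_at

lemma fn_next_sym: "fn G F \<Longrightarrow> fn G (\<lambda>w e. next_sym w (F w e))"
  unfolding next_sym_def
  by (rule fn_least[OF fn_length]) (assumption | rule fn_snd basic | rule fn_weak)+

lemma fn_init_pos: "fn G (\<lambda>w e. init_pos w)"
  unfolding init_pos_def
  by (rule fn_least[OF fn_length]) (assumption | rule fn_snd basic | rule fn_weak)+

text \<open>A name may have linear length and need not fit into a counter, so names are represented
  by positions and compared bit by bit.\<close>

lemma dc_name_eq:
  assumes F: "fn G F" and H: "fn G H"
  shows "dc G (\<lambda>w e. name_at w (F w e) = name_at w (H w e))"
proof -
  let ?l = "\<lambda>w i. next_sym w i - min (N w) (Suc i)"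
  let ?t = "\<lambda>w i k. sym_at w {Bit True} (min (N w) (min (N w) (Suc i) + k))"
  have "dc G (\<lambda>w e. ?l w (F w e) = ?l w (H w e) \<and> (\<forall>k < ?l w (F w e). ?t w (F w e) k = ?t w (H w e) k))"
    by (assumption | rule F H fn_snd fn_next_sym basic | rule fn_weak)+
  then show ?thesis
  proof (rule dc_cong)
    fix w e
    have l: "?l w i = next_sym w i - Suc i" for i
    proof -
      have "next_sym w i \<le> length w" unfolding next_sym_def by (rule Least_le) simp
      then show ?thesis using N_ge[of w] by (simp add: min_def)
    qed
    have t: "?t w i k \<longleftrightarrow> sym_at w {Bit True} (Suc i + k)" for i k
      using N_ge[of w] by (auto simp: sym_at_def min_def)
    show "(?l w (F w e) = ?l w (H w e) \<and> (\<forall>k < ?l w (F w e). ?t w (F w e) k = ?t w (H w e) k)) =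
        (name_at w (F w e) = name_at w (H w e))"
      unfolding l t name_at_def list_eq_iff_nth_eq by auto
  qed
qed

lemma const_le: "k \<le> Suc R \<Longrightarrow> k \<le> 2 ^ deg"
  using less_exp[of deg] unfolding deg by linarith

lemma finite_nodes: "finite (node_syms B)"
  using fin by (simp add: node_syms_def)

lemma ar_le: "ar B x \<le> R"
  by (cases x) (use R in auto)

lemma fn_ar:
  assumes "fn G F"
  shows "fn G (\<lambda>w e. if sym_at w UNIV (F w e) then ar B (w ! F w e) else 0)"
proof (rule fn_cases[OF finite_nodes, where P = "\<lambda>x w e. sym_at w {x} (F w e)" and F = "\<lambda>x w e. ar B x"])
  show "dc G (\<lambda>w e. sym_at w {x} (F w e))" for x by (rule dc_sym_at[OF assms])
  show "fn G (\<lambda>w e. ar B x)" for x by (rule fn_const[OF const_le]) (use ar_le[of x] in simp)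
  fix w e assume *: "\<And>x. x \<in> node_syms B \<Longrightarrow> \<not> sym_at w {x} (F w e)"
  show "(if sym_at w UNIV (F w e) then ar B (w ! F w e) else 0) = 0"
    using *[of "w ! F w e"] by (cases "w ! F w e") (auto simp: sym_at_def node_syms_def)
qed (auto simp: sym_at_def)

text \<open>One pass over the word. The truncated sums are exact, because at most
  \<open>1 + R * j\<close> slots are open at position j and this stays within
  \<open>N w\<close>.\<close>

lemma fn_dep:
  assumes F: "fn G F"
  shows "fn G (\<lambda>w e. dep B w (F w e))"
proof -
  let ?a = "\<lambda>w i. if sym_at w UNIV i then ar B (w ! i) else 0"
  let ?S = "\<lambda>w e i a. if sym_at w bits i then a else min (N w) (a + ?a w i) - 1"
  let ?K = "\<lambda>w e. if F w e < length w then F w e else length w"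
  have rec: "fn G (\<lambda>w e. rec_nat (Suc 0) (?S w e) (?K w e))"
    by (rule fn_rec) (assumption | rule F fn_snd fn_ar basic | rule fn_weak)+
  have le: "dep B w j \<le> 1 + R * j" if "j \<le> length w" for w j
    using that
  proof (induction j)
    case (Suc j)
    then show ?case
      using ar_le[of "w ! j"] by (auto simp: dep_def take_Suc_conv_app_nth upd_def)
  qed (simp add: dep_def)
  have N: "1 + R * length w \<le> N w" for w
  proof -
    \<comment> \<open>The base \<open>length w + 2\<close> is at least 2, so its R-th power already
      covers the factor R + 1.\<close>
    have "R + 1 \<le> 2 ^ R" using less_exp[of R] by (simp add: Suc_le_eq)
    also have "\<dots> \<le> (length w + 2) ^ R" by (rule power_mono) auto
    finally have "(length w + 2) * (R + 1) \<le> N w"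
      unfolding N_eq power_Suc by (rule mult_le_mono2)
    then show ?thesis by (simp add: algebra_simps)
  qed
  have dep: "rec_nat (Suc 0) (?S w e) j = dep B w j" if "j \<le> length w" for w e j
    using that
  proof (induction j)
    case (Suc j)
    then have j: "j < length w" by simp
    have "dep B w j + ar B (w ! j) \<le> 1 + R * Suc j"
      using le[of j w] ar_le[of "w ! j"] j by simp
    also have "\<dots> \<le> 1 + R * length w" using Suc.prems by (intro add_left_mono mult_le_mono2)
    finally have "min (N w) (dep B w j + ar B (w ! j)) = dep B w j + ar B (w ! j)"
      using N[of w] by simp
    moreover have "dep B w (Suc j) = upd B (w ! j) (dep B w j)"
      using j by (simp add: dep_def take_Suc_conv_app_nth)
    ultimately show ?case using Suc j by (simp add: upd_def sym_at_def)
  qed (simp add: dep_def)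
  have "rec_nat (Suc 0) (?S w e) (?K w e) = dep B w (F w e)" for w e
    using dep[of "?K w e" w] by (simp add: dep_def)
  then show ?thesis using rec by (rule_tac fn_cong)
qed

lemma fn_en: "fn G F \<Longrightarrow> fn G (\<lambda>w e. en B w (F w e))"
  unfolding en_def
  by (rule fn_least[OF fn_length]) (assumption | rule fn_snd fn_dep basic | rule fn_weak)+

lemma dc_has_left: "fn G F \<Longrightarrow> dc G (\<lambda>w e. has_left B w (F w e))"
  unfolding has_left_def by (rule dc_sym_at)

lemma dc_has_right: "fn G F \<Longrightarrow> dc G (\<lambda>w e. has_right B w (F w e))"
  unfolding has_right_def by (assumption | rule fn_snd fn_en basic | rule fn_weak)+

lemma fn_forest_end: "fn G F \<Longrightarrow> fn G (\<lambda>w e. forest_end B w (F w e))"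
  unfolding forest_end_def
  by (rule fn_least[OF fn_length]) (assumption | rule fn_snd fn_en basic | rule fn_weak)+

lemma dc_heavy_left:
  assumes F: "fn G F"
  shows "dc G (\<lambda>w e. heavy_left B w (F w e))"
proof (rule dc_cong)
  \<comment> \<open>Subtracting \<open>F w e\<close> and then 1 avoids the truncated
    successor.\<close>
  show "dc G (\<lambda>w e. forest_end B w (F w e) - en B w (F w e) \<le> en B w (F w e) - F w e - 1)"
    by (assumption | rule F fn_snd fn_en fn_forest_end basic | rule fn_weak)+
qed (simp add: heavy_left_def)

lemma fn_parent:
  assumes F: "fn G F"
  shows "fn G (\<lambda>w e. parent B w (F w e))"
proof -
  have l: "fn G (\<lambda>w e. LEAST j. length w \<le> j \<or>
      node_at B w j \<and> en B w j = F w e \<and> has_right B w j)"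
    by (rule fn_least[OF fn_length]) (assumption | rule F fn_snd fn_en dc_has_right basic | rule fn_weak)+
  show ?thesis
    unfolding parent_def by (assumption | rule F l fn_snd fn_en dc_has_right basic | rule fn_weak)+
qed

lemma dc_wf_formula: "dc G (\<lambda>w e. wf_formula B w)"
  unfolding wf_formula_def
  by (assumption | rule fn_snd fn_dep fn_init_pos basic | rule fn_weak)+

definition labelled :: "symbol list \<Rightarrow> nat \<Rightarrow> bool" where
  "labelled w i \<longleftrightarrow> (\<exists>j<length w. sym_at w {Label_Sym} j \<and>
     name_at w j = name_at w (init_pos w) \<and> name_at w (next_sym w j) = name_at w i)"

lemma dc_labelled: "fn G F \<Longrightarrow> dc G (\<lambda>w e. labelled w (F w e))"
  unfolding labelled_def
  by (assumption | rule fn_snd dc_name_eq fn_next_sym fn_init_pos basic | rule fn_weak)+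

lemma labelled_iff:
  "labelled w i \<longleftrightarrow> (name_at w (init_pos w), name_at w i) \<in> pairs Label_Sym w"
  unfolding labelled_def pairs_positions by (auto simp: sym_at_def image_iff)

definition "q = (2 :: nat) ^ Suc R"

lemma q_le: "q \<le> 2 ^ deg"
  by (simp add: q_def deg)

lemma q_pos: "0 < q"
  by (simp add: q_def)

text \<open>The connectives are arbitrary functions, but there are finitely many of them, acting on
  values below \<open>q\<close>; their action is a table built into the program.\<close>

lemma fn_op_at:
  assumes F: "fn G F" and A: "fn G A" and C: "fn G C"
  shows "fn G (\<lambda>w e. op_at B w q (labelled w) (F w e) (A w e) (C w e))"
proof -
  let ?D = "node_syms B \<times> (UNIV :: bool set) \<times> {..<q} \<times> {..<q}"
  let ?P = "\<lambda>(x, t, a, c) w e. sym_at w {x} (F w e) \<and> labelled w (F w e) = t \<and> A w e = a \<and> C w e = c"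
  let ?F = "\<lambda>(x, t, a, c) w e. comb q x t a c"
  show ?thesis
  proof (rule fn_cases[where D = "?D"
        and P = "?P"
        and F = "?F"])
    show "finite ?D"
      by (simp add: finite_nodes)
  next
    fix d assume d: "d \<in> ?D"
    obtain x t a c where d': "d = (x, t, a, c)" by (cases d)
    have ac: "a \<le> 2 ^ deg" "c \<le> 2 ^ deg" using d q_le by (auto simp: d')
    have t: "dc G (\<lambda>w e. t)" using dc_True dc_False by (cases t) auto
    have "dc G (\<lambda>w e. sym_at w {x} (F w e) \<and> labelled w (F w e) = t \<and> A w e = a \<and> C w e = c)"
      by (rule dc_and dc_sym_at dc_iff dc_labelled dc_eq t F A C fn_const[OF ac(1)] fn_const[OF ac(2)])+
    then show "dc G (?P d)"
      by (simp add: d')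
    have "comb q x t a c < q" using q_pos by (simp add: comb_def)
    then have "comb q x t a c \<le> 2 ^ deg" using q_le by linarith
    then show "fn G (?F d)"
      by (simp add: d' fn_const)
  next
    fix w e d
    assume "d \<in> ?D"
      "?P d w e"
    then show "op_at B w q (labelled w) (F w e) (A w e) (C w e) = ?F d w e"
      by (auto simp: op_at_def sym_at_def)
  next
    fix w e
    assume *: "\<And>d. d \<in> ?D \<Longrightarrow>
      \<not> ?P d w e"
    show "op_at B w q (labelled w) (F w e) (A w e) (C w e) = 0"
      using *[of "(w ! F w e, labelled w (F w e), A w e, C w e)"] by (auto simp: op_at_def sym_at_def)
  qed
qed

section \<open>Transition functions of the evaluation\<close>

abbreviation "from_left' w \<equiv> tree_steps.from_left (has_left B w) (parent B w)"
abbreviation "next_pos' w \<equiv>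
  tree_steps.next_pos (has_left B w) (has_right B w) (heavy_left B w) (en B w) (parent B w)"
abbreviation "next_mode' w \<equiv> tree_steps.next_mode (has_left B w) (has_right B w) (heavy_left B w)
  (parent B w) (op_at B w q (labelled w)) (Suc 0) q (N w)"
abbreviation "next_stack' w \<equiv> tree_steps.next_stack (has_left B w) (has_right B w) (heavy_left B w)
  (parent B w) q (N w)"

lemma dc_from_left:
  assumes F: "fn G F"
  shows "dc G (\<lambda>w e. from_left' w (F w e))"
proof (rule dc_cong)
  \<comment> \<open>\<open>Suc p = i\<close> is expressed through the predecessor of i, since
    successors are truncated.\<close>
  show "dc G (\<lambda>w e. has_left B w (parent B w (F w e)) \<and> 0 < F w e \<and> parent B w (F w e) = F w e - 1)"
    by (rule F fn_parent dc_has_left dc_pos basic)+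
qed (auto simp: tree_steps.from_left_def)

lemma min_Suc_left: "has_left B w i \<Longrightarrow> min (N w) (Suc i) = Suc i"
  using N_ge[of w] by (simp add: has_left_def sym_at_def)

lemma fn_next_pos:
  assumes F: "fn G F" and A: "fn G A"
  shows "fn G (\<lambda>w e. next_pos' w (F w e) (A w e) s)"
proof (rule fn_cong)
  show "fn G (\<lambda>w e. (if A w e = 0
      then if has_left B w (F w e) \<and> (\<not> has_right B w (F w e) \<or> heavy_left B w (F w e))
        then min (N w) (Suc (F w e)) else if has_right B w (F w e) then en B w (F w e) else F w e
      else if from_left' w (F w e)
        then if has_right B w (parent B w (F w e)) \<and> heavy_left B w (parent B w (F w e))
          then en B w (parent B w (F w e)) else parent B w (F w e)
      else if has_left B w (parent B w (F w e)) \<and> \<not> heavy_left B w (parent B w (F w e))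
        then min (N w) (Suc (parent B w (F w e))) else parent B w (F w e)))"
    by (rule F A fn_parent fn_en dc_has_left dc_has_right dc_heavy_left dc_from_left basic)+
qed (simp add: tree_steps.next_pos_def min_Suc_left)

lemma q_le_N: "q \<le> N w"
  using q_le power_mono[of 2 "length w + 2" deg] by (simp add: N_def)

lemma fn_Suc_op_at:
  assumes "fn G F" "fn G A" "fn G C"
  shows "fn G (\<lambda>w e. Suc (op_at B w q (labelled w) (F w e) (A w e) (C w e)))"
proof (rule fn_cong[OF fn_Suc[OF fn_op_at[OF assms]]])
  fix w e
  have "op_at B w q (labelled w) (F w e) (A w e) (C w e) < q"
    using q_pos by (simp add: op_at_def comb_def)
  then show "min (N w) (Suc (op_at B w q (labelled w) (F w e) (A w e) (C w e))) =
      Suc (op_at B w q (labelled w) (F w e) (A w e) (C w e))"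
    using q_le_N[of w] by simp
qed

lemma fn_next_mode:
  assumes F: "fn G F" and A: "fn G A" and C: "fn G C"
  shows "fn G (\<lambda>w e. next_mode' w (F w e) (A w e) (C w e))"
proof (rule fn_cong)
  let ?op = "\<lambda>w. op_at B w q (labelled w)" and ?p = "\<lambda>w e. parent B w (F w e)"
  let ?top = "\<lambda>w e. if C w e < N w then C w e mod q else 0"
  show "fn G (\<lambda>w e. (if A w e = 0 then
      if has_left B w (F w e) \<or> has_right B w (F w e) then 0 else Suc (?op w (F w e) (Suc 0) (Suc 0))
    else if from_left' w (F w e) then
      if \<not> has_right B w (?p w e) then Suc (?op w (?p w e) (A w e - 1) (Suc 0))
      else if heavy_left B w (?p w e) then 0 else Suc (?op w (?p w e) (A w e - 1) (?top w e))
    else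
      if \<not> has_left B w (?p w e) then Suc (?op w (?p w e) (Suc 0) (A w e - 1))
      else if heavy_left B w (?p w e) then Suc (?op w (?p w e) (?top w e) (A w e - 1)) else 0))"
    by (rule F A C fn_parent fn_mod[OF C q_pos] fn_Suc_op_at dc_has_left dc_has_right dc_heavy_left
        dc_from_left basic)+
qed (simp add: tree_steps.next_mode_def tree_steps.top_def)

lemma fn_next_stack:
  assumes F: "fn G F" and A: "fn G A" and C: "fn G C"
  shows "fn G (\<lambda>w e. next_stack' w (F w e) (A w e) (C w e))"
proof (rule fn_cong)
  let ?p = "\<lambda>w e. parent B w (F w e)"
  let ?pop = "\<lambda>w e. if C w e < N w then C w e div q else C w e"
  let ?push = "\<lambda>w e. min (N w) (min (N w) (q * C w e) + (A w e - 1))"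
  show "fn G (\<lambda>w e. (if A w e = 0 then C w e
    else if from_left' w (F w e) then
      if \<not> has_right B w (?p w e) then C w e
      else if heavy_left B w (?p w e) then ?push w e else ?pop w e
    else
      if \<not> has_left B w (?p w e) then C w e
      else if heavy_left B w (?p w e) then ?pop w e else ?push w e))"
    by (rule F A C fn_parent fn_div[OF C q_pos] fn_mult dc_has_left dc_has_right dc_heavy_left
        dc_from_left basic)+
qed (simp add: tree_steps.next_stack_def tree_steps.pop_def tree_steps.push_def)

text \<open>The loop has to stop on malformed words as well; there the guard ends it at
  once.\<close>

abbreviation "cont' w \<equiv> \<lambda>(x, y, z). wf_formula B w \<and> (0 < x \<or> y = 0)"
abbreviation "step' w \<equiv> \<lambda>(x, y, z). (next_pos' w x y 0, next_mode' w x y z, next_stack' w x y z)"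

definition result :: "symbol list \<Rightarrow> nat" where
  "result w = fst (snd (halt (cont' w) (step' w) (0, 0, 0)))"

lemma evaluation:
  assumes "\<phi> \<in> B_formulae B" "w = enc_fm \<phi> @ Init_Sym # v"
  shows "result w = Suc (code [bev (\<lambda>x. (name_at w (init_pos w), x) \<in> pairs Label_Sym w) \<phi>])"
    and "\<exists>t. \<not> cont' w ((step' w ^^ t) (0, 0, 0))"
proof -
  have "length w ^ Suc R \<le> N w"
    unfolding N_eq by (rule power_mono) simp_all
  then interpret fm: formula_machine B w R q "N w" "labelled w"
    by unfold_locales (simp_all add: q_def R)
  have "wf_formula B w" using assms unfolding wf_formula_iff by blast
  then have b: "cont' w = fm.cont"
    by (auto simp: fm.cont_def fun_eq_iff)
  have s: "step' w = fm.step"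
    unfolding fm.step_def by (auto simp: fun_eq_iff tree_steps.next_pos_def)
  note fm = fm.formula_machine[OF assms, of "\<lambda>x. (name_at w (init_pos w), x) \<in> pairs Label_Sym w",
      OF labelled_iff]
  show "result w = Suc (code [bev (\<lambda>x. (name_at w (init_pos w), x) \<in> pairs Label_Sym w) \<phi>])"
    unfolding result_def b s fm(1) by simp
  show "\<exists>t. \<not> cont' w ((step' w ^^ t) (0, 0, 0))"
    unfolding b s by (rule fm(2))
qed

lemma fn_result: "fn G (\<lambda>w e. result w)"
  unfolding result_def
proof (rule fn_loop[where B = "\<lambda>w e x y z. wf_formula B w \<and> (0 < x \<or> y = 0)"
      and ?S1.0 = "\<lambda>w e x y z. next_pos' w x y 0" and ?S2.0 = "\<lambda>w e x y z. next_mode' w x y z"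
      and ?S3.0 = "\<lambda>w e x y z. next_stack' w x y z", OF fn_0 fn_0 fn_0])
  let ?x = "\<lambda>w p. snd (fst (fst p))" and ?y = "\<lambda>w p. snd (fst p)" and ?z = "\<lambda>w p. snd p"
  have x: "fn (ext (ext (ext G))) ?x" by (rule fn_weak[OF fn_weak[OF fn_snd]])
  have y: "fn (ext (ext (ext G))) ?y" by (rule fn_weak[OF fn_snd])
  have z: "fn (ext (ext (ext G))) ?z" by (rule fn_snd)
  have "dc (ext (ext (ext G))) (\<lambda>w p. wf_formula B w \<and> (0 < ?x w p \<or> ?y w p = 0))"
    by (rule dc_wf_formula dc_pos x y basic)+
  then show "fn (ext (ext (ext G))) (\<lambda>w p. if wf_formula B w \<and> (0 < ?x w p \<or> ?y w p = 0) then 1 else 0)"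
    by (simp add: dc_def)
  show "fn (ext (ext (ext G))) (\<lambda>w p. next_pos' w (?x w p) (?y w p) 0)"
    by (rule fn_next_pos[OF x y])
  show "fn (ext (ext (ext G))) (\<lambda>w p. next_mode' w (?x w p) (?y w p) (?z w p))"
    by (rule fn_next_mode[OF x y z])
  show "fn (ext (ext (ext G))) (\<lambda>w p. next_stack' w (?x w p) (?y w p) (?z w p))"
    by (rule fn_next_stack[OF x y z])
  fix w :: "symbol list"
  show "\<exists>t. \<not> cont' w ((step' w ^^ t) (0, 0, 0))"
  proof (cases "wf_formula B w")
    case True
    then obtain \<phi> v where "\<phi> \<in> B_formulae B" "w = enc_fm \<phi> @ Init_Sym # v"
      unfolding wf_formula_iff by blast
    then show ?thesis by (rule evaluation(2))
  next
    case False
    then show ?thesis by (intro exI[of _ 0]) simp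
  qed
qed

section \<open>Checking the description of the structure\<close>

lemma finite_alphabet: "finite (alphabet B)"
proof -
  have "finite bits" by (rule finite_imageI) simp
  then show ?thesis using fin by (simp add: alphabet_def)
qed

text \<open>The guards make each step a finite table; on words over the alphabet they always
  hold.\<close>

definition dfa_run :: "symbol list \<Rightarrow> nat" where
  "dfa_run w = rec_nat 0
     (\<lambda>i s. if s \<le> 6 \<and> sym_at w (alphabet B) i then dfa s (w ! i) else 0) (length w)"

lemma dfa_run:
  assumes "w \<in> lists (alphabet B)"
  shows "dfa_run w = foldl dfa 0 w"
proof -
  have "rec_nat 0 (\<lambda>i s. if s \<le> 6 \<and> sym_at w (alphabet B) i then dfa s (w ! i) else 0) j =
      foldl dfa 0 (take j w) \<and> foldl dfa 0 (take j w) \<le> 6" if "j \<le> length w" for j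
    using that
  proof (induction j)
    case (Suc j)
    have "sym_at w (alphabet B) j" using assms Suc.prems by (auto simp: sym_at_def)
    then show ?case using Suc dfa_le by (simp add: take_Suc_conv_app_nth)
  qed simp
  from this[of "length w"] show ?thesis by (simp add: dfa_run_def)
qed

lemma fn_dfa_step:
  assumes F: "fn G F" and A: "fn G A"
  shows "fn G (\<lambda>w e. if A w e \<le> 6 \<and> sym_at w (alphabet B) (F w e) then dfa (A w e) (w ! F w e) else 0)"
proof (rule fn_cases[where D = "{..6} \<times> alphabet B"
      and P = "\<lambda>(s, x) w e. A w e = s \<and> sym_at w {x} (F w e)" and F = "\<lambda>(s, x) w e. dfa s x"])
  show "finite ({..6::nat} \<times> alphabet B)" using finite_alphabet by simp
next
  fix d assume d: "d \<in> {..6::nat} \<times> alphabet B"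
  have six: "6 \<le> (2::nat) ^ deg"
    using R power_increasing[of 3 deg "2::nat"] by (simp add: deg)
  obtain s x where d': "d = (s, x)" by (cases d)
  have s: "s \<le> 2 ^ deg" "dfa s x \<le> 2 ^ deg" using d six dfa_le[of s x] by (auto simp: d')
  have "dc G (\<lambda>w e. A w e = s \<and> sym_at w {x} (F w e))"
    by (rule dc_and dc_eq dc_sym_at F A fn_const[OF s(1)])+
  then show "dc G ((\<lambda>(s, x) w e. A w e = s \<and> sym_at w {x} (F w e)) d)" by (simp add: d')
  show "fn G ((\<lambda>(s, x) w e. dfa s x) d)" using fn_const[OF s(2)] by (simp add: d')
next
  fix w e d
  assume "d \<in> {..6} \<times> alphabet B" "(\<lambda>(s, x) w e. A w e = s \<and> sym_at w {x} (F w e)) d w e"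
  then show "(if A w e \<le> 6 \<and> sym_at w (alphabet B) (F w e) then dfa (A w e) (w ! F w e) else 0) =
      (\<lambda>(s, x) w e. dfa s x) d w e"
    by (auto simp: sym_at_def)
next
  fix w e
  assume *: "\<And>d. d \<in> {..6} \<times> alphabet B \<Longrightarrow> \<not> (\<lambda>(s, x) w e. A w e = s \<and> sym_at w {x} (F w e)) d w e"
  show "(if A w e \<le> 6 \<and> sym_at w (alphabet B) (F w e) then dfa (A w e) (w ! F w e) else 0) = 0"
    using *[of "(A w e, w ! F w e)"] by (auto simp: sym_at_def)
qed

lemma fn_dfa_run: "fn G (\<lambda>w e. dfa_run w)"
  unfolding dfa_run_def
  by (rule fn_rec) (rule fn_length fn_0 fn_dfa_step fn_snd fn_weak)+

definition world_at :: "symbol list \<Rightarrow> nat \<Rightarrow> bool" where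
  "world_at w i \<longleftrightarrow> (\<exists>j<length w. sym_at w {World_Sym} j \<and> name_at w j = name_at w i)"

lemma dc_world_at: "fn G F \<Longrightarrow> dc G (\<lambda>w e. world_at w (F w e))"
  unfolding world_at_def by (assumption | rule fn_snd dc_name_eq basic | rule fn_weak)+

lemma world_at_iff: "world_at w i \<longleftrightarrow> name_at w i \<in> fst ` pairs World_Sym w"
  unfolding world_at_def pairs_positions by (force simp: sym_at_def image_iff)

definition accepts :: "symbol list \<Rightarrow> bool" where
  "accepts w \<longleftrightarrow> (dfa_run w = 1 \<or> dfa_run w = 3 \<or> dfa_run w = 5) \<and> world_at w (init_pos w) \<and>
     (\<forall>i<length w. sym_at w {Edge_Sym} i \<longrightarrow> world_at w i \<and> world_at w (next_sym w i)) \<and>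
     (\<forall>i<length w. sym_at w {World_Sym} i \<longrightarrow>
        (\<exists>j<length w. sym_at w {Edge_Sym} j \<and> name_at w j = name_at w i)) \<and>
     (\<forall>i<length w. sym_at w {Label_Sym} i \<longrightarrow> world_at w i)"

lemma accepts_iff:
  assumes "w \<in> lists (alphabet B)"
  shows "accepts w \<longleftrightarrow> accepted (name_at w (init_pos w)) w"
proof -
  have lt: "sym_at w S i \<Longrightarrow> i < length w" for S i by (simp add: sym_at_def)
  have all_lt: "(\<forall>i<length w. sym_at w S i \<longrightarrow> P i) \<longleftrightarrow> (\<forall>i. sym_at w S i \<longrightarrow> P i)" for S P
    using lt by blast
  have ex_lt: "(\<exists>i<length w. sym_at w S i \<and> P i) \<longleftrightarrow> (\<exists>i. sym_at w S i \<and> P i)" for S P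
    using lt by blast
  have 1: "(\<forall>(x, y)\<in>pairs Edge_Sym w. x \<in> fst ` pairs World_Sym w \<and> y \<in> fst ` pairs World_Sym w) \<longleftrightarrow>
      (\<forall>i<length w. sym_at w {Edge_Sym} i \<longrightarrow> world_at w i \<and> world_at w (next_sym w i))"
    unfolding world_at_iff pairs_positions[of Edge_Sym] using lt by auto
  have 2: "(\<forall>x\<in>fst ` pairs World_Sym w. \<exists>y. (x, y) \<in> pairs Edge_Sym w) \<longleftrightarrow>
      (\<forall>i<length w. sym_at w {World_Sym} i \<longrightarrow>
        (\<exists>j<length w. sym_at w {Edge_Sym} j \<and> name_at w j = name_at w i))"
    unfolding pairs_positions image_image fst_conv all_lt ex_lt
    by (auto simp: image_iff) metis+
  have 3: "(\<forall>(s, x)\<in>pairs Label_Sym w. s \<in> fst ` pairs World_Sym w) \<longleftrightarrow>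
      (\<forall>i<length w. sym_at w {Label_Sym} i \<longrightarrow> world_at w i)"
    unfolding world_at_iff pairs_positions[of Label_Sym] using lt by auto
  show ?thesis
    unfolding accepts_def accepted_def 1 2 3 dfa_run[OF assms] world_at_iff[of w "init_pos w"] by simp
qed

lemma dc_accepts: "dc G (\<lambda>w e. accepts w)"
proof -
  have c: "1 \<le> (2::nat) ^ deg" "3 \<le> (2::nat) ^ deg" "5 \<le> (2::nat) ^ deg"
    using R power_increasing[of 3 deg "2::nat"] by (simp_all add: deg)
  show ?thesis
    unfolding accepts_def
    by (rule fn_snd dc_name_eq dc_world_at fn_next_sym fn_init_pos fn_dfa_run
        fn_const[OF c(1)] fn_const[OF c(2)] fn_const[OF c(3)] basic | rule fn_weak)+
qed

lemma MC_Since_decides: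
  assumes "w \<in> lists (alphabet B)"
  shows "w \<in> MC_Since B \<longleftrightarrow> wf_formula B w \<and> accepts w \<and> result w = 4"
proof -
  \<comment> \<open>\<open>code [True]\<close> is 3, and the final mode is the successor of the
    value; hence 4.\<close>
  have "result w = 4 \<longleftrightarrow> bev (\<lambda>x. (name_at w (init_pos w), x) \<in> pairs Label_Sym w) \<phi>"
    if "\<phi> \<in> B_formulae B" "w = enc_fm \<phi> @ Init_Sym # v" for \<phi> v
    using evaluation(1)[OF that] by simp
  then show ?thesis
    unfolding MC_Since_iff wf_formula_iff accepts_iff[OF assms] by blast
qed

lemma MC_Since_logspace: "logspace_decidable (alphabet B) (MC_Since B)"
proof (rule decidable_predicate[OF finite_alphabet MC_Since_lists])
  have four: "4 \<le> (2::nat) ^ deg"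
    using R power_increasing[of 2 deg "2::nat"] by (simp add: deg)
  show "dc ({} :: (unit \<Rightarrow> nat) set) (\<lambda>w e. wf_formula B w \<and> accepts w \<and> result w = 4)"
    by (rule dc_wf_formula dc_accepts fn_result fn_const[OF four] basic)+
qed (rule MC_Since_decides)

end

theorem theorem12:
  fixes B :: "bool_fun set"
  assumes "finite B"
  shows "logspace_decidable (alphabet B) (MC_Since B)"
proof -
  \<comment> \<open>The 2 accounts for \<open>Since\<close>. It also makes \<open>2 ^ Suc R\<close>
    at least 8, large enough for the constants of the program, such as the states of the
    automaton.\<close>
  define R where "R = Max (insert 2 (fst ` B))"
  have fin: "finite (insert 2 (fst ` B))" using assms by simp
  interpret since_machine "Suc R" B R
  proof
    show "2 \<le> R" "\<And>f. f \<in> B \<Longrightarrow> fst f \<le> R"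
      unfolding R_def using Max_ge[OF fin] by simp_all
  qed (use assms in simp_all)
  show ?thesis by (rule MC_Since_logspace)
qed

end
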